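(* Let $T$ be a complete theory of fields in a language $L\supseteq L_{\mathrm{rings}}$. If $T$ is $\omega$-stable, then $\mathrm{ACF}_T$ is $\omega$-stable.
   Context: $L_{\mathrm{rings}}$ is the language of rings. A theory of fields is a theory in a language $L\supseteq L_{\mathrm{rings}}$ which contains all the field axioms. $\mathrm{ACF}$ is the theory of algebraically closed fields. The theory $\mathrm{ACF}_T$: let $L^P=L\cup\{P\}$ with $P$ a unary predicate. $\mathrm{ACF}_T$ is the $L^P$-theory consisting of $\mathrm{ACF}$ (for the $L_{\mathrm{rings}}$-reduct of the universe) together with: (1) $P$ is a subfield of the universe; (2) $P$ (with the induced $L$-structure) is a model of $T$; (3) for every $n$-ary function symbol $f\in L\setminus L_{\mathrm{rings}}$: if $x_0,\dots,x_{n-1}\in P$ then $f(x_0,\dots,x_{n-1})\in P$, and if some $x_i\notin P$ then $f(x_0,\dots,x_{n-1})=0$; (4) for every $n$-ary relation symbol $R\in L$, if some $x_i\notin P$ then $\lnot R(x_0,\dots,x_{n-1})$; (5) the degree of the field extension of the universe over $P$ is infinite. (When $T$ is complete, $\mathrm{ACF}_T$ is complete.) *)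

theory Defs
  imports "HOL-Algebra.Algebraic_Closure" "HOL-Library.Countable_Set"
begin

section \<open>First-order logic\<close>

record ('f, 'r) language =
  funs :: "'f set"
  rels :: "'r set"
  far :: "'f \<Rightarrow> nat"
  rar :: "'r \<Rightarrow> nat"

definition sublanguage :: "('f, 'r) language \<Rightarrow> ('f, 'r) language \<Rightarrow> bool" where
  "sublanguage L L' \<longleftrightarrow> funs L \<subseteq> funs L' \<and> rels L \<subseteq> rels L' \<and>
     (\<forall>f\<in>funs L. far L f = far L' f) \<and> (\<forall>R\<in>rels L. rar L R = rar L' R)"

datatype 'f tm = Var nat | Fun 'f "'f tm list"

datatype ('f, 'r) fm =
    Falsum
  | Eq "'f tm" "'f tm"
  | Rel 'r "'f tm list"
  | Imp "('f, 'r) fm" "('f, 'r) fm"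
  | Forall nat "('f, 'r) fm"

abbreviation Neg :: "('f, 'r) fm \<Rightarrow> ('f, 'r) fm" where
  "Neg \<phi> \<equiv> Imp \<phi> Falsum"
abbreviation Conj :: "('f, 'r) fm \<Rightarrow> ('f, 'r) fm \<Rightarrow> ('f, 'r) fm" where
  "Conj \<phi> \<psi> \<equiv> Neg (Imp \<phi> (Neg \<psi>))"
abbreviation Exists :: "nat \<Rightarrow> ('f, 'r) fm \<Rightarrow> ('f, 'r) fm" where
  "Exists i \<phi> \<equiv> Neg (Forall i (Neg \<phi>))"

definition Conjs :: "('f, 'r) fm list \<Rightarrow> ('f, 'r) fm" where
  "Conjs \<phi>s = foldr Conj \<phi>s (Neg Falsum)"
definition Alls :: "nat list \<Rightarrow> ('f, 'r) fm \<Rightarrow> ('f, 'r) fm" where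
  "Alls is \<phi> = foldr Forall is \<phi>"
definition Exs :: "nat list \<Rightarrow> ('f, 'r) fm \<Rightarrow> ('f, 'r) fm" where
  "Exs is \<phi> = foldr Exists is \<phi>"

primrec fv_tm :: "'f tm \<Rightarrow> nat set" where
  "fv_tm (Var i) = {i}"
| "fv_tm (Fun f ts) = \<Union> (set (map fv_tm ts))"

primrec fv :: "('f, 'r) fm \<Rightarrow> nat set" where
  "fv Falsum = {}"
| "fv (Eq s t) = fv_tm s \<union> fv_tm t"
| "fv (Rel R ts) = \<Union> (set (map fv_tm ts))"
| "fv (Imp \<phi> \<psi>) = fv \<phi> \<union> fv \<psi>"
| "fv (Forall i \<phi>) = fv \<phi> - {i}"

primrec wf_tm :: "('f, 'r) language \<Rightarrow> 'f tm \<Rightarrow> bool" where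
  "wf_tm L (Var i) \<longleftrightarrow> True"
| "wf_tm L (Fun f ts) \<longleftrightarrow> f \<in> funs L \<and> length ts = far L f \<and> list_all id (map (wf_tm L) ts)"

primrec wf_fm :: "('f, 'r) language \<Rightarrow> ('f, 'r) fm \<Rightarrow> bool" where
  "wf_fm L Falsum \<longleftrightarrow> True"
| "wf_fm L (Eq s t) \<longleftrightarrow> wf_tm L s \<and> wf_tm L t"
| "wf_fm L (Rel R ts) \<longleftrightarrow> R \<in> rels L \<and> length ts = rar L R \<and> list_all (wf_tm L) ts"
| "wf_fm L (Imp \<phi> \<psi>) \<longleftrightarrow> wf_fm L \<phi> \<and> wf_fm L \<psi>"
| "wf_fm L (Forall i \<phi>) \<longleftrightarrow> wf_fm L \<phi>"

definition sentences :: "('f, 'r) language \<Rightarrow> ('f, 'r) fm set" where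
  "sentences L = {\<phi>. wf_fm L \<phi> \<and> fv \<phi> = {}}"

record ('a, 'f, 'r) struct =
  univ :: "'a set"
  ifun :: "'f \<Rightarrow> 'a list \<Rightarrow> 'a"
  irel :: "'r \<Rightarrow> 'a list \<Rightarrow> bool"

definition is_struct :: "('f, 'r) language \<Rightarrow> ('a, 'f, 'r) struct \<Rightarrow> bool" where
  "is_struct L M \<longleftrightarrow> univ M \<noteq> {} \<and>
     (\<forall>f\<in>funs L. \<forall>xs. set xs \<subseteq> univ M \<and> length xs = far L f \<longrightarrow> ifun M f xs \<in> univ M)"

primrec val :: "('a, 'f, 'r) struct \<Rightarrow> (nat \<Rightarrow> 'a) \<Rightarrow> 'f tm \<Rightarrow> 'a" where
  "val M e (Var i) = e i"
| "val M e (Fun f ts) = ifun M f (map (val M e) ts)"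

primrec sat :: "('a, 'f, 'r) struct \<Rightarrow> (nat \<Rightarrow> 'a) \<Rightarrow> ('f, 'r) fm \<Rightarrow> bool" where
  "sat M e Falsum \<longleftrightarrow> False"
| "sat M e (Eq s t) \<longleftrightarrow> val M e s = val M e t"
| "sat M e (Rel R ts) \<longleftrightarrow> irel M R (map (val M e) ts)"
| "sat M e (Imp \<phi> \<psi>) \<longleftrightarrow> (sat M e \<phi> \<longrightarrow> sat M e \<psi>)"
| "sat M e (Forall i \<phi>) \<longleftrightarrow> (\<forall>a\<in>univ M. sat M (e(i := a)) \<phi>)"

definition true_in :: "('a, 'f, 'r) struct \<Rightarrow> ('f, 'r) fm \<Rightarrow> bool" where
  "true_in M \<phi> \<longleftrightarrow> (\<forall>e. range e \<subseteq> univ M \<longrightarrow> sat M e \<phi>)"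

definition is_model :: "('f, 'r) language \<Rightarrow> ('a, 'f, 'r) struct \<Rightarrow> ('f, 'r) fm set \<Rightarrow> bool" where
  "is_model L M T \<longleftrightarrow> is_struct L M \<and> (\<forall>\<phi>\<in>T. true_in M \<phi>)"


section \<open>Complete theories, types and omega-stability\<close>

text \<open>
  A HOL formula cannot quantify over types, so notions that refer to all models of a theory
  carry a type argument: the models considered are those whose universe is a subset of that type.
  The type \<^typ>\<open>('f, 'r) fm\<close> is a canonical choice for theories over symbols from 'f and 'r: it is
  infinite and has at least as many elements as there are formulas of any such language, so, by
  Loewenheim-Skolem, consistency, entailment and omega-stability evaluated over this type agree
  with the same notions evaluated over models of arbitrary size.
\<close>

definition entails ::
    "'u itself \<Rightarrow> ('f, 'r) language \<Rightarrow> ('f, 'r) fm set \<Rightarrow> ('f, 'r) fm \<Rightarrow> bool" where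
  "entails U L T \<phi> \<longleftrightarrow> (\<forall>M :: ('u, 'f, 'r) struct. is_model L M T \<longrightarrow> true_in M \<phi>)"

definition complete_theory :: "'u itself \<Rightarrow> ('f, 'r) language \<Rightarrow> ('f, 'r) fm set \<Rightarrow> bool" where
  "complete_theory U L T \<longleftrightarrow> T \<subseteq> sentences L \<and>
     (\<exists>M :: ('u, 'f, 'r) struct. is_model L M T) \<and>
     (\<forall>\<phi>\<in>sentences L. entails U L T \<phi> \<or> entails U L T (Neg \<phi>))"

text \<open>The language L(A), and the expansion of M by a constant for every element.\<close>

definition add_consts :: "('f, 'r) language \<Rightarrow> 'a set \<Rightarrow> ('f + 'a, 'r) language" where
  "add_consts L A = \<lparr>funs = Inl ` funs L \<union> Inr ` A, rels = rels L,
     far = case_sum (far L) (\<lambda>_. 0), rar = rar L\<rparr>"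

definition expand :: "('a, 'f, 'r) struct \<Rightarrow> ('a, 'f + 'a, 'r) struct" where
  "expand M = \<lparr>univ = univ M, ifun = case_sum (ifun M) (\<lambda>a _. a), irel = irel M\<rparr>"

definition param_forms ::
    "('f, 'r) language \<Rightarrow> 'a set \<Rightarrow> nat \<Rightarrow> ('f + 'a, 'r) fm set" where
  "param_forms L A n = {\<phi>. wf_fm (add_consts L A) \<phi> \<and> fv \<phi> \<subseteq> {..<n}}"

definition finitely_satisfiable :: "('a, 'f, 'r) struct \<Rightarrow> ('f + 'a, 'r) fm set \<Rightarrow> bool" where
  "finitely_satisfiable M p \<longleftrightarrow>
     (\<forall>q. q \<subseteq> p \<and> finite q \<longrightarrow> (\<exists>e. range e \<subseteq> univ M \<and> (\<forall>\<phi>\<in>q. sat (expand M) e \<phi>)))"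

text \<open>
  The space of complete n-types over A, that is, of maximal finitely satisfiable sets of
  L(A)-formulas in the free variables 0, ..., n - 1.
\<close>

definition types ::
    "('f, 'r) language \<Rightarrow> ('a, 'f, 'r) struct \<Rightarrow> 'a set \<Rightarrow> nat \<Rightarrow> ('f + 'a, 'r) fm set set" where
  "types L M A n = {p. p \<subseteq> param_forms L A n \<and> finitely_satisfiable M p \<and>
     (\<forall>q. p \<subseteq> q \<and> q \<subseteq> param_forms L A n \<and> finitely_satisfiable M q \<longrightarrow> q = p)}"

definition omega_stable :: "'u itself \<Rightarrow> ('f, 'r) language \<Rightarrow> ('f, 'r) fm set \<Rightarrow> bool" where
  "omega_stable U L T \<longleftrightarrow> (\<forall>M :: ('u, 'f, 'r) struct. is_model L M T \<longrightarrow>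
     (\<forall>A n. A \<subseteq> univ M \<and> countable A \<longrightarrow> countable (types L M A n)))"


section \<open>Fields\<close>

text \<open>
  The function symbols of every language L considered below live in this type, so that the ring
  symbols are available in it; minus is unary. Which of the symbols actually belong to L is
  recorded by \<^term>\<open>funs L\<close>.
\<close>

datatype 'f rsym = RZero | ROne | RPlus | RMinus | RTimes | Extra 'f

definition L_rings :: "('f rsym, 'r) language" where
  "L_rings = \<lparr>funs = {RZero, ROne, RPlus, RMinus, RTimes}, rels = {},
     far = (\<lambda>f. case f of RMinus \<Rightarrow> 1 | RPlus \<Rightarrow> 2 | RTimes \<Rightarrow> 2 | _ \<Rightarrow> 0), rar = (\<lambda>_. 0)\<rparr>"

abbreviation "zero_tm \<equiv> Fun RZero []"
abbreviation "one_tm \<equiv> Fun ROne []"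
abbreviation "plus_tm s t \<equiv> Fun RPlus [s, t]"
abbreviation "minus_tm s \<equiv> Fun RMinus [s]"
abbreviation "times_tm s t \<equiv> Fun RTimes [s, t]"

definition field_ax :: "('f rsym, 'r) fm set" where
  "field_ax = (let x = Var 0; y = Var 1; z = Var 2 in
    {Alls [0,1,2] (Eq (plus_tm (plus_tm x y) z) (plus_tm x (plus_tm y z))),
     Alls [0,1] (Eq (plus_tm x y) (plus_tm y x)),
     Alls [0] (Eq (plus_tm x zero_tm) x),
     Alls [0] (Eq (plus_tm x (minus_tm x)) zero_tm),
     Alls [0,1,2] (Eq (times_tm (times_tm x y) z) (times_tm x (times_tm y z))),
     Alls [0,1] (Eq (times_tm x y) (times_tm y x)),
     Alls [0] (Eq (times_tm x one_tm) x),
     Alls [0,1,2] (Eq (times_tm x (plus_tm y z)) (plus_tm (times_tm x y) (times_tm x z))),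
     Neg (Eq zero_tm one_tm),
     Alls [0] (Imp (Neg (Eq x zero_tm)) (Exists 1 (Eq (times_tm x y) one_tm)))})"

definition theory_of_fields :: "('f rsym, 'r) language \<Rightarrow> ('f rsym, 'r) fm set \<Rightarrow> bool" where
  "theory_of_fields L T \<longleftrightarrow> sublanguage L_rings L \<and> T \<subseteq> sentences L \<and> field_ax \<subseteq> T"

text \<open>The polynomial with coefficients cs, leading one first, at t, in Horner form.\<close>

definition poly_tm :: "'f rsym tm list \<Rightarrow> 'f rsym tm \<Rightarrow> 'f rsym tm" where
  "poly_tm cs t = foldl (\<lambda>s c. plus_tm (times_tm s t) c) zero_tm cs"

text \<open>Every monic polynomial of degree n, with coefficients the variables below n, has a root.\<close>

definition root_axiom :: "nat \<Rightarrow> ('f rsym, 'r) fm" where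
  "root_axiom n =
     Alls [0..<n] (Exists n (Eq (poly_tm (one_tm # map Var [0..<n]) (Var n)) zero_tm))"

definition ACF :: "('f rsym, 'r) fm set" where
  "ACF = field_ax \<union> {root_axiom n |n. n \<ge> 1}"


section \<open>Algebraically closed fields with a predicate for a model of T\<close>

datatype 'r psym = Base 'r | SubP

definition add_pred :: "('f, 'r) language \<Rightarrow> ('f, 'r psym) language" where
  "add_pred L = \<lparr>funs = funs L, rels = insert SubP (Base ` rels L), far = far L,
     rar = (\<lambda>R. case R of Base R' \<Rightarrow> rar L R' | SubP \<Rightarrow> 1)\<rparr>"

abbreviation in_P :: "'f tm \<Rightarrow> ('f, 'r psym) fm" where
  "in_P t \<equiv> Rel SubP [t]"

primrec relativize :: "('f, 'r) fm \<Rightarrow> ('f, 'r psym) fm" where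
  "relativize Falsum = Falsum"
| "relativize (Eq s t) = Eq s t"
| "relativize (Rel R ts) = Rel (Base R) ts"
| "relativize (Imp \<phi> \<psi>) = Imp (relativize \<phi>) (relativize \<psi>)"
| "relativize (Forall i \<phi>) = Forall i (Imp (in_P (Var i)) (relativize \<phi>))"

definition subfield_ax :: "('f rsym, 'r psym) fm set" where
  "subfield_ax = (let x = Var 0; y = Var 1 in
    {in_P zero_tm, in_P one_tm,
     Alls [0,1] (Imp (Conj (in_P x) (in_P y)) (in_P (plus_tm x y))),
     Alls [0] (Imp (in_P x) (in_P (minus_tm x))),
     Alls [0,1] (Imp (Conj (in_P x) (in_P y)) (in_P (times_tm x y))),
     Alls [0,1] (Imp (Conj (in_P x) (Eq (times_tm x y) one_tm)) (in_P y))})"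

definition all_in_P :: "nat list \<Rightarrow> ('f, 'r psym) fm" where
  "all_in_P is = Conjs (map (\<lambda>i. in_P (Var i)) is)"

definition fun_axioms :: "('f rsym, 'r) language \<Rightarrow> 'f rsym \<Rightarrow> ('f rsym, 'r psym) fm set" where
  "fun_axioms L f = (let vs = [0..<far L f]; t = Fun f (map Var vs) in
     {Alls vs (Imp (all_in_P vs) (in_P t)),
      Alls vs (Imp (Neg (all_in_P vs)) (Eq t zero_tm))})"

definition rel_axiom :: "('f rsym, 'r) language \<Rightarrow> 'r \<Rightarrow> ('f rsym, 'r psym) fm" where
  "rel_axiom L R = (let vs = [0..<rar L R] in
     Alls vs (Imp (Neg (all_in_P vs)) (Neg (Rel (Base R) (map Var vs)))))"

definition lin_comb_tm :: "'f rsym tm list \<Rightarrow> 'f rsym tm list \<Rightarrow> 'f rsym tm" where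
  "lin_comb_tm ks us = foldr (\<lambda>(k, u) s. plus_tm (times_tm k u) s) (zip ks us) zero_tm"

text \<open>
  There are n elements (the variables below n) that are linearly independent over P; the
  coefficients are the variables from n on. The degree is infinite iff this holds for all n.
\<close>

definition degree_axiom :: "nat \<Rightarrow> ('f rsym, 'r psym) fm" where
  "degree_axiom n = (let us = [0..<n]; ks = [n..<2 * n] in
     Exs us (Alls ks (Imp
       (Conj (all_in_P ks) (Eq (lin_comb_tm (map Var ks) (map Var us)) zero_tm))
       (Conjs (map (\<lambda>k. Eq (Var k) zero_tm) ks)))))"

definition ACF_T :: "('f rsym, 'r) language \<Rightarrow> ('f rsym, 'r) fm set \<Rightarrow> ('f rsym, 'r psym) fm set" where
  "ACF_T L T = ACF \<union> subfield_ax \<union> relativize ` T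
     \<union> (\<Union>f \<in> funs L - funs (L_rings :: ('f rsym, 'r) language). fun_axioms L f)
     \<union> rel_axiom L ` rels L
     \<union> range degree_axiom"

end

(* Let M be a model of ACF_T and N a countable ultrapower of M, with field K and subfield F. By
   omega-stability of T, types over countable subsets of F are determined by countably many
   formulas, so F is homogeneous for countable sequences. Two finite tuples e, e' of K are
   equivalent if for some sequences y, y' in F of the same type, and for all finite extensions of
   y, y' to sequences of the same type, the same integer polynomials vanish at (y, e) and (y', e').
   This equivalence has the back-and-forth property: an element algebraic over F(e) is matched with
   a root of the corresponding minimal polynomial, and a transcendental one with a transcendental
   one. Transcendental elements over every such F(e') may be missing, but then K is algebraic over
   F(c) for some countable sequence c, which can be added to the parameters. Hence the type of a tuple is given by a tower of minimal
   polynomials and the type in F of their coefficients, which leaves countably many realized types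
   over a countable set. Since N is countably saturated, all types are then countable in number:
   otherwise either a binary tree of formulas yields uncountably many realized types, or there
   are uncountably many types that are determined by countably many formulas, and so realized. *)

theory Submission
  imports Defs
begin

section \<open>Families of formulas and their types\<close>

text \<open>The language may be uncountable. A type over a countable set is then not a countable set
  of formulas, and a countably saturated structure need not realize it; each time a type has to be
  realized, it is first cut down to countably many formulas. The equivalence quantifies over all
  matched extensions of y, y' for two reasons: algebraic relations may use any coefficients in F,
  and a term of L evaluated inside F yields elements of F that no polynomial in y reaches.
  Polynomials are kept as integer expressions that can be read on both sides, so Euclidean division
  is replaced by pseudo-division, which inverts nothing. That the parameters are equivalent to
  themselves is not trivial, since matched extensions differ in F. The sequence y must contain
  enough coefficients of linear relations over F between polynomials in the parameters. Finally,
  omega-stability of T speaks of models inside the type of formulas, while F consists of sequences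
  in 'u; a Skolem hull bridges the two.\<close>

definition fin_sat :: "'x set \<Rightarrow> ('x \<Rightarrow> 'i \<Rightarrow> bool) \<Rightarrow> 'i set \<Rightarrow> bool" where
  "fin_sat W h p \<longleftrightarrow> (\<forall>q. q \<subseteq> p \<and> finite q \<longrightarrow> (\<exists>x\<in>W. \<forall>\<phi>\<in>q. h x \<phi>))"

definition max_types :: "'x set \<Rightarrow> ('x \<Rightarrow> 'i \<Rightarrow> bool) \<Rightarrow> 'i set \<Rightarrow> 'i set set" where
  "max_types W h \<Phi> = {p. p \<subseteq> \<Phi> \<and> fin_sat W h p \<and>
     (\<forall>q. p \<subseteq> q \<and> q \<subseteq> \<Phi> \<and> fin_sat W h q \<longrightarrow> q = p)}"

definition realized_type :: "('x \<Rightarrow> 'i \<Rightarrow> bool) \<Rightarrow> 'i set \<Rightarrow> 'x \<Rightarrow> 'i set" where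
  "realized_type h \<Phi> x = {\<phi>\<in>\<Phi>. h x \<phi>}"

lemma fin_sat_mono: "fin_sat W h p \<Longrightarrow> q \<subseteq> p \<Longrightarrow> fin_sat W h q"
  unfolding fin_sat_def by blast

text \<open>Zorn's lemma applies because a finite subset of the union of a nonempty chain already
  lies in one member.\<close>

lemma fin_sat_extend:
  assumes p: "p \<subseteq> \<Phi>" "fin_sat W h p"
  shows "\<exists>q\<in>max_types W h \<Phi>. p \<subseteq> q"
proof -
  let ?A = "{q. p \<subseteq> q \<and> q \<subseteq> \<Phi> \<and> fin_sat W h q}"
  have "\<exists>M\<in>?A. \<forall>Y\<in>?A. M \<subseteq> Y \<longrightarrow> Y = M"
  proof (rule subset_Zorn_nonempty)
    show "?A \<noteq> {}" using p by auto
  next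
    fix C assume C: "C \<noteq> {}" "subset.chain ?A C"
    have "fin_sat W h (\<Union>C)"
      unfolding fin_sat_def
    proof (intro allI impI)
      fix q assume q: "q \<subseteq> \<Union>C \<and> finite q"
      then obtain Y where "Y \<in> C" "q \<subseteq> Y"
        using finite_subset_Union_chain[of q C ?A] C by auto
      moreover from this have "fin_sat W h Y" using C(2) unfolding subset_chain_def by auto
      ultimately show "\<exists>x\<in>W. \<forall>\<phi>\<in>q. h x \<phi>"
        using q unfolding fin_sat_def by auto
    qed
    then show "\<Union>C \<in> ?A" using C unfolding subset_chain_def by blast
  qed
  then obtain M where M: "M \<in> ?A" "\<forall>Y\<in>?A. M \<subseteq> Y \<longrightarrow> Y = M" by (elim bexE)
  have "q = M" if "M \<subseteq> q" "q \<subseteq> \<Phi>" "fin_sat W h q" for q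
    using M that by auto
  then have "M \<in> max_types W h \<Phi>" using M(1) unfolding max_types_def by auto
  then show ?thesis using M(1) by auto
qed

text \<open>One framework for several uses: formulas with constants, formulas read at tuples over a
  parameter sequence, formulas of the ultrapower, and sets of naturals, whose maximal types are
  ultrafilters.\<close>

locale boolean_family =
  fixes W :: "'x set" and h :: "'x \<Rightarrow> 'i \<Rightarrow> bool" and \<Phi> :: "'i set"
    and ng :: "'i \<Rightarrow> 'i" and cn :: "'i \<Rightarrow> 'i \<Rightarrow> 'i" and tt :: 'i
  assumes ng: "\<phi> \<in> \<Phi> \<Longrightarrow> ng \<phi> \<in> \<Phi>" "\<phi> \<in> \<Phi> \<Longrightarrow> x \<in> W \<Longrightarrow> h x (ng \<phi>) \<longleftrightarrow> \<not> h x \<phi>"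
    and cn: "\<phi> \<in> \<Phi> \<Longrightarrow> \<psi> \<in> \<Phi> \<Longrightarrow> cn \<phi> \<psi> \<in> \<Phi>"
      "\<phi> \<in> \<Phi> \<Longrightarrow> \<psi> \<in> \<Phi> \<Longrightarrow> x \<in> W \<Longrightarrow> h x (cn \<phi> \<psi>) \<longleftrightarrow> h x \<phi> \<and> h x \<psi>"
    and tt: "tt \<in> \<Phi>" "x \<in> W \<Longrightarrow> h x tt"
begin

abbreviation "Ty \<equiv> max_types W h \<Phi>"

lemma type_subset: "p \<in> Ty \<Longrightarrow> p \<subseteq> \<Phi>"
  by (auto simp: max_types_def)

lemma type_fin_sat: "p \<in> Ty \<Longrightarrow> finite q \<Longrightarrow> q \<subseteq> p \<Longrightarrow> \<exists>x\<in>W. \<forall>\<phi>\<in>q. h x \<phi>"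
  by (auto simp: max_types_def fin_sat_def)

text \<open>If neither formula could be added, finite parts \<open>q\<close> and \<open>r\<close> of
  \<open>p\<close> would exclude \<phi> and its negation, and a witness of their union could satisfy
  neither.\<close>

lemma type_complete:
  assumes p: "p \<in> Ty" and \<phi>: "\<phi> \<in> \<Phi>"
  shows "\<phi> \<in> p \<or> ng \<phi> \<in> p"
proof (rule ccontr)
  assume n: "\<not> (\<phi> \<in> p \<or> ng \<phi> \<in> p)"
  have *: "\<exists>q. finite q \<and> q \<subseteq> p \<and> \<not> (\<exists>x\<in>W. (\<forall>\<phi>\<in>q. h x \<phi>) \<and> h x \<psi>)"
    if "\<psi> \<notin> p" "\<psi> \<in> \<Phi>" for \<psi>
  proof -
    have "\<not> fin_sat W h (insert \<psi> p)"
      using p that unfolding max_types_def by (metis (mono_tags, lifting) insertI1 insert_subset mem_Collect_eq subset_insertI)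
    then obtain q where q: "q \<subseteq> insert \<psi> p" "finite q" "\<not> (\<exists>x\<in>W. \<forall>\<phi>\<in>q. h x \<phi>)"
      unfolding fin_sat_def by auto
    then show ?thesis by (intro exI[of _ "q - {\<psi>}"]) auto
  qed
  obtain q where q: "finite q" "q \<subseteq> p" "\<not> (\<exists>x\<in>W. (\<forall>\<phi>\<in>q. h x \<phi>) \<and> h x \<phi>)"
    using *[of \<phi>] n \<phi> by auto
  obtain r where r: "finite r" "r \<subseteq> p" "\<not> (\<exists>x\<in>W. (\<forall>\<phi>\<in>r. h x \<phi>) \<and> h x (ng \<phi>))"
    using *[of "ng \<phi>"] n \<phi> ng(1) by auto
  obtain x where "x \<in> W" "\<forall>\<phi>\<in>q \<union> r. h x \<phi>"
    using type_fin_sat[OF p, of "q \<union> r"] q r by auto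
  then show False using q(3) r(3) ng \<phi> by blast
qed

lemma type_not_both: "p \<in> Ty \<Longrightarrow> \<phi> \<in> p \<Longrightarrow> ng \<phi> \<notin> p"
  using type_fin_sat[of p "{\<phi>, ng \<phi>}"] ng(2) type_subset by fastforce

lemma type_upward:
  assumes p: "p \<in> Ty" and q: "finite q" "q \<subseteq> p" and \<psi>: "\<psi> \<in> \<Phi>"
    and "\<And>x. x \<in> W \<Longrightarrow> \<forall>\<phi>\<in>q. h x \<phi> \<Longrightarrow> h x \<psi>"
  shows "\<psi> \<in> p"
proof (rule ccontr)
  assume "\<psi> \<notin> p"
  then have "ng \<psi> \<in> p" using type_complete[OF p \<psi>] by auto
  then obtain x where "x \<in> W" "\<forall>\<phi>\<in>insert (ng \<psi>) q. h x \<phi>"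
    using type_fin_sat[OF p, of "insert (ng \<psi>) q"] q by auto
  then show False using assms(5) ng \<psi> by auto
qed

lemma type_cn:
  assumes p: "p \<in> Ty" and f: "\<phi> \<in> \<Phi>" "\<psi> \<in> \<Phi>"
  shows "cn \<phi> \<psi> \<in> p \<longleftrightarrow> \<phi> \<in> p \<and> \<psi> \<in> p"
proof
  assume "cn \<phi> \<psi> \<in> p"
  then show "\<phi> \<in> p \<and> \<psi> \<in> p"
    using type_upward[OF p, of "{cn \<phi> \<psi>}"] f cn(2)[OF f] by auto
next
  assume "\<phi> \<in> p \<and> \<psi> \<in> p"
  then show "cn \<phi> \<psi> \<in> p"
    using type_upward[OF p, of "{\<phi>, \<psi>}" "cn \<phi> \<psi>"] cn[OF f] by auto
qed

lemma type_tt: "p \<in> Ty \<Longrightarrow> tt \<in> p"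
  using type_upward[of p "{}"] tt by auto

lemma type_eqI:
  assumes "p \<in> Ty" "q \<in> Ty" "p \<subseteq> q"
  shows "p = q"
  using assms type_complete type_not_both type_subset by blast

lemma complete_type:
  assumes p: "p \<subseteq> \<Phi>" "fin_sat W h p" "\<And>\<phi>. \<phi> \<in> \<Phi> \<Longrightarrow> \<phi> \<in> p \<or> ng \<phi> \<in> p"
  shows "p \<in> Ty"
  using fin_sat_extend[OF p(1,2)] type_not_both p
  by (metis subsetD subsetI subset_antisym type_subset)

lemma realized_type_in: "x \<in> W \<Longrightarrow> realized_type h \<Phi> x \<in> Ty"
  by (rule complete_type) (auto simp: realized_type_def fin_sat_def ng intro!: bexI[of _ x])

text \<open>If \<open>\<phi>\<close> belongs to p and to only countably many other types, one separating formula for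
  each of these isolates p by a countable subset.\<close>

lemma countably_determined:
  assumes p: "p \<in> Ty" "\<phi> \<in> p" and c: "countable {q\<in>Ty. \<phi> \<in> q}"
  shows "\<exists>\<Delta>\<subseteq>p. countable \<Delta> \<and> (\<forall>q\<in>Ty. \<Delta> \<subseteq> q \<longrightarrow> q = p)"
proof -
  have "\<exists>\<psi>. \<psi> \<in> p \<and> \<psi> \<notin> q" if "q \<in> Ty" "q \<noteq> p" for q
    using type_eqI[OF p(1) that(1)] that(2) by blast
  then obtain s where s: "\<And>q. q \<in> Ty \<Longrightarrow> q \<noteq> p \<Longrightarrow> s q \<in> p \<and> s q \<notin> q" by metis
  let ?D = "insert \<phi> (s ` ({q\<in>Ty. \<phi> \<in> q} - {p}))"
  have "?D \<subseteq> p" using s p by auto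
  moreover have "countable ?D" using c by auto
  moreover have "\<forall>q\<in>Ty. ?D \<subseteq> q \<longrightarrow> q = p" using s by blast
  ultimately show ?thesis by blast
qed

text \<open>A Cantor-Bendixson argument with countability of \<open>\<Phi>\<close> replaced by
  \<open>saturated\<close>. Either big formulas keep splitting and the branches of a binary tree are
  realized by points of different types, or below a non-splitting formula all types but at most one
  contain a small formula and are realized for that reason.\<close>

lemma countable_types:
  assumes saturated: "\<And>\<Delta>. \<Delta> \<subseteq> \<Phi> \<Longrightarrow> countable \<Delta> \<Longrightarrow> fin_sat W h \<Delta> \<Longrightarrow> \<exists>x\<in>W. \<forall>\<phi>\<in>\<Delta>. h x \<phi>"
    and realized: "countable (realized_type h \<Phi> ` W)"
  shows "countable Ty"
proof (rule ccontr)
  assume unc: "uncountable Ty"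
  define big where "big \<phi> \<longleftrightarrow> uncountable {p\<in>Ty. \<phi> \<in> p}" for \<phi>
  have "{p\<in>Ty. tt \<in> p} = Ty" using type_tt by blast
  then have big_tt: "big tt" unfolding big_def using unc by simp
  show False
  proof (cases "\<forall>\<phi>\<in>\<Phi>. big \<phi> \<longrightarrow> (\<exists>\<psi>\<in>\<Phi>. big (cn \<phi> \<psi>) \<and> big (cn \<phi> (ng \<psi>)))")
    case True
    then obtain sp where sp: "\<And>\<phi>. \<phi> \<in> \<Phi> \<Longrightarrow> big \<phi> \<Longrightarrow>
        sp \<phi> \<in> \<Phi> \<and> big (cn \<phi> (sp \<phi>)) \<and> big (cn \<phi> (ng (sp \<phi>)))"
      by metis
    define t where "t \<beta> n = rec_nat tt (\<lambda>n \<phi>. cn \<phi> (if \<beta> n then sp \<phi> else ng (sp \<phi>))) n"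
      for \<beta> :: "nat \<Rightarrow> bool" and n
    have t0: "t \<beta> 0 = tt" and tS: "t \<beta> (Suc n) = cn (t \<beta> n) (if \<beta> n then sp (t \<beta> n) else ng (sp (t \<beta> n)))" for \<beta> n
      by (simp_all add: t_def)
    have tb: "t \<beta> n \<in> \<Phi> \<and> big (t \<beta> n)" for \<beta> n
      by (induction n) (auto simp: t0 tS tt big_tt sp cn ng)
    have mono: "h x (t \<beta> m)" if "h x (t \<beta> n)" "m \<le> n" "x \<in> W" for x \<beta> m n
      using that(2,1) by (induction rule: inc_induct) (use that tb sp cn ng in \<open>auto simp: tS split: if_splits\<close>)
    have "\<exists>x\<in>W. \<forall>n. h x (t \<beta> n)" for \<beta>
    proof -
      have "\<exists>x\<in>W. \<forall>\<phi>\<in>range (t \<beta>). h x \<phi>"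
      proof (rule saturated)
        show "fin_sat W h (range (t \<beta>))"
          unfolding fin_sat_def
        proof (intro allI impI)
          fix q assume "q \<subseteq> range (t \<beta>) \<and> finite q"
          then obtain I where I: "finite I" "q = t \<beta> ` I"
            by (metis finite_subset_image)
          obtain n where n: "\<forall>i\<in>I. i \<le> n" using I(1) by (metis finite_nat_set_iff_bounded_le)
          \<comment> \<open>Bigness enters only here: some type contains \<open>t \<beta> n\<close>,
            so some point satisfies the first \<open>n\<close> choices.\<close>
          have "{p\<in>Ty. t \<beta> n \<in> p} \<noteq> {}" using tb[of \<beta> n] unfolding big_def by force
          then obtain p where "p \<in> Ty" "t \<beta> n \<in> p" by blast
          then obtain x where "x \<in> W" "h x (t \<beta> n)" using type_fin_sat[of p "{t \<beta> n}"] by auto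
          then show "\<exists>x\<in>W. \<forall>\<phi>\<in>q. h x \<phi>" using mono n I by blast
        qed
      qed (use tb in auto)
      then show ?thesis by auto
    qed
    then obtain w where w: "\<And>\<beta>. w \<beta> \<in> W" "\<And>\<beta> n. h (w \<beta>) (t \<beta> n)" by metis
    have "inj (\<lambda>\<beta>. realized_type h \<Phi> (w \<beta>))"
    proof (rule injI, rule ccontr)
      fix \<beta> \<gamma> assume eq: "realized_type h \<Phi> (w \<beta>) = realized_type h \<Phi> (w \<gamma>)" and "\<beta> \<noteq> \<gamma>"
      then have ex: "\<exists>n. \<beta> n \<noteq> \<gamma> n" by auto
      define n where "n = (LEAST n. \<beta> n \<noteq> \<gamma> n)"
      have n: "\<beta> n \<noteq> \<gamma> n" "\<And>m. m < n \<Longrightarrow> \<beta> m = \<gamma> m"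
        unfolding n_def using LeastI_ex[OF ex] not_less_Least by auto
      have "t \<beta> m = t \<gamma> m" if "m \<le> n" for m
        using that by (induction m) (auto simp: t0 tS n(2))
      then have e: "t \<beta> n = t \<gamma> n" by auto
      \<comment> \<open>The branches agree below \<open>n\<close>, so both split at the same
        formula, one choosing it and the other its negation.\<close>
      let ?s = "sp (t \<beta> n)"
      have s: "?s \<in> \<Phi>" using sp tb by auto
      have "h (w \<beta>) ?s \<longleftrightarrow> \<beta> n"
        using w(2)[of \<beta> "Suc n"] w(1)[of \<beta>] tb[of \<beta> n] sp[of "t \<beta> n"] ng cn
        by (auto simp: tS split: if_splits)
      moreover have "h (w \<gamma>) ?s \<longleftrightarrow> \<gamma> n"
        using w(2)[of \<gamma> "Suc n"] w(1)[of \<gamma>] tb[of \<gamma> n] sp[of "t \<gamma> n"] ng cn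
        by (auto simp: tS e split: if_splits)
      moreover have "h (w \<beta>) ?s = h (w \<gamma>) ?s" using eq s unfolding realized_type_def by auto
      ultimately show False using n(1) by auto
    qed
    moreover have "range (\<lambda>\<beta>. realized_type h \<Phi> (w \<beta>)) \<subseteq> realized_type h \<Phi> ` W"
      using w(1) by auto
    ultimately have "countable (UNIV :: (nat \<Rightarrow> bool) set)"
      using realized by (meson countable_image_inj_on countable_subset)
    then obtain f :: "nat \<Rightarrow> nat \<Rightarrow> bool" where "surj f"
      by (metis UNIV_not_empty range_from_nat_into)
    then obtain k where "f k = (\<lambda>n. \<not> f n n)" by (metis surjD)
    then show False by metis
  next
    case False
    then obtain \<phi> where \<phi>: "\<phi> \<in> \<Phi>" "big \<phi>"
      and ns: "\<And>\<psi>. \<psi> \<in> \<Phi> \<Longrightarrow> \<not> (big (cn \<phi> \<psi>) \<and> big (cn \<phi> (ng \<psi>)))" by blast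
    \<comment> \<open>This set need not be a type. As \<phi> does not split, a type through \<phi>
      whose members are all big together with \<phi> can only be \<open>p\<close>.\<close>
    define p where "p = {\<psi>\<in>\<Phi>. big (cn \<phi> \<psi>)}"
    have disj: "q = p \<or> q \<in> realized_type h \<Phi> ` W" if q: "q \<in> Ty" "\<phi> \<in> q" for q
    proof (cases "\<forall>\<psi>\<in>q. big (cn \<phi> \<psi>)")
      case True
      then have "q \<subseteq> p" using type_subset[OF q(1)] by (auto simp: p_def)
      moreover have "p \<subseteq> q"
        using True ns type_complete[OF q(1)] by (auto simp: p_def)
      ultimately show ?thesis by auto
    next
      case False
      \<comment> \<open>Only countably many types contain the small formula
        \<open>cn \<phi> \<psi>\<close>, so a countable subset isolates \<open>q\<close>, and a
        point satisfying that subset realizes \<open>q\<close>.\<close>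
      then obtain \<psi> where \<psi>: "\<psi> \<in> q" "\<not> big (cn \<phi> \<psi>)" by blast
      have m: "cn \<phi> \<psi> \<in> q" using type_cn[OF q(1)] \<psi> q type_subset[OF q(1)] \<phi> by blast
      obtain \<Delta> where \<Delta>: "\<Delta> \<subseteq> q" "countable \<Delta>" "\<forall>r\<in>Ty. \<Delta> \<subseteq> r \<longrightarrow> r = q"
        using countably_determined[OF q(1) m] \<psi>(2) unfolding big_def by blast
      have "\<Delta> \<subseteq> \<Phi>" using \<Delta>(1) type_subset[OF q(1)] by blast
      moreover have "fin_sat W h \<Delta>"
        using q(1) fin_sat_mono[OF _ \<Delta>(1)] unfolding max_types_def by auto
      ultimately obtain x where x: "x \<in> W" "\<forall>\<phi>\<in>\<Delta>. h x \<phi>" using saturated \<Delta>(2) by blast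
      then have "\<Delta> \<subseteq> realized_type h \<Phi> x" using \<open>\<Delta> \<subseteq> \<Phi>\<close> by (auto simp: realized_type_def)
      then show ?thesis using \<Delta>(3) realized_type_in x(1) by blast
    qed
    have "{q\<in>Ty. \<phi> \<in> q} \<subseteq> insert p (realized_type h \<Phi> ` W)"
      by (rule subsetI) (use disj in simp)
    then show False using \<phi>(2) realized unfolding big_def by (meson countable_insert countable_subset)
  qed
qed

end

section \<open>Comparing the types of different families\<close>

text \<open>Types are injected by translating them and extending the image to a maximal type. Two
  different types disagree on some \<phi>, and \<open>neg\<close> makes the translations of \<phi>
  and its negation incompatible; the translation has to respect negation only as to truth on
  \<open>W'\<close>.\<close>

lemma countable_types_transfer:
  assumes F: "boolean_family W h \<Phi> ng cn tt" and G: "boolean_family W' h' \<Phi>' ng' cn' tt'"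
    and tr: "\<And>\<phi>. \<phi> \<in> \<Phi> \<Longrightarrow> tr \<phi> \<in> \<Phi>'"
    and w: "\<And>x. x \<in> W \<Longrightarrow> \<exists>x'\<in>W'. \<forall>\<phi>\<in>\<Phi>. h' x' (tr \<phi>) \<longleftrightarrow> h x \<phi>"
    and neg: "\<And>\<phi> x'. \<phi> \<in> \<Phi> \<Longrightarrow> x' \<in> W' \<Longrightarrow> h' x' (tr (ng \<phi>)) \<longleftrightarrow> \<not> h' x' (tr \<phi>)"
    and c: "countable (max_types W' h' \<Phi>')"
  shows "countable (max_types W h \<Phi>)"
proof -
  interpret F: boolean_family W h \<Phi> ng cn tt by (rule F)
  interpret G: boolean_family W' h' \<Phi>' ng' cn' tt' by (rule G)
  have "\<exists>q\<in>G.Ty. tr ` p \<subseteq> q" if p: "p \<in> F.Ty" for p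
  proof (rule fin_sat_extend)
    show "tr ` p \<subseteq> \<Phi>'" using F.type_subset[OF p] tr by auto
    show "fin_sat W' h' (tr ` p)"
      unfolding fin_sat_def
    proof (intro allI impI)
      fix q assume "q \<subseteq> tr ` p \<and> finite q"
      then obtain r where r: "r \<subseteq> p" "finite r" "q = tr ` r" by (metis finite_subset_image)
      then obtain x where "x \<in> W" "\<forall>\<phi>\<in>r. h x \<phi>" using F.type_fin_sat[OF p] by blast
      then obtain x' where "x' \<in> W'" "\<forall>\<phi>\<in>\<Phi>. h' x' (tr \<phi>) \<longleftrightarrow> h x \<phi>" using w by blast
      moreover from this have "\<forall>\<phi>\<in>q. h' x' \<phi>"
        using r F.type_subset[OF p] \<open>\<forall>\<phi>\<in>r. h x \<phi>\<close> by auto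
      ultimately show "\<exists>x\<in>W'. \<forall>\<phi>\<in>q. h' x \<phi>" by auto
    qed
  qed
  then obtain g where g: "\<And>p. p \<in> F.Ty \<Longrightarrow> g p \<in> G.Ty \<and> tr ` p \<subseteq> g p" by metis
  have "inj_on g F.Ty"
  proof (rule inj_onI, rule F.type_eqI)
    fix p q assume pq: "p \<in> F.Ty" "q \<in> F.Ty" "g p = g q"
    show "p \<subseteq> q"
    proof (rule ccontr)
      assume "\<not> p \<subseteq> q"
      then obtain \<phi> where \<phi>: "\<phi> \<in> p" "\<phi> \<notin> q" by blast
      then have f: "\<phi> \<in> \<Phi>" "ng \<phi> \<in> q" using F.type_subset F.type_complete pq by blast+
      then have "{tr \<phi>, tr (ng \<phi>)} \<subseteq> g p" using g pq \<phi> by auto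
      then obtain x where "x \<in> W'" "h' x (tr \<phi>)" "h' x (tr (ng \<phi>))"
        using G.type_fin_sat[of "g p" "{tr \<phi>, tr (ng \<phi>)}"] g pq by auto
      then show False using neg f by auto
    qed
  qed
  moreover have "countable (g ` F.Ty)" using c g by (metis countable_subset image_subsetI)
  ultimately show ?thesis by (rule countable_image_inj_on[rotated])
qed

text \<open>Types are plain sets of formulas, so equal finite satisfiability makes the type spaces
  literally equal. Types move in this way between a structure and a copy of its Skolem hull, and
  between a structure and its ultrapower.\<close>

lemma max_types_cong:
  assumes "\<And>p. p \<subseteq> \<Phi> \<Longrightarrow> fin_sat W h p \<longleftrightarrow> fin_sat W' h' p"
  shows "max_types W h \<Phi> = max_types W' h' \<Phi>"
  unfolding max_types_def using assms by blast

lemma types_eq_max_types: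
  "types L M A n = max_types {e. range e \<subseteq> univ M} (sat (expand M)) (param_forms L A n)"
  unfolding types_def max_types_def finitely_satisfiable_def fin_sat_def by auto

section \<open>Formulas, renaming and parameters\<close>

lemma finite_fv_tm: "finite (fv_tm t)"
  by (induction t) auto

lemma finite_fv: "finite (fv \<phi>)"
  by (induction \<phi>) (auto simp: finite_fv_tm)

lemma fv_bound: "\<exists>m. fv \<phi> \<subseteq> {..<m}"
  using finite_fv[of \<phi>] by (meson finite_nat_iff_bounded)

lemma val_cong: "(\<And>i. i \<in> fv_tm t \<Longrightarrow> e i = e' i) \<Longrightarrow> val M e t = val M e' t"
proof (induction t)
  case (Fun f ts)
  have "val M e t = val M e' t" if "t \<in> set ts" for t
    using Fun.prems that by (intro Fun.IH) auto
  then show ?case by (auto intro!: arg_cong[of _ _ "ifun M _"])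
qed auto

lemma sat_cong: "(\<And>i. i \<in> fv \<phi> \<Longrightarrow> e i = e' i) \<Longrightarrow> sat M e \<phi> \<longleftrightarrow> sat M e' \<phi>"
proof (induction \<phi> arbitrary: e e')
  case (Eq s t)
  then have "val M e s = val M e' s" "val M e t = val M e' t" by (auto intro!: val_cong)
  then show ?case by simp
next
  case (Rel R ts)
  then have "map (val M e) ts = map (val M e') ts" by (auto intro!: val_cong)
  then show ?case by (simp del: map_eq_conv)
next
  case (Forall i \<phi>)
  have "sat M (e(i := a)) \<phi> = sat M (e'(i := a)) \<phi>" for a
    using Forall.prems by (intro Forall.IH) auto
  then show ?case by simp
next
  case (Imp \<phi> \<psi>)
  have "sat M e \<phi> = sat M e' \<phi>" "sat M e \<psi> = sat M e' \<psi>"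
    using Imp.prems by (intro Imp.IH; simp)+
  then show ?case by simp
qed auto

lemma sat_Neg: "sat M e (Neg \<phi>) \<longleftrightarrow> \<not> sat M e \<phi>"
  by auto

lemma sat_Conjs: "sat M e (Conjs \<phi>s) \<longleftrightarrow> (\<forall>\<phi>\<in>set \<phi>s. sat M e \<phi>)"
  by (induction \<phi>s) (auto simp: Conjs_def)

lemma wf_Conjs: "wf_fm L (Conjs \<phi>s) \<longleftrightarrow> (\<forall>\<phi>\<in>set \<phi>s. wf_fm L \<phi>)"
  by (induction \<phi>s) (auto simp: Conjs_def)

lemma sat_Alls:
  "sat M e (Alls is \<phi>) \<longleftrightarrow>
     (\<forall>e'. (\<forall>i. i \<notin> set is \<longrightarrow> e' i = e i) \<and> e' ` set is \<subseteq> univ M \<longrightarrow> sat M e' \<phi>)"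
proof (induction "is" arbitrary: e)
  case Nil
  show ?case by (auto simp: Alls_def intro: sat_cong[THEN iffD1])
next
  case (Cons i js)
  have "sat M e (Alls (i # js) \<phi>) \<longleftrightarrow> (\<forall>a\<in>univ M. sat M (e(i := a)) (Alls js \<phi>))"
    by (simp add: Alls_def)
  also have "\<dots> \<longleftrightarrow> (\<forall>e'. (\<forall>j. j \<notin> set (i # js) \<longrightarrow> e' j = e j) \<and> e' ` set (i # js) \<subseteq> univ M \<longrightarrow> sat M e' \<phi>)"
    unfolding Cons.IH
  proof safe
    fix e' assume *: "\<forall>a\<in>univ M. \<forall>e'. (\<forall>j. j \<notin> set js \<longrightarrow> e' j = (e(i := a)) j) \<and> e' ` set js \<subseteq> univ M \<longrightarrow> sat M e' \<phi>"
      and e': "\<forall>j. j \<notin> set (i # js) \<longrightarrow> e' j = e j" "e' ` set (i # js) \<subseteq> univ M"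
    show "sat M e' \<phi>" using *[rule_format, of "e' i" e'] e' by auto
  next
    fix a e' assume *: "\<forall>e'. (\<forall>j. j \<notin> set (i # js) \<longrightarrow> e' j = e j) \<and> e' ` set (i # js) \<subseteq> univ M \<longrightarrow> sat M e' \<phi>"
      and a: "a \<in> univ M" and e': "\<forall>j. j \<notin> set js \<longrightarrow> e' j = (e(i := a)) j" "e' ` set js \<subseteq> univ M"
    have "e' i \<in> univ M" using a e' by (cases "i \<in> set js") auto
    then show "sat M e' \<phi>" using *[rule_format, of e'] e' by auto
  qed
  finally show ?case .
qed

lemma sat_Exs:
  "sat M e (Exs is \<phi>) \<longleftrightarrow>
     (\<exists>e'. (\<forall>i. i \<notin> set is \<longrightarrow> e' i = e i) \<and> e' ` set is \<subseteq> univ M \<and> sat M e' \<phi>)"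
proof -
  have "sat M e (Exs is \<phi>) \<longleftrightarrow> \<not> sat M e (Alls is (Neg \<phi>))"
    by (induction "is" arbitrary: e) (auto simp: Exs_def Alls_def)
  then show ?thesis unfolding sat_Alls sat_Neg by blast
qed

lemma wf_Exs: "wf_fm L (Exs is \<phi>) \<longleftrightarrow> wf_fm L \<phi>"
  by (induction "is") (auto simp: Exs_def)

lemma val_closed:
  assumes "is_struct L M" "wf_tm L t" "range e \<subseteq> univ M"
  shows "val M e t \<in> univ M"
  using assms(2)
proof (induction t)
  case (Fun f ts)
  then have "set (map (val M e) ts) \<subseteq> univ M" by (auto simp: list_all_iff)
  then show ?case using Fun.prems assms(1) unfolding is_struct_def by simp
qed (use assms in auto)

section \<open>Renaming variables\<close>

primrec rename_tm :: "(nat \<Rightarrow> nat) \<Rightarrow> 'f tm \<Rightarrow> 'f tm" where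
  "rename_tm r (Var i) = Var (r i)"
| "rename_tm r (Fun f ts) = Fun f (map (rename_tm r) ts)"

lemma val_rename_tm: "val M e (rename_tm r t) = val M (\<lambda>k. e (r k)) t"
  by (induction t) (auto intro!: arg_cong[of _ _ "ifun M _"])

lemma wf_rename_tm: "wf_tm L (rename_tm r t) \<longleftrightarrow> wf_tm L t"
  by (induction t) (auto simp: list_all_iff)

text \<open>Stated as an existence because bound variables must be replaced by fresh ones;
  \<open>\<psi>\<close> is uniform in the structure and the assignment. The map \<open>r\<close> may
  identify variables, as predecessor on the naturals does.\<close>

lemma rename_formula:
  "wf_fm L \<phi> \<Longrightarrow> \<exists>\<psi>. wf_fm L \<psi> \<and> (\<forall>M :: ('a, 'f, 'r) struct. \<forall>e. sat M e \<psi> \<longleftrightarrow> sat M (\<lambda>k. e (r k)) \<phi>)"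
proof (induction \<phi> arbitrary: r)
  case Falsum
  show ?case by (intro exI[of _ Falsum]) auto
next
  case (Eq s t)
  then show ?case
    by (intro exI[of _ "Eq (rename_tm r s) (rename_tm r t)"]) (simp add: val_rename_tm wf_rename_tm comp_def)
next
  case (Rel R ts)
  then show ?case
    by (intro exI[of _ "Rel R (map (rename_tm r) ts)"])
      (auto simp: val_rename_tm wf_rename_tm list_all_iff comp_def)
next
  case (Imp \<phi> \<psi>)
  then obtain \<phi>' \<psi>' where "wf_fm L \<phi>'" "wf_fm L \<psi>'"
    "\<forall>M :: ('a, 'f, 'r) struct. \<forall>e. sat M e \<phi>' \<longleftrightarrow> sat M (\<lambda>k. e (r k)) \<phi>"
    "\<forall>M :: ('a, 'f, 'r) struct. \<forall>e. sat M e \<psi>' \<longleftrightarrow> sat M (\<lambda>k. e (r k)) \<psi>"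
    by (metis wf_fm.simps(4))
  then show ?case by (intro exI[of _ "Imp \<phi>' \<psi>'"]) auto
next
  case (Forall i \<phi>)
  obtain j where j: "j \<notin> r ` fv \<phi>"
    using finite_fv[of \<phi>] by (metis ex_new_if_finite finite_imageI infinite_UNIV_nat)
  obtain \<psi> where \<psi>: "wf_fm L \<psi>"
    "\<And>M :: ('a, 'f, 'r) struct. \<And>e. sat M e \<psi> \<longleftrightarrow> sat M (\<lambda>k. e ((r(i := j)) k)) \<phi>"
    using Forall.IH[of "r(i := j)"] Forall.prems by auto
  have "sat M (e(j := a)) \<psi> \<longleftrightarrow> sat M ((\<lambda>k. e (r k))(i := a)) \<phi>" for M :: "('a, 'f, 'r) struct" and e a
    unfolding \<psi>(2) by (rule sat_cong) (use j in auto)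
  then show ?case using \<psi>(1) by (intro exI[of _ "Forall j \<psi>"]) auto
qed

section \<open>Parameters as constants and as variables\<close>

text \<open>\<open>V\<close> collects the variables to be kept: the genuinely free ones and, below a
  quantifier, the bound ones. Every other variable \<open>i\<close> becomes the constant
  \<open>b i\<close>.\<close>

primrec const_tm :: "(nat \<Rightarrow> 'a) \<Rightarrow> nat set \<Rightarrow> 'f tm \<Rightarrow> ('f + 'a) tm" where
  "const_tm b V (Var i) = (if i \<in> V then Var i else Fun (Inr (b i)) [])"
| "const_tm b V (Fun f ts) = Fun (Inl f) (map (const_tm b V) ts)"

primrec const_fm :: "(nat \<Rightarrow> 'a) \<Rightarrow> nat set \<Rightarrow> ('f, 'r) fm \<Rightarrow> ('f + 'a, 'r) fm" where
  "const_fm b V Falsum = Falsum"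
| "const_fm b V (Eq s t) = Eq (const_tm b V s) (const_tm b V t)"
| "const_fm b V (Rel R ts) = Rel R (map (const_tm b V) ts)"
| "const_fm b V (Imp \<phi> \<psi>) = Imp (const_fm b V \<phi>) (const_fm b V \<psi>)"
| "const_fm b V (Forall i \<phi>) = Forall i (const_fm b (insert i V) \<phi>)"

lemma val_const_tm:
  "(\<And>i. i \<notin> V \<Longrightarrow> e i = b i) \<Longrightarrow> val (expand M) e (const_tm b V t) = val M e t"
  by (induction t) (auto simp: expand_def intro!: arg_cong[of _ _ "ifun M _"])

lemma sat_const_fm:
  "(\<And>i. i \<notin> V \<Longrightarrow> e i = b i) \<Longrightarrow> sat (expand M) e (const_fm b V \<phi>) \<longleftrightarrow> sat M e \<phi>"
proof (induction \<phi> arbitrary: e V)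
  case (Rel R ts)
  then have "map (val (expand M) e) (map (const_tm b V) ts) = map (val M e) ts"
    by (auto simp: val_const_tm)
  then show ?case by (simp add: expand_def del: map_map map_eq_conv)
next
  case (Forall i \<phi>)
  have "sat (expand M) (e(i := a)) (const_fm b (insert i V) \<phi>) \<longleftrightarrow> sat M (e(i := a)) \<phi>" for a
    using Forall.prems by (intro Forall.IH) auto
  then show ?case by (simp add: expand_def)
qed (auto simp: val_const_tm)

lemma const_tm_props:
  "wf_tm L t \<Longrightarrow> b ` (- V) \<subseteq> A \<Longrightarrow> wf_tm (add_consts L A) (const_tm b V t)"
  "fv_tm (const_tm b V t) \<subseteq> V"
  by (induction t) (auto simp: add_consts_def list_all_iff)

lemma wf_const_fm:
  "wf_fm L \<phi> \<Longrightarrow> b ` (- V) \<subseteq> A \<Longrightarrow> wf_fm (add_consts L A) (const_fm b V \<phi>)"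
proof (induction \<phi> arbitrary: V)
  case (Forall i \<phi>)
  from Forall.IH[of "insert i V"] Forall.prems show ?case by auto
qed (auto simp: const_tm_props list_all_iff, auto simp: add_consts_def)

lemma fv_const_fm: "fv (const_fm b V \<phi>) \<subseteq> V"
proof (induction \<phi> arbitrary: V)
  case (Forall i \<phi>)
  then show ?case by (force simp: subset_iff)
qed (use const_tm_props(2) in \<open>fastforce+\<close>)

text \<open>Constants are replaced by odd variables, so that no bound variable can capture them.\<close>

primrec unconst_tm :: "('a \<Rightarrow> nat) \<Rightarrow> ('f + 'a) tm \<Rightarrow> 'f tm" where
  "unconst_tm c (Var i) = Var (2 * i)"
| "unconst_tm c (Fun f ts) =
     (case f of Inl f \<Rightarrow> Fun f (map (unconst_tm c) ts) | Inr a \<Rightarrow> Var (2 * c a + 1))"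

primrec unconst_fm :: "('a \<Rightarrow> nat) \<Rightarrow> ('f + 'a, 'r) fm \<Rightarrow> ('f, 'r) fm" where
  "unconst_fm c Falsum = Falsum"
| "unconst_fm c (Eq s t) = Eq (unconst_tm c s) (unconst_tm c t)"
| "unconst_fm c (Rel R ts) = Rel R (map (unconst_tm c) ts)"
| "unconst_fm c (Imp \<phi> \<psi>) = Imp (unconst_fm c \<phi>) (unconst_fm c \<psi>)"
| "unconst_fm c (Forall i \<phi>) = Forall (2 * i) (unconst_fm c \<phi>)"

text \<open>The assignment that fits \<open>unconst_fm\<close>: variable \<open>i\<close> of the
  original formula is read at \<open>2 * i\<close>, parameter number \<open>i\<close> at
  \<open>2 * i + 1\<close>.\<close>

definition interleave :: "(nat \<Rightarrow> 'a) \<Rightarrow> (nat \<Rightarrow> 'a) \<Rightarrow> nat \<Rightarrow> 'a" where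
  "interleave e b i = (if even i then e (i div 2) else b (i div 2))"

lemma interleave_simps [simp]:
  "interleave e b (2 * i) = e i" "interleave e b (Suc (2 * i)) = b i"
  by (auto simp: interleave_def)

lemma interleave_upd [simp]: "(interleave e b)(2 * i := a) = interleave (e(i := a)) b"
  by (rule ext) (auto simp: interleave_def elim!: evenE)

lemma range_interleave: "range (interleave e b) = range e \<union> range b"
proof -
  have "e i \<in> range (interleave e b)" "b i \<in> range (interleave e b)" for i
    by (metis interleave_simps(1) rangeI, metis interleave_simps(2) rangeI)
  then show ?thesis by (auto simp: interleave_def)
qed

lemma wf_unconst_tm: "wf_tm (add_consts L A) t \<Longrightarrow> wf_tm L (unconst_tm c t)"
  by (induction t) (auto simp: add_consts_def list_all_iff split: sum.splits)

lemma val_unconst_tm: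
  "wf_tm (add_consts L A) t \<Longrightarrow> (\<And>a. a \<in> A \<Longrightarrow> b (c a) = a) \<Longrightarrow>
    val M (interleave e b) (unconst_tm c t) = val (expand M) e t"
  by (induction t)
    (auto simp: add_consts_def expand_def list_all_iff split: sum.splits intro!: arg_cong[of _ _ "ifun M _"])

lemma wf_unconst_fm: "wf_fm (add_consts L A) \<phi> \<Longrightarrow> wf_fm L (unconst_fm c \<phi>)"
  by (induction \<phi>) (auto simp: wf_unconst_tm list_all_iff, auto simp: add_consts_def)

lemma sat_unconst_fm:
  assumes "\<And>a. a \<in> A \<Longrightarrow> b (c a) = a"
  shows "wf_fm (add_consts L A) \<phi> \<Longrightarrow> sat M (interleave e b) (unconst_fm c \<phi>) \<longleftrightarrow> sat (expand M) e \<phi>"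
proof (induction \<phi> arbitrary: e)
  case (Rel R ts)
  then have "map (val M (interleave e b)) (map (unconst_tm c) ts) = map (val (expand M) e) ts"
    using assms by (auto simp: val_unconst_tm list_all_iff)
  then show ?case by (simp add: expand_def del: map_map map_eq_conv)
next
  case (Forall i \<phi>)
  then show ?case by (simp add: expand_def)
qed (auto simp: val_unconst_tm assms)

lemma boolean_family_formulas:
  assumes "\<And>\<phi>. \<phi> \<in> \<Phi> \<Longrightarrow> Neg \<phi> \<in> \<Phi>" "\<And>\<phi> \<psi>. \<phi> \<in> \<Phi> \<Longrightarrow> \<psi> \<in> \<Phi> \<Longrightarrow> Conj \<phi> \<psi> \<in> \<Phi>" "Neg Falsum \<in> \<Phi>"
  shows "boolean_family W (\<lambda>x. sat M (g x)) \<Phi> Neg Conj (Neg Falsum)"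
  using assms by unfold_locales auto

lemma boolean_family_param_forms:
  "boolean_family W (sat M) (param_forms L A n) Neg Conj (Neg Falsum)"
  using boolean_family_formulas[of "param_forms L A n" W M "\<lambda>x. x"] by (auto simp: param_forms_def)

lemma L_rings_arity:
  fixes L :: "('f rsym, 'r) language"
  assumes "sublanguage L_rings L"
  shows "RPlus \<in> funs L" "RTimes \<in> funs L" "RMinus \<in> funs L" "RZero \<in> funs L" "ROne \<in> funs L"
    "far L RPlus = 2" "far L RTimes = 2" "far L RMinus = 1" "far L RZero = 0" "far L ROne = 0"
  using assms by (auto simp: sublanguage_def L_rings_def)

lemma wf_add_pred_tm: "wf_tm (add_pred L) t \<longleftrightarrow> wf_tm L t"
proof (induction t)
  case (Fun f ts)
  have "funs (add_pred L) = funs L" "far (add_pred L) = far L" by (simp_all add: add_pred_def)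
  then show ?case using Fun by (auto simp: list_all_iff)
qed simp

section \<open>Ultrapowers over a countable index set\<close>

text \<open>\<open>atLeast\<close> excludes principal ultrafilters. It is the source of saturation:
  each single condition may be ignored at finitely many indices.\<close>

locale nat_ultrafilter =
  fixes U :: "nat set set"
  assumes Int_iff: "A \<inter> B \<in> U \<longleftrightarrow> A \<in> U \<and> B \<in> U"
    and Compl_iff: "- A \<in> U \<longleftrightarrow> A \<notin> U"
    and atLeast: "{k..} \<in> U"
begin

lemma upward: "A \<in> U \<Longrightarrow> A \<subseteq> B \<Longrightarrow> B \<in> U"
  by (metis Int_iff inf.absorb1)

lemma Imp_iff: "{k. P k \<longrightarrow> Q k} \<in> U \<longleftrightarrow> ({k. P k} \<in> U \<longrightarrow> {k. Q k} \<in> U)"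
proof -
  have "{k. P k \<longrightarrow> Q k} = - ({k. P k} \<inter> - {k. Q k})" by auto
  then show ?thesis by (simp only: Compl_iff Int_iff) auto
qed

lemma Falsum: "{} \<notin> U" and UNIV: "UNIV \<in> U"
  using atLeast[of 0] Compl_iff[of UNIV] by auto

lemma finite_Ball:
  "finite S \<Longrightarrow> (\<And>x. x \<in> S \<Longrightarrow> {k. P x k} \<in> U) \<Longrightarrow> {k. \<forall>x\<in>S. P x k} \<in> U"
proof (induction S rule: finite_induct)
  case (insert x S)
  then have "{k. P x k} \<inter> {k. \<forall>x\<in>S. P x k} \<in> U" unfolding Int_iff by auto
  then show ?case by (rule upward) auto
qed (simp add: UNIV)

text \<open>Classes are replaced by chosen representatives, so that an element of the ultrapower is
  itself a sequence and has components. The choice depends only on the class of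
  \<open>f\<close>.\<close>

definition rep :: "('a, 'f, 'r) struct \<Rightarrow> (nat \<Rightarrow> 'a) \<Rightarrow> nat \<Rightarrow> 'a" where
  "rep M f = (SOME g. range g \<subseteq> univ M \<and> {k. g k = f k} \<in> U)"

definition ultrapower :: "('a, 'f, 'r) struct \<Rightarrow> (nat \<Rightarrow> 'a, 'f, 'r) struct" where
  "ultrapower M = \<lparr>univ = rep M ` {f. range f \<subseteq> univ M},
     ifun = (\<lambda>f xs. rep M (\<lambda>k. ifun M f (map (\<lambda>x. x k) xs))),
     irel = (\<lambda>R xs. {k. irel M R (map (\<lambda>x. x k) xs)} \<in> U)\<rparr>"

lemma rep:
  assumes "range f \<subseteq> univ M"
  shows "range (rep M f) \<subseteq> univ M \<and> {k. rep M f k = f k} \<in> U"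
  unfolding rep_def by (rule someI[of _ f]) (use assms UNIV in auto)

lemma rep_eqI: "{k. f k = g k} \<in> U \<Longrightarrow> rep M f = rep M g"
proof -
  assume *: "{k. f k = g k} \<in> U"
  have "{k. h k = f k} \<in> U \<longleftrightarrow> {k. h k = g k} \<in> U" for h
  proof
    assume "{k. h k = f k} \<in> U"
    then have "{k. f k = g k} \<inter> {k. h k = f k} \<in> U" using * Int_iff by simp
    then show "{k. h k = g k} \<in> U" by (rule upward) auto
  next
    assume "{k. h k = g k} \<in> U"
    then have "{k. f k = g k} \<inter> {k. h k = g k} \<in> U" using * Int_iff by simp
    then show "{k. h k = f k} \<in> U" by (rule upward) auto
  qed
  then show ?thesis unfolding rep_def by simp
qed

lemma univ_ultrapower_range: "x \<in> univ (ultrapower M) \<Longrightarrow> x k \<in> univ M"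
  using rep by (fastforce simp: ultrapower_def)

lemma ultrapower_component:
  "set xs \<subseteq> univ (ultrapower M) \<Longrightarrow> set (map (\<lambda>x. x k) xs) \<subseteq> univ M"
  "range e \<subseteq> univ (ultrapower M) \<Longrightarrow> range (\<lambda>i. e i k) \<subseteq> univ M"
  using univ_ultrapower_range by (fastforce, fast)

lemma ultrapower_eq_iff:
  assumes "x \<in> univ (ultrapower M)" "y \<in> univ (ultrapower M)"
  shows "x = y \<longleftrightarrow> {k. x k = y k} \<in> U"
proof
  assume *: "{k. x k = y k} \<in> U"
  obtain f g where f: "range f \<subseteq> univ M" "x = rep M f" and g: "range g \<subseteq> univ M" "y = rep M g"
    using assms by (auto simp: ultrapower_def)
  have "{k. x k = y k} \<inter> ({k. x k = f k} \<inter> {k. y k = g k}) \<in> U"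
    unfolding Int_iff using * rep[OF f(1)] rep[OF g(1)] f g by auto
  then have "{k. f k = g k} \<in> U" by (rule upward) auto
  then show "x = y" using rep_eqI f g by auto
qed (simp add: UNIV)

lemma is_struct_ultrapower:
  assumes M: "is_struct L M"
  shows "is_struct L (ultrapower M)"
proof -
  obtain a where a: "a \<in> univ M" using M by (auto simp: is_struct_def)
  have "rep M (\<lambda>_. a) \<in> univ (ultrapower M)" using a by (auto simp: ultrapower_def)
  moreover have "ifun (ultrapower M) f xs \<in> univ (ultrapower M)"
    if "f \<in> funs L" "set xs \<subseteq> univ (ultrapower M)" "length xs = far L f" for f xs
  proof -
    have "ifun M f (map (\<lambda>x. x k) xs) \<in> univ M" for k
      using M that(1,3) ultrapower_component(1)[OF that(2), of k] unfolding is_struct_def by simp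
    then show ?thesis by (auto simp: ultrapower_def)
  qed
  ultimately show ?thesis unfolding is_struct_def by auto
qed

context
  fixes L :: "('f, 'r) language" and M :: "('a, 'f, 'r) struct"
  assumes M: "is_struct L M"
begin

lemma val_ultrapower:
  assumes e: "range e \<subseteq> univ (ultrapower M)"
  shows "wf_tm L t \<Longrightarrow> {k. val (ultrapower M) e t k = val M (\<lambda>i. e i k) t} \<in> U"
proof (induction t)
  case (Fun f ts)
  have "\<forall>k. ifun M f (map (\<lambda>x. x k) (map (val (ultrapower M) e) ts)) \<in> univ M"
  proof
    fix k
    have "set (map (val (ultrapower M) e) ts) \<subseteq> univ (ultrapower M)"
      using Fun.prems val_closed[OF is_struct_ultrapower[OF M] _ e] by (auto simp: list_all_iff)
    from ultrapower_component(1)[OF this, of k]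
    show "ifun M f (map (\<lambda>x. x k) (map (val (ultrapower M) e) ts)) \<in> univ M"
      using M Fun.prems unfolding is_struct_def by simp
  qed
  then have "{k. val (ultrapower M) e (Fun f ts) k = ifun M f (map (\<lambda>x. x k) (map (val (ultrapower M) e) ts))} \<in> U"
    using rep[of "\<lambda>k. ifun M f (map (\<lambda>x. x k) (map (val (ultrapower M) e) ts))" M]
    by (auto simp: ultrapower_def)
  moreover have "{k. \<forall>t\<in>set ts. val (ultrapower M) e t k = val M (\<lambda>i. e i k) t} \<in> U"
    using Fun by (intro finite_Ball) (auto simp: list_all_iff)
  ultimately show ?case
    by (rule upward[OF Int_iff[THEN iffD2, OF conjI]])
      (auto intro!: arg_cong[of _ _ "ifun M f"])
qed (simp add: UNIV)

lemma sat_ultrapower: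
  "wf_fm L \<phi> \<Longrightarrow> range e \<subseteq> univ (ultrapower M) \<Longrightarrow>
    sat (ultrapower M) e \<phi> \<longleftrightarrow> {k. sat M (\<lambda>i. e i k) \<phi>} \<in> U"
proof (induction \<phi> arbitrary: e)
  case Falsum
  show ?case using nat_ultrafilter.Falsum[OF nat_ultrafilter_axioms] by simp
next
  case (Eq s t)
  have st: "{k. val (ultrapower M) e s k = val M (\<lambda>i. e i k) s} \<in> U"
    "{k. val (ultrapower M) e t k = val M (\<lambda>i. e i k) t} \<in> U"
    using Eq by (auto intro: val_ultrapower)
  have "sat (ultrapower M) e (Eq s t) \<longleftrightarrow> {k. val (ultrapower M) e s k = val (ultrapower M) e t k} \<in> U"
    using Eq by (auto intro!: ultrapower_eq_iff val_closed[OF is_struct_ultrapower[OF M]])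
  also have "\<dots> \<longleftrightarrow> {k. val M (\<lambda>i. e i k) s = val M (\<lambda>i. e i k) t} \<in> U"
    (is "?L \<in> U \<longleftrightarrow> ?R \<in> U")
  proof
    let ?C = "{k. val (ultrapower M) e s k = val M (\<lambda>i. e i k) s} \<inter>
      {k. val (ultrapower M) e t k = val M (\<lambda>i. e i k) t}"
    { assume "?L \<in> U"
      then have "?L \<inter> ?C \<in> U" using st Int_iff by simp
      then show "?R \<in> U" by (rule upward) auto }
    { assume "?R \<in> U"
      then have "?R \<inter> ?C \<in> U" using st Int_iff by simp
      then show "?L \<in> U" by (rule upward) auto }
  qed
  finally show ?case by simp
next
  case (Rel R ts)
  have st: "{k. \<forall>t\<in>set ts. val (ultrapower M) e t k = val M (\<lambda>i. e i k) t} \<in> U"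
    using Rel by (intro finite_Ball val_ultrapower) (auto simp: list_all_iff)
  have eq: "map (\<lambda>x. x k) (map (val (ultrapower M) e) ts) = map (val M (\<lambda>i. e i k)) ts"
    if "\<forall>t\<in>set ts. val (ultrapower M) e t k = val M (\<lambda>i. e i k) t" for k
    using that by auto
  have "sat (ultrapower M) e (Rel R ts) \<longleftrightarrow> {k. irel M R (map (\<lambda>x. x k) (map (val (ultrapower M) e) ts))} \<in> U"
    by (simp add: ultrapower_def)
  also have "\<dots> \<longleftrightarrow> {k. irel M R (map (val M (\<lambda>i. e i k)) ts)} \<in> U"
  proof
    assume "{k. irel M R (map (\<lambda>x. x k) (map (val (ultrapower M) e) ts))} \<in> U"
    from Int_iff[THEN iffD2, OF conjI[OF this st]]
    show "{k. irel M R (map (val M (\<lambda>i. e i k)) ts)} \<in> U"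
      by (rule upward) (clarsimp simp del: map_map, simp only: eq)
  next
    assume "{k. irel M R (map (val M (\<lambda>i. e i k)) ts)} \<in> U"
    from Int_iff[THEN iffD2, OF conjI[OF this st]]
    show "{k. irel M R (map (\<lambda>x. x k) (map (val (ultrapower M) e) ts))} \<in> U"
      by (rule upward) (clarsimp simp del: map_map, simp only: eq)
  qed
  finally show ?case by simp
next
  case (Imp \<phi> \<psi>)
  then show ?case by (simp add: Imp_iff)
next
  case (Forall i \<phi>)
  let ?N = "ultrapower M"
  let ?e = "\<lambda>k j. e j k"
  have upd: "(\<lambda>j. (e(i := a)) j k) = (?e k)(i := a k)" for a k by auto
  have IH: "sat ?N (e(i := a)) \<phi> \<longleftrightarrow> {k. sat M ((?e k)(i := a k)) \<phi>} \<in> U" if "a \<in> univ ?N" for a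
  proof -
    have "range (e(i := a)) \<subseteq> univ ?N" using Forall.prems that by auto
    from Forall.IH[OF _ this] Forall.prems(1) show ?thesis by (simp only: upd wf_fm.simps)
  qed
  show ?case
  proof
    assume *: "{k. sat M (?e k) (Forall i \<phi>)} \<in> U"
    have "{k. sat M ((?e k)(i := a k)) \<phi>} \<in> U" if "a \<in> univ ?N" for a
      by (rule upward[OF *]) (use univ_ultrapower_range[OF that] in auto)
    then show "sat ?N e (Forall i \<phi>)" using IH by auto
  next
    assume *: "sat ?N e (Forall i \<phi>)"
    obtain a0 where a0: "a0 \<in> univ M" using M by (auto simp: is_struct_def)
    \<comment> \<open>Pick at each index a counterexample to the universal formula if there is one;
      the resulting sequence tests the formula at all indices at once.\<close>
    have "\<exists>b. b \<in> univ M \<and> (sat M ((?e k)(i := b)) \<phi> \<longrightarrow> sat M (?e k) (Forall i \<phi>))" for k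
      using a0 by (cases "sat M (?e k) (Forall i \<phi>)") auto
    then obtain f where f: "\<And>k. f k \<in> univ M" "\<And>k. sat M ((?e k)(i := f k)) \<phi> \<Longrightarrow> sat M (?e k) (Forall i \<phi>)"
      by metis
    have rf: "range f \<subseteq> univ M" using f by auto
    then have "rep M f \<in> univ ?N" by (auto simp: ultrapower_def)
    then have "{k. sat M ((?e k)(i := rep M f k)) \<phi>} \<in> U" using * IH by auto
    then have "{k. sat M ((?e k)(i := rep M f k)) \<phi>} \<inter> {k. rep M f k = f k} \<in> U"
      using rep[OF rf] Int_iff by auto
    then show "{k. sat M (?e k) (Forall i \<phi>)} \<in> U"
      by (rule upward) (use f(2) in auto)
  qed
qed

text \<open>The diagonal argument: index \<open>k\<close> takes care of the longest solvable initial
  segment among the formulas numbered up to \<open>k\<close>. Only the variables in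
  \<open>V\<close>, possibly infinitely many, are solved for; the others keep the values of
  \<open>e0\<close>.\<close>

lemma ultrapower_saturated:
  assumes wf: "\<And>\<phi>. \<phi> \<in> \<Delta> \<Longrightarrow> wf_fm L \<phi>" and c: "countable \<Delta>"
    and e0: "range e0 \<subseteq> univ (ultrapower M)"
    and fin: "\<And>q. q \<subseteq> \<Delta> \<Longrightarrow> finite q \<Longrightarrow> \<exists>e. range e \<subseteq> univ (ultrapower M) \<and> (\<forall>i. i \<notin> V \<longrightarrow> e i = e0 i) \<and>
        (\<forall>\<phi>\<in>q. sat (ultrapower M) e \<phi>)"
  shows "\<exists>e. range e \<subseteq> univ (ultrapower M) \<and> (\<forall>i. i \<notin> V \<longrightarrow> e i = e0 i) \<and>
        (\<forall>\<phi>\<in>\<Delta>. sat (ultrapower M) e \<phi>)"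
proof (cases "\<Delta> = {}")
  case True
  then show ?thesis using fin[of "{}"] by auto
next
  case False
  let ?N = "ultrapower M"
  obtain \<theta> :: "nat \<Rightarrow> ('f, 'r) fm" where \<theta>: "range \<theta> = \<Delta>"
    using c False by (metis range_from_nat_into)
  \<comment> \<open>\<open>G k m d\<close>: at index \<open>k\<close> the assignment
    \<open>d\<close> solves the formulas up to number \<open>m\<close>. By finite satisfiability a
    solution exists at almost all \<open>k\<close>, for each fixed \<open>m\<close>.\<close>
  define G where "G k m d \<longleftrightarrow> range d \<subseteq> univ M \<and> (\<forall>i. i \<notin> V \<longrightarrow> d i = e0 i k) \<and>
      (\<forall>j\<le>m. sat M d (\<theta> j))" for k and m :: nat and d
  have GU: "{k. \<exists>d. G k m d} \<in> U" for m
  proof -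
    have "\<theta> ` {..m} \<subseteq> \<Delta>" using \<theta> by auto
    from fin[OF this] obtain e where e: "range e \<subseteq> univ ?N" "\<And>i. i \<notin> V \<Longrightarrow> e i = e0 i"
      "\<And>j. j \<le> m \<Longrightarrow> sat ?N e (\<theta> j)" by auto
    have "{k. \<forall>j\<in>{..m}. sat M (\<lambda>i. e i k) (\<theta> j)} \<in> U"
      using e(1,3) sat_ultrapower wf \<theta> by (intro finite_Ball) auto
    then show ?thesis
    proof (rule upward, safe)
      fix k assume "\<forall>j\<in>{..m}. sat M (\<lambda>i. e i k) (\<theta> j)"
      then have "G k m (\<lambda>i. e i k)" using e ultrapower_component(2)[OF e(1)] by (simp add: G_def)
      then show "\<exists>d. G k m d" by blast
    qed
  qed
  \<comment> \<open>A solution of the longest solvable segment also solves every shorter one. If no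
    segment is solvable at \<open>k\<close>, any assignment will do, for instance the component of
    \<open>e0\<close>.\<close>
  have "\<exists>d. range d \<subseteq> univ M \<and> (\<forall>i. i \<notin> V \<longrightarrow> d i = e0 i k) \<and>
      (\<forall>m\<le>k. (\<exists>d. G k m d) \<longrightarrow> sat M d (\<theta> m))" for k
  proof (cases "\<exists>m\<le>k. \<exists>d. G k m d")
    case True
    let ?S = "{m. m \<le> k \<and> (\<exists>d. G k m d)}"
    have "finite ?S" "?S \<noteq> {}" using True by auto
    then have "Max ?S \<in> ?S" by (rule Max_in)
    then obtain d where "G k (Max ?S) d" by auto
    moreover have "m \<le> Max ?S" if "m \<le> k" "\<exists>d. G k m d" for m using \<open>finite ?S\<close> that by auto
    ultimately show ?thesis unfolding G_def by (intro exI[of _ d]) auto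
  next
    case False
    then show ?thesis
      using ultrapower_component(2)[OF e0] by (intro exI[of _ "\<lambda>i. e0 i k"]) auto
  qed
  then obtain D where D: "\<And>k. range (D k) \<subseteq> univ M" "\<And>k i. i \<notin> V \<Longrightarrow> D k i = e0 i k"
    "\<And>k m. m \<le> k \<Longrightarrow> \<exists>d. G k m d \<Longrightarrow> sat M (D k) (\<theta> m)"
    by metis
  define e where "e i = (if i \<in> V then rep M (\<lambda>k. D k i) else e0 i)" for i
  have r: "range (\<lambda>k. D k i) \<subseteq> univ M" for i using D(1) by auto
  then have "rep M (\<lambda>k. D k i) \<in> univ ?N" for i by (auto simp: ultrapower_def)
  then have e: "range e \<subseteq> univ ?N" using e0 by (auto simp: e_def)
  have agree: "{k. e i k = D k i} \<in> U" for i
    using rep[OF r] D(2) UNIV by (auto simp: e_def)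
  have "sat ?N e (\<theta> m)" for m
  proof -
    have "{k. \<forall>i\<in>fv (\<theta> m). e i k = D k i} \<in> U"
      by (rule finite_Ball) (auto simp: agree finite_fv)
    then have "{k. \<forall>i\<in>fv (\<theta> m). e i k = D k i} \<inter> ({m..} \<inter> {k. \<exists>d. G k m d}) \<in> U"
      using atLeast GU Int_iff by auto
    then have "{k. sat M (\<lambda>i. e i k) (\<theta> m)} \<in> U"
    proof (rule upward, safe)
      fix k d assume "\<forall>i\<in>fv (\<theta> m). e i k = D k i" "m \<le> k" "G k m d"
      then show "sat M (\<lambda>i. e i k) (\<theta> m)"
        using D(3)[of m k] sat_cong[of "\<theta> m" "\<lambda>i. e i k" "D k" M] by auto
    qed
    then show ?thesis using sat_ultrapower e wf \<theta> by auto
  qed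
  then show ?thesis using e \<theta> by (intro exI[of _ e]) (auto simp: e_def)
qed

end

end

text \<open>Sets of naturals act as formulas and membership as satisfaction; a maximal type
  containing all final segments is the required ultrafilter.\<close>

lemma ex_nat_ultrafilter: "\<exists>U. nat_ultrafilter U"
proof -
  interpret boolean_family "UNIV :: nat set" "(\<in>)" "UNIV :: nat set set" uminus "(\<inter>)" UNIV
    by unfold_locales auto
  have "fin_sat UNIV (\<in>) (range (atLeast :: nat \<Rightarrow> nat set))"
    unfolding fin_sat_def
  proof (intro allI impI)
    fix q assume "q \<subseteq> range (atLeast :: nat \<Rightarrow> nat set) \<and> finite q"
    then obtain I where I: "finite I" "q = atLeast ` I" by (metis finite_subset_image)
    obtain n where "\<forall>i\<in>I. i \<le> n" using I(1) by (metis finite_nat_set_iff_bounded_le)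
    then show "\<exists>x\<in>UNIV. \<forall>\<phi>\<in>q. x \<in> \<phi>" using I by auto
  qed
  then obtain U where U: "U \<in> Ty" "range atLeast \<subseteq> U"
    using fin_sat_extend[of "range (atLeast :: nat \<Rightarrow> nat set)" UNIV UNIV "(\<in>)"] by auto
  have "nat_ultrafilter U"
  proof
    show "A \<inter> B \<in> U \<longleftrightarrow> A \<in> U \<and> B \<in> U" for A B using type_cn[OF U(1)] by auto
    show "- A \<in> U \<longleftrightarrow> A \<notin> U" for A using type_complete[OF U(1)] type_not_both[OF U(1)] by blast
    show "{k..} \<in> U" for k using U(2) by auto
  qed
  then show ?thesis ..
qed

section \<open>Loewenheim-Skolem and types of tuples\<close>

text \<open>A tuple occupies the first variables and the countable parameter sequence moves up, so
  that adding finitely many parameters gives again a sequence indexed by the naturals.\<close>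

definition prep :: "'a list \<Rightarrow> (nat \<Rightarrow> 'a) \<Rightarrow> nat \<Rightarrow> 'a" where
  "prep zs y i = (if i < length zs then zs ! i else y (i - length zs))"

lemma prep_Nil [simp]: "prep [] y = y"
  by (auto simp: prep_def)

lemma prep_append: "prep (ws @ zs) y = prep ws (prep zs y)"
  by (rule ext) (auto simp: prep_def nth_append)

lemma prep_shift [simp]: "prep zs y (i + length zs) = y i"
  by (simp add: prep_def)

lemma range_prep: "range y \<subseteq> A \<Longrightarrow> set zs \<subseteq> A \<Longrightarrow> range (prep zs y) \<subseteq> A"
  by (auto simp: prep_def)

lemma prep_Cons: "prep [x] y 0 = x" "prep [x] y (Suc i) = y i"
  by (auto simp: prep_def)

text \<open>The list \<open>as\<close> is a dummy that the quantifiers overwrite. It has to be there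
  because \<open>Exs\<close> leaves the other variables alone, so the parameters must already stand
  at their shifted places.\<close>

lemma ex_prep_iff_Exs:
  assumes y: "range y \<subseteq> univ M" and a: "length as = k"
  shows "(\<exists>zs. length zs = k \<and> set zs \<subseteq> univ M \<and> sat M (prep zs y) \<phi>) \<longleftrightarrow>
    sat M (prep as y) (Exs [0..<k] \<phi>)"
  unfolding sat_Exs
proof safe
  fix zs assume "k = length zs" "set zs \<subseteq> univ M" "sat M (prep zs y) \<phi>"
  then show "\<exists>e'. (\<forall>i. i \<notin> set [0..<length zs] \<longrightarrow> e' i = prep as y i) \<and>
      e' ` set [0..<length zs] \<subseteq> univ M \<and> sat M e' \<phi>"
    using a by (intro exI[of _ "prep zs y"]) (auto simp: prep_def)
next
  fix e' assume e': "\<forall>i. i \<notin> set [0..<k] \<longrightarrow> e' i = prep as y i" "e' ` set [0..<k] \<subseteq> univ M" "sat M e' \<phi>"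
  have "prep (map e' [0..<k]) y = e'" using e'(1) a by (auto simp: prep_def fun_eq_iff)
  then show "\<exists>zs. length zs = k \<and> set zs \<subseteq> univ M \<and> sat M (prep zs y) \<phi>"
    using e' by (intro exI[of _ "map e' [0..<k]"]) auto
qed

text \<open>Skolem terms are coded by formulas: the second component decodes the list of arguments,
  and an implication from a universal formula codes a witness.\<close>

primrec decode :: "(nat \<Rightarrow> 'a) \<Rightarrow> (('f, 'r) fm \<Rightarrow> nat \<Rightarrow> 'a list \<Rightarrow> 'a) \<Rightarrow> ('f, 'r) fm \<Rightarrow> 'a \<times> 'a list" where
  "decode y w Falsum = (y 0, [])"
| "decode y w (Eq s t) = (y 0, [])"
| "decode y w (Rel R ts) = (y 0, [])"
| "decode y w (Forall n \<phi>) = (y n, [])"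
| "decode y w (Imp \<phi> \<psi>) = (case \<phi> of Forall i \<chi> \<Rightarrow> w \<chi> i (snd (decode y w \<psi>)) | _ \<Rightarrow> y 0,
     fst (decode y w \<phi>) # snd (decode y w \<psi>))"

lemma decode_list: "set l \<subseteq> range (\<lambda>\<phi>. fst (decode y w \<phi>)) \<Longrightarrow> \<exists>\<psi>. snd (decode y w \<psi>) = l"
proof (induction l)
  case Nil
  show ?case by (rule exI[of _ Falsum]) simp
next
  case (Cons a l)
  then obtain \<phi> \<psi> where "fst (decode y w \<phi>) = a" "snd (decode y w \<psi>) = l" by auto
  then show ?case by (intro exI[of _ "Imp \<phi> \<psi>"]) auto
qed

lemma val_univ_update [simp]: "val (M\<lparr>univ := H\<rparr>) = val M"
proof (intro ext)
  show "val (M\<lparr>univ := H\<rparr>) e t = val M e t" for e t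
    by (induction t) (auto intro!: arg_cong[of _ _ "ifun M _"])
qed

lemma Tarski_Vaught:
  fixes M :: "('a, 'f, 'r) struct"
  assumes sub: "H \<subseteq> univ M"
    and tv: "\<And>e i \<phi>. range e \<subseteq> H \<Longrightarrow> \<exists>a\<in>univ M. sat M (e(i := a)) \<phi> \<Longrightarrow> \<exists>a\<in>H. sat M (e(i := a)) \<phi>"
  shows "range e \<subseteq> H \<Longrightarrow> sat (M\<lparr>univ := H\<rparr>) e \<phi> \<longleftrightarrow> sat M e \<phi>"
proof (induction \<phi> arbitrary: e)
  case (Forall i \<phi>)
  have "sat (M\<lparr>univ := H\<rparr>) (e(i := a)) \<phi> \<longleftrightarrow> sat M (e(i := a)) \<phi>" if "a \<in> H" for a
    using Forall.prems that by (intro Forall.IH) auto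
  then have "sat (M\<lparr>univ := H\<rparr>) e (Forall i \<phi>) \<longleftrightarrow> (\<forall>a\<in>H. sat M (e(i := a)) \<phi>)" by simp
  also have "\<dots> \<longleftrightarrow> (\<forall>a\<in>univ M. sat M (e(i := a)) \<phi>)"
    using tv[OF Forall.prems, of i "Neg \<phi>"] sub by auto
  finally show ?case by simp
qed auto

text \<open>The hull is indexed by formulas, which code its Skolem terms. Hence it injects into the
  type of formulas, the type over which omega-stability of \<open>T\<close> is assumed.\<close>

lemma Loewenheim_Skolem:
  fixes M :: "('a, 'f, 'r) struct" and y :: "nat \<Rightarrow> 'a"
  assumes M: "is_struct L M" and y: "range y \<subseteq> univ M"
  obtains H and g :: "'a \<Rightarrow> ('f, 'r) fm" where "range y \<subseteq> H" "H \<subseteq> univ M" "inj_on g H"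
    "is_struct L (M\<lparr>univ := H\<rparr>)" "\<And>e \<phi>. range e \<subseteq> H \<Longrightarrow> sat (M\<lparr>univ := H\<rparr>) e \<phi> \<longleftrightarrow> sat M e \<phi>"
proof -
  \<comment> \<open>An argument list is padded with \<open>y 0\<close> to a full assignment.\<close>
  define env where "env l j = (if j < length l then l ! j else y 0)" for l j
  define w where "w \<chi> i l = (if \<exists>a\<in>univ M. sat M ((env l)(i := a)) \<chi>
      then SOME a. a \<in> univ M \<and> sat M ((env l)(i := a)) \<chi> else y 0)" for \<chi> i l
  have w: "w \<chi> i l \<in> univ M" for \<chi> i l
    using y someI_ex[of "\<lambda>a. a \<in> univ M \<and> sat M ((env l)(i := a)) \<chi>"] by (auto simp: w_def)
  define H where "H = range (\<lambda>\<phi> :: ('f, 'r) fm. fst (decode y w \<phi>))"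
  have "fst (decode y w \<phi>) \<in> univ M" for \<phi>
    using y w by (cases \<phi>) (auto split: fm.split)
  then have sub: "H \<subseteq> univ M" by (auto simp: H_def)
  have "y n \<in> H" for n unfolding H_def by (rule range_eqI[of _ _ "Forall n Falsum"]) simp
  then have yH: "range y \<subseteq> H" by auto
  have tv: "\<exists>a\<in>H. sat M (e(i := a)) \<phi>"
    if e: "range e \<subseteq> H" and ex: "\<exists>a\<in>univ M. sat M (e(i := a)) \<phi>" for e i \<phi>
  proof -
    obtain m where m: "fv \<phi> \<subseteq> {..<m}" using fv_bound by auto
    have "set (map e [0..<m]) \<subseteq> H" using e by auto
    then obtain \<psi> where \<psi>: "snd (decode y w \<psi>) = map e [0..<m]"
      unfolding H_def using decode_list by blast
    have *: "sat M ((env (map e [0..<m]))(i := a)) \<phi> \<longleftrightarrow> sat M (e(i := a)) \<phi>" for a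
      by (rule sat_cong) (use m in \<open>auto simp: env_def\<close>)
    have "sat M (e(i := w \<phi> i (map e [0..<m]))) \<phi>"
    proof -
      have "w \<phi> i (map e [0..<m]) = (SOME a. a \<in> univ M \<and> sat M (e(i := a)) \<phi>)"
        unfolding w_def * using ex by simp
      then show ?thesis using someI_ex[of "\<lambda>a. a \<in> univ M \<and> sat M (e(i := a)) \<phi>"] ex by auto
    qed
    moreover have "w \<phi> i (map e [0..<m]) \<in> H"
      unfolding H_def by (rule range_eqI[of _ _ "Imp (Forall i \<phi>) \<psi>"]) (simp add: \<psi>)
    ultimately show ?thesis by auto
  qed
  have "ifun M f xs \<in> H" if f: "f \<in> funs L" and xs: "set xs \<subseteq> H" "length xs = far L f" for f xs
  proof -
    define n where "n = length xs"
    define e where "e = (\<lambda>j. if j < n then xs ! j else y 0)"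
    have e: "range e \<subseteq> H" using xs yH by (auto simp: e_def n_def)
    have "map (val M (e(n := a))) (map Var [0..<n]) = map e [0..<n]" for a by simp
    moreover have "map e [0..<n] = xs" by (rule nth_equalityI) (simp_all add: e_def n_def)
    ultimately have v: "map (val M (e(n := a))) (map Var [0..<n]) = xs" for a by metis
    \<comment> \<open>Closure under function symbols is the Tarski-Vaught condition for the formula
      saying that variable \<open>n\<close> is the value of \<open>f\<close> at the variables below
      \<open>n\<close>.\<close>
    have "ifun M f xs \<in> univ M" using M f xs sub unfolding is_struct_def by auto
    then have "\<exists>a\<in>univ M. sat M (e(n := a)) (Eq (Var n) (Fun f (map Var [0..<n])))"
      by (simp add: v del: map_map)
    from tv[OF e this] show ?thesis by (auto simp: v simp del: map_map)
  qed
  then have "is_struct L (M\<lparr>univ := H\<rparr>)" using yH unfolding is_struct_def by auto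
  moreover have "inj_on (inv_into UNIV (\<lambda>\<phi> :: ('f, 'r) fm. fst (decode y w \<phi>))) H"
    unfolding H_def by (rule inj_on_inv_into) simp
  ultimately show thesis using that[OF yH sub] Tarski_Vaught[OF sub tv] by blast
qed

section \<open>Moving a structure to another type\<close>

definition copy_struct :: "('a \<Rightarrow> 'b) \<Rightarrow> ('a, 'f, 'r) struct \<Rightarrow> ('b, 'f, 'r) struct" where
  "copy_struct g M = \<lparr>univ = g ` univ M,
     ifun = (\<lambda>f xs. g (ifun M f (map (inv_into (univ M) g) xs))),
     irel = (\<lambda>R xs. irel M R (map (inv_into (univ M) g) xs))\<rparr>"

lemma is_struct_copy:
  assumes "is_struct L M" "inj_on g (univ M)"
  shows "is_struct L (copy_struct g M)"
proof -
  have "ifun M f (map (inv_into (univ M) g) xs) \<in> univ M"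
    if "f \<in> funs L" "set xs \<subseteq> g ` univ M" "length xs = far L f" for f xs
  proof -
    have "set (map (inv_into (univ M) g) xs) \<subseteq> univ M"
      using that(2) by (auto intro!: inv_into_into)
    then show ?thesis using assms(1) that unfolding is_struct_def by simp
  qed
  then show ?thesis using assms(1) unfolding is_struct_def copy_struct_def by auto
qed

lemma sat_copy:
  assumes M: "is_struct L M" and g: "inj_on g (univ M)"
  shows "range e \<subseteq> univ M \<Longrightarrow> wf_fm L \<phi> \<Longrightarrow> sat (copy_struct g M) (\<lambda>i. g (e i)) \<phi> \<longleftrightarrow> sat M e \<phi>"
proof -
  have inv: "inv_into (univ M) g (g a) = a" if "a \<in> univ M" for a using that g by simp
  have map_inv: "map (inv_into (univ M) g) (map (\<lambda>t. g (val M e t)) ts) = map (val M e) ts"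
    if "range e \<subseteq> univ M" "list_all (wf_tm L) ts" for e ts
    using that val_closed[OF M] by (auto simp: inv list_all_iff)
  have val: "val (copy_struct g M) (\<lambda>i. g (e i)) t = g (val M e t)"
    if e: "range e \<subseteq> univ M" and t: "wf_tm L t" for e t
    using t
  proof (induction t)
    case (Fun f ts)
    then have "map (val (copy_struct g M) (\<lambda>i. g (e i))) ts = map (\<lambda>t. g (val M e t)) ts"
      by (auto simp: list_all_iff)
    moreover have "list_all (wf_tm L) ts" using Fun.prems by (simp add: list_all_iff)
    ultimately show ?case using map_inv[OF e] by (simp add: copy_struct_def del: map_map map_eq_conv)
  qed simp
  show "range e \<subseteq> univ M \<Longrightarrow> wf_fm L \<phi> \<Longrightarrow> sat (copy_struct g M) (\<lambda>i. g (e i)) \<phi> \<longleftrightarrow> sat M e \<phi>"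
  proof (induction \<phi> arbitrary: e)
    case (Eq s t)
    then show ?case using g val_closed[OF M] by (auto simp: val dest: inj_onD)
  next
    case (Rel R ts)
    then have "map (val (copy_struct g M) (\<lambda>i. g (e i))) ts = map (\<lambda>t. g (val M e t)) ts"
      by (auto simp: list_all_iff val)
    then show ?case using map_inv[OF Rel.prems(1), of ts] Rel.prems(2)
      by (simp add: copy_struct_def del: map_map map_eq_conv)
  next
    case (Forall i \<phi>)
    have upd: "(\<lambda>i. g (e i))(i := g a) = (\<lambda>j. g ((e(i := a)) j))" for a by auto
    have "sat (copy_struct g M) ((\<lambda>i. g (e i))(i := g a)) \<phi> \<longleftrightarrow> sat M (e(i := a)) \<phi>"
      if "a \<in> univ M" for a
      unfolding upd using Forall.prems that by (intro Forall.IH) auto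
    moreover have "univ (copy_struct g M) = g ` univ M" by (simp add: copy_struct_def)
    ultimately show ?case by simp
  qed auto
qed

section \<open>Types of tuples over a parameter sequence\<close>

definition tuples :: "('a, 'f, 'r) struct \<Rightarrow> nat \<Rightarrow> 'a list set" where
  "tuples M k = {zs. length zs = k \<and> set zs \<subseteq> univ M}"

text \<open>Parameters are variables instead of constants: in a formula the variables below
  \<open>k\<close> stand for the tuple and variable \<open>k + i\<close> for \<open>y i\<close>. The
  language thus does not depend on the structure, and types over sequences in different structures
  can be compared.\<close>

abbreviation "tuple_types L M y k \<equiv> max_types (tuples M k) (\<lambda>zs. sat M (prep zs y)) {\<phi>. wf_fm L \<phi>}"

lemma boolean_family_tuples:
  "boolean_family W (\<lambda>zs. sat M (g zs)) {\<phi>. wf_fm L \<phi>} Neg Conj (Neg Falsum)"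
  by (rule boolean_family_formulas) auto

text \<open>Each variable \<open>i\<close> with \<open>i \<ge> k\<close> is turned into the constant
  for \<open>y (i - k)\<close>, and the types are transferred along this translation.\<close>

lemma countable_tuple_types:
  assumes c: "countable (types L M (range y) k)" and y: "range y \<subseteq> univ M"
  shows "countable (tuple_types L M y k)"
proof (rule countable_types_transfer[OF boolean_family_tuples boolean_family_param_forms])
  let ?tr = "const_fm (\<lambda>i. y (i - k)) {..<k}"
  show "?tr \<phi> \<in> param_forms L (range y) k" if "\<phi> \<in> {\<phi>. wf_fm L \<phi>}" for \<phi>
    using that fv_const_fm[of "\<lambda>i. y (i - k)" "{..<k}" \<phi>]
    by (auto simp: param_forms_def intro!: wf_const_fm)
  show "\<exists>x'\<in>{e. range e \<subseteq> univ M}. \<forall>\<phi>\<in>{\<phi>. wf_fm L \<phi>}. sat (expand M) x' (?tr \<phi>) \<longleftrightarrow> sat M (prep zs y) \<phi>"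
    if "zs \<in> tuples M k" for zs
    using that y range_prep[of y "univ M" zs]
    by (intro bexI[of _ "prep zs y"] ballI sat_const_fm) (auto simp: tuples_def prep_def)
  show "countable (max_types {e. range e \<subseteq> univ M} (sat (expand M)) (param_forms L (range y) k))"
    using c by (simp add: types_eq_max_types)
qed auto

text \<open>Removes the restriction to models inside the type of formulas: the Skolem hull of
  \<open>y\<close> is copied into that type, and elementarity preserves which formulas are finitely
  satisfiable over \<open>y\<close>.\<close>

lemma omega_stable_countable_tuple_types:
  fixes L :: "('f, 'r) language" and M :: "('a, 'f, 'r) struct"
  assumes T: "omega_stable TYPE(('f, 'r) fm) L T" "T \<subseteq> sentences L"
    and M: "is_model L M T" and y: "range y \<subseteq> univ M"
  shows "countable (tuple_types L M y k)"
proof -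
  have sM: "is_struct L M" using M by (simp add: is_model_def)
  obtain H and g :: "'a \<Rightarrow> ('f, 'r) fm" where H: "range y \<subseteq> H" "H \<subseteq> univ M" "inj_on g H"
    and sH: "is_struct L (M\<lparr>univ := H\<rparr>)"
    and el: "\<And>e \<phi>. range e \<subseteq> H \<Longrightarrow> sat (M\<lparr>univ := H\<rparr>) e \<phi> \<longleftrightarrow> sat M e \<phi>"
    using Loewenheim_Skolem[OF sM y] by metis
  define N where "N = copy_struct g (M\<lparr>univ := H\<rparr>)"
  have uN: "univ N = g ` H" by (simp add: N_def copy_struct_def)
  have sN: "is_struct L N" unfolding N_def using sH H by (intro is_struct_copy) auto
  have sat: "sat N (\<lambda>i. g (e i)) \<phi> \<longleftrightarrow> sat M e \<phi>" if "range e \<subseteq> H" "wf_fm L \<phi>" for e \<phi>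
    unfolding N_def el[OF that(1), symmetric] using that H by (intro sat_copy[OF sH]) auto
  have "true_in N \<phi>" if "\<phi> \<in> T" for \<phi>
    unfolding true_in_def
  proof (intro allI impI)
    fix e :: "nat \<Rightarrow> ('f, 'r) fm" assume e: "range e \<subseteq> univ N"
    define d where "d i = inv_into H g (e i)" for i
    have "range d \<subseteq> H" using e by (auto simp: d_def uN intro!: inv_into_into)
    moreover have "e = (\<lambda>i. g (d i))" using e by (auto simp: d_def uN f_inv_into_f subset_iff fun_eq_iff)
    moreover have "wf_fm L \<phi>" using T(2) that by (auto simp: sentences_def)
    ultimately show "sat N e \<phi>"
      using sat M that H(2) unfolding is_model_def true_in_def by auto
  qed
  then have "is_model L N T" using sN by (simp add: is_model_def)
  moreover have gy: "range (\<lambda>i. g (y i)) \<subseteq> univ N" using H(1) by (auto simp: uN)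
  ultimately have "countable (types L N (range (\<lambda>i. g (y i))) k)"
    using T(1) unfolding omega_stable_def by blast
  from countable_tuple_types[OF this gy] have "countable (tuple_types L N (\<lambda>i. g (y i)) k)" .
  moreover have "tuple_types L N (\<lambda>i. g (y i)) k = tuple_types L M y k"
  proof (rule max_types_cong)
    fix p :: "('f, 'r) fm set" assume p: "p \<subseteq> {\<phi>. wf_fm L \<phi>}"
    have "(\<exists>zs\<in>tuples N k. \<forall>\<phi>\<in>q. sat N (prep zs (\<lambda>i. g (y i))) \<phi>) \<longleftrightarrow>
        (\<exists>zs\<in>tuples M k. \<forall>\<phi>\<in>q. sat M (prep zs y) \<phi>)" if q: "q \<subseteq> p" "finite q" for q
    proof -
      obtain ql where ql: "set ql = q" using q finite_list by auto
      let ?a = "replicate k (y 0)"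
      have ra: "range (prep ?a y) \<subseteq> H"
        using H(1) by (intro range_prep) (auto simp: set_replicate_conv_if)
      \<comment> \<open>Satisfiability of the finite set \<open>q\<close> by a tuple is a single
        existential formula about the parameters, which hull and copy preserve.\<close>
      have "(\<exists>zs\<in>tuples M k. \<forall>\<phi>\<in>q. sat M (prep zs y) \<phi>) \<longleftrightarrow> sat M (prep ?a y) (Exs [0..<k] (Conjs ql))"
        by (subst ex_prep_iff_Exs[OF y, symmetric]) (auto simp: sat_Conjs ql tuples_def)
      also have "\<dots> \<longleftrightarrow> sat N (\<lambda>i. g (prep ?a y i)) (Exs [0..<k] (Conjs ql))"
        using p q ql ra by (subst sat) (auto simp: wf_Exs wf_Conjs)
      also have "(\<lambda>i. g (prep ?a y i)) = prep (map g ?a) (\<lambda>i. g (y i))"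
        by (auto simp: prep_def fun_eq_iff)
      also have "sat N (prep (map g ?a) (\<lambda>i. g (y i))) (Exs [0..<k] (Conjs ql)) \<longleftrightarrow>
          (\<exists>zs\<in>tuples N k. \<forall>\<phi>\<in>q. sat N (prep zs (\<lambda>i. g (y i))) \<phi>)"
        by (subst ex_prep_iff_Exs[OF gy, symmetric]) (auto simp: sat_Conjs ql tuples_def)
      finally show ?thesis ..
    qed
    then show "fin_sat (tuples N k) (\<lambda>zs. sat N (prep zs (\<lambda>i. g (y i)))) p \<longleftrightarrow>
        fin_sat (tuples M k) (\<lambda>zs. sat M (prep zs y)) p"
      unfolding fin_sat_def by blast
  qed
  ultimately show ?thesis by simp
qed

section \<open>Polynomials over a field\<close>

text \<open>Integer polynomials are represented by expressions, since only their values matter. For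
  countable \<open>'v\<close> there are countably many, which the counting of types relies
  on.\<close>

datatype 'v ringpoly = PVar 'v | PZero | POne | PAdd "'v ringpoly" "'v ringpoly" | PNeg "'v ringpoly"
  | PMul "'v ringpoly" "'v ringpoly"

instance ringpoly :: (countable) countable
  by countable_datatype

primrec pval :: "('a, 'm) ring_scheme \<Rightarrow> ('v \<Rightarrow> 'a) \<Rightarrow> 'v ringpoly \<Rightarrow> 'a" where
  "pval R \<nu> (PVar v) = \<nu> v"
| "pval R \<nu> PZero = \<zero>\<^bsub>R\<^esub>"
| "pval R \<nu> POne = \<one>\<^bsub>R\<^esub>"
| "pval R \<nu> (PAdd p q) = pval R \<nu> p \<oplus>\<^bsub>R\<^esub> pval R \<nu> q"
| "pval R \<nu> (PNeg p) = \<ominus>\<^bsub>R\<^esub> pval R \<nu> p"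
| "pval R \<nu> (PMul p q) = pval R \<nu> p \<otimes>\<^bsub>R\<^esub> pval R \<nu> q"

text \<open>Evaluation of coefficient lists, constant coefficient first.\<close>

primrec horner :: "('a, 'm) ring_scheme \<Rightarrow> 'a list \<Rightarrow> 'a \<Rightarrow> 'a" where
  "horner R [] x = \<zero>\<^bsub>R\<^esub>"
| "horner R (c # cs) x = c \<oplus>\<^bsub>R\<^esub> x \<otimes>\<^bsub>R\<^esub> horner R cs x"

fun padd :: "'v ringpoly list \<Rightarrow> 'v ringpoly list \<Rightarrow> 'v ringpoly list" where
  "padd [] qs = qs"
| "padd ps [] = ps"
| "padd (p # ps) (q # qs) = PAdd p q # padd ps qs"

fun pmul :: "'v ringpoly list \<Rightarrow> 'v ringpoly list \<Rightarrow> 'v ringpoly list" where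
  "pmul [] qs = []"
| "pmul (p # ps) qs = padd (map (PMul p) qs) (PZero # pmul ps qs)"

text \<open>The list may end in coefficients with value zero, so its length only bounds the
  degree.\<close>

primrec coeffs_in :: "'v \<Rightarrow> 'v ringpoly \<Rightarrow> 'v ringpoly list" where
  "coeffs_in v (PVar w) = (if w = v then [PZero, POne] else [PVar w])"
| "coeffs_in v PZero = []"
| "coeffs_in v POne = [POne]"
| "coeffs_in v (PAdd p q) = padd (coeffs_in v p) (coeffs_in v q)"
| "coeffs_in v (PNeg p) = map PNeg (coeffs_in v p)"
| "coeffs_in v (PMul p q) = pmul (coeffs_in v p) (coeffs_in v q)"

lemma length_padd: "length (padd ps qs) = max (length ps) (length qs)"
  by (induction ps qs rule: padd.induct) auto

lemma pval_map: "pval R \<nu> (map_ringpoly f p) = pval R (\<lambda>v. \<nu> (f v)) p"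
  by (induction p) auto

lemma pval_cong: "(\<And>v. v \<in> set_ringpoly p \<Longrightarrow> \<nu> v = \<nu>' v) \<Longrightarrow> pval R \<nu> p = pval R \<nu>' p"
  by (induction p) auto

lemma finite_set_ringpoly: "finite (set_ringpoly p)"
  by (induction p) auto

context field
begin

lemma pval_closed [simp]: "range \<nu> \<subseteq> carrier R \<Longrightarrow> pval R \<nu> p \<in> carrier R"
  by (induction p) auto

lemma horner_closed [simp]: "set cs \<subseteq> carrier R \<Longrightarrow> x \<in> carrier R \<Longrightarrow> horner R cs x \<in> carrier R"
  by (induction cs) auto

lemma pvals_closed: "range \<nu> \<subseteq> carrier R \<Longrightarrow> set (map (pval R \<nu>) ps) \<subseteq> carrier R"
  by (simp add: image_subset_iff)

lemma horner_append:
  "set cs \<subseteq> carrier R \<Longrightarrow> set ds \<subseteq> carrier R \<Longrightarrow> x \<in> carrier R \<Longrightarrow>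
    horner R (cs @ ds) x = horner R cs x \<oplus> x [^] length cs \<otimes> horner R ds x"
proof (induction cs)
  case (Cons c cs)
  then have "horner R ((c # cs) @ ds) x =
      c \<oplus> x \<otimes> (horner R cs x \<oplus> x [^] length cs \<otimes> horner R ds x)"
    by simp
  also have "\<dots> = c \<oplus> x \<otimes> horner R cs x \<oplus> (x [^] length cs \<otimes> x) \<otimes> horner R ds x"
  proof -
    have "c \<oplus> x \<otimes> (h \<oplus> u \<otimes> g) = c \<oplus> x \<otimes> h \<oplus> (u \<otimes> x) \<otimes> g"
      if "c \<in> carrier R" "x \<in> carrier R" "h \<in> carrier R" "u \<in> carrier R" "g \<in> carrier R" for h u g
      using that by algebra
    then show ?thesis using Cons.prems by simp
  qed
  finally show ?case by simp
qed simp

lemma horner_zeros: "(\<And>c. c \<in> set cs \<Longrightarrow> c = \<zero>) \<Longrightarrow> x \<in> carrier R \<Longrightarrow> horner R cs x = \<zero>"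
  proof (induction cs)
  case (Cons c cs)
  then have "c = \<zero>" "horner R cs x = \<zero>" by auto
  then show ?case using Cons.prems(2) by simp
qed simp

context
  fixes \<nu> :: "'v \<Rightarrow> 'a" and x
  assumes \<nu>: "range \<nu> \<subseteq> carrier R" and x: "x \<in> carrier R"
begin

abbreviation "ph ps \<equiv> horner R (map (pval R \<nu>) ps) x"

lemma ph_closed: "ph ps \<in> carrier R"
  using \<nu> x by (intro horner_closed pvals_closed)

lemma horner_padd: "ph (padd ps qs) = ph ps \<oplus> ph qs"
proof (induction ps qs rule: padd.induct)
  case (3 p ps q qs)
  have "(a \<oplus> b) \<oplus> x \<otimes> (g \<oplus> h) = (a \<oplus> x \<otimes> g) \<oplus> (b \<oplus> x \<otimes> h)"
    if "a \<in> carrier R" "b \<in> carrier R" "g \<in> carrier R" "h \<in> carrier R" for a b g h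
    using that x by algebra
  then show ?case using 3 pval_closed[OF \<nu>] ph_closed by simp
next
  case (1 qs)
  show ?case using ph_closed[of qs] by simp
next
  case (2 p ps)
  show ?case using ph_closed[of "p # ps"] by simp
qed

lemma horner_pscale: "ph (map (PMul p) ps) = pval R \<nu> p \<otimes> ph ps"
proof (induction ps)
  case (Cons q ps)
  have "a \<otimes> b \<oplus> x \<otimes> (a \<otimes> h) = a \<otimes> (b \<oplus> x \<otimes> h)"
    if "a \<in> carrier R" "b \<in> carrier R" "h \<in> carrier R" for a b h
    using that x by algebra
  then show ?case using Cons pval_closed[OF \<nu>] ph_closed by simp
qed (simp add: \<nu>)

lemma horner_pmul: "ph (pmul ps qs) = ph ps \<otimes> ph qs"
proof (induction ps)
  case (Cons p ps)
  have c: "pval R \<nu> p \<in> carrier R" using \<nu> by simp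
  have "ph (pmul (p # ps) qs) = pval R \<nu> p \<otimes> ph qs \<oplus> x \<otimes> (ph ps \<otimes> ph qs)"
    using Cons x ph_closed[of ps] ph_closed[of qs] by (simp add: horner_padd horner_pscale del: map_map)
  then show ?case using c x ph_closed[of ps] ph_closed[of qs] by (simp add: l_distr m_assoc)
qed (simp add: ph_closed)

lemma horner_pneg: "ph (map PNeg ps) = \<ominus> ph ps"
proof (induction ps)
  case (Cons q ps)
  have c: "pval R \<nu> q \<in> carrier R" using \<nu> by simp
  then show ?case using Cons x ph_closed[of ps] by (simp add: minus_add r_minus)
qed auto

lemma horner_coeffs_in:
  "pval R (\<nu>(v := x)) p = ph (coeffs_in v p)"
proof (induction p)
  case (PVar w)
  have "\<nu> w \<in> carrier R" using \<nu> by auto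
  then show ?case using x by auto
qed (use x in \<open>simp_all add: horner_padd horner_pmul horner_pneg del: map_map\<close>)

end

section \<open>Pseudo-division\<close>

text \<open>The list \<open>rs @ [l]\<close> is the divisor with leading coefficient
  \<open>l\<close>, \<open>S\<close> the quotient, \<open>D\<close> the remainder and
  \<open>m\<close> the factor that avoids division. As one choice of \<open>m\<close>,
  \<open>S\<close>, \<open>D\<close> serves all valuations, the division can be read simultaneously
  on both sides of the back and forth.\<close>

definition pseudo_div where
  "pseudo_div rs l ps m S D \<longleftrightarrow> length D \<le> length rs \<and> length S = length ps - length rs \<and>
    (\<forall>\<nu> x. range \<nu> \<subseteq> carrier R \<longrightarrow> x \<in> carrier R \<longrightarrow>
      pval R \<nu> m \<otimes> horner R (map (pval R \<nu>) ps) x =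
        horner R (map (pval R \<nu>) S) x \<otimes> horner R (map (pval R \<nu>) (rs @ [l])) x \<oplus> horner R (map (pval R \<nu>) D) x) \<and>
    (\<forall>\<nu>. range \<nu> \<subseteq> carrier R \<longrightarrow> pval R \<nu> l \<noteq> \<zero> \<longrightarrow> pval R \<nu> m \<noteq> \<zero> \<and>
      (length rs < length ps \<longrightarrow> pval R \<nu> (last ps) \<noteq> \<zero> \<longrightarrow> pval R \<nu> (last S) \<noteq> \<zero>))"

lemma pseudo_division: "\<exists>m S D. pseudo_div rs l ps m S D"
proof (induction "length ps" arbitrary: ps rule: less_induct)
  case less
  show ?case
  proof (cases "length ps \<le> length rs")
    case True
    then have "pseudo_div rs l ps POne [] ps"
      unfolding pseudo_div_def by (auto simp: horner_closed[OF pvals_closed] simp del: map_append)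
    then show ?thesis by blast
  next
    case False
    then obtain ps0 a where ps: "ps = ps0 @ [a]" by (cases ps rule: rev_cases) auto
    define k where "k = length ps0 - length rs"
    have len: "length ps0 = k + length rs" using False ps by (simp add: k_def)
    \<comment> \<open>This is \<open>l\<close> times \<open>ps\<close> minus \<open>a\<close> times
      X^k times the divisor. The two top terms, both with coefficient \<open>l\<close> times
      \<open>a\<close>, cancel and are left out, so the list is shorter than
      \<open>ps\<close>.\<close>
    define qs where "qs = padd (map (PMul l) ps0) (map PNeg (map (PMul a) (replicate k PZero @ rs)))"
    have lq: "length qs = length ps0" by (simp add: qs_def len length_padd)
    obtain m S D where IH: "pseudo_div rs l qs m S D" using less[of qs] lq ps by auto
    then have D: "length D \<le> length rs" "length S = k"
      unfolding pseudo_div_def by (simp_all add: lq k_def)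
    have div: "\<And>\<nu> x. range \<nu> \<subseteq> carrier R \<Longrightarrow> x \<in> carrier R \<Longrightarrow>
      pval R \<nu> m \<otimes> horner R (map (pval R \<nu>) qs) x =
        horner R (map (pval R \<nu>) S) x \<otimes> horner R (map (pval R \<nu>) (rs @ [l])) x \<oplus> horner R (map (pval R \<nu>) D) x"
      using IH unfolding pseudo_div_def by blast
    have nz: "\<And>\<nu>. range \<nu> \<subseteq> carrier R \<Longrightarrow> pval R \<nu> l \<noteq> \<zero> \<Longrightarrow> pval R \<nu> m \<noteq> \<zero>"
      using IH unfolding pseudo_div_def by blast
    \<comment> \<open>\<open>S\<close> has length \<open>k\<close>, so appending
      \<open>PMul m a\<close> adds the term m a X^k to the quotient.\<close>
    let ?m = "PMul m l" and ?S = "S @ [PMul m a]"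
    have "pval R \<nu> ?m \<otimes> horner R (map (pval R \<nu>) ps) x =
        horner R (map (pval R \<nu>) ?S) x \<otimes> horner R (map (pval R \<nu>) (rs @ [l])) x \<oplus> horner R (map (pval R \<nu>) D) x"
      if \<nu>: "range \<nu> \<subseteq> carrier R" and x: "x \<in> carrier R" for \<nu> x
    proof -
      let ?h = "\<lambda>ps. horner R (map (pval R \<nu>) ps) x"
      have c: "?h ps \<in> carrier R" "pval R \<nu> p \<in> carrier R" for ps p using horner_closed[OF pvals_closed[OF \<nu>] x] pval_closed[OF \<nu>] by auto
      have z: "?h (replicate k PZero) = \<zero>" using x by (intro horner_zeros) auto
      have app: "?h (ps @ qs) = ?h ps \<oplus> x [^] length ps \<otimes> ?h qs" for ps qs
        using horner_append[OF pvals_closed[OF \<nu>, of ps] pvals_closed[OF \<nu>, of qs] x] by simp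
      have one: "?h [p] = pval R \<nu> p" for p using c x by simp
      \<comment> \<open>The evaluated lists become plain ring elements, which leaves polynomial
        identities in nine variables.\<close>
      define A L M H G S1 D1 u w where "A = pval R \<nu> a" "L = pval R \<nu> l" "M = pval R \<nu> m"
        "H = ?h ps0" "G = ?h rs" "S1 = ?h S" "D1 = ?h D" "u = x [^] k" "w = x [^] length rs"
      note defs = this
      have cl: "A \<in> carrier R" "L \<in> carrier R" "M \<in> carrier R" "H \<in> carrier R" "G \<in> carrier R"
        "S1 \<in> carrier R" "D1 \<in> carrier R" "u \<in> carrier R" "w \<in> carrier R"
        using c x by (auto simp: defs)
      have "?h qs = L \<otimes> H \<oplus> \<ominus> (A \<otimes> (u \<otimes> G))"
        unfolding qs_def using \<nu> x c
        by (simp only: horner_padd horner_pneg horner_pscale app z) (simp add: defs)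
      with div[OF \<nu> x] have e: "M \<otimes> (L \<otimes> H \<oplus> \<ominus> (A \<otimes> (u \<otimes> G))) = S1 \<otimes> (G \<oplus> w \<otimes> L) \<oplus> D1"
        by (simp only: app one defs)
      have "?h ps = H \<oplus> (u \<otimes> w) \<otimes> A"
        unfolding ps app one len using x by (simp add: defs nat_pow_mult)
      moreover have "?h ?S = S1 \<oplus> u \<otimes> (M \<otimes> A)"
        unfolding app one D(2) by (simp add: defs)
      moreover have "?h (rs @ [l]) = G \<oplus> w \<otimes> L" unfolding app one by (simp add: defs)
      moreover have "(M \<otimes> L) \<otimes> (H \<oplus> (u \<otimes> w) \<otimes> A) =
          M \<otimes> (L \<otimes> H \<oplus> \<ominus> (A \<otimes> (u \<otimes> G))) \<oplus> (u \<otimes> (M \<otimes> A)) \<otimes> (G \<oplus> w \<otimes> L)"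
        using cl by algebra
      moreover have "S1 \<otimes> (G \<oplus> w \<otimes> L) \<oplus> D1 \<oplus> (u \<otimes> (M \<otimes> A)) \<otimes> (G \<oplus> w \<otimes> L) =
          (S1 \<oplus> u \<otimes> (M \<otimes> A)) \<otimes> (G \<oplus> w \<otimes> L) \<oplus> D1"
        using cl by algebra
      ultimately show ?thesis using e by (simp add: defs(2,3,7) [symmetric])
    qed
    moreover have "pval R \<nu> ?m \<noteq> \<zero> \<and> (pval R \<nu> (last ps) \<noteq> \<zero> \<longrightarrow> pval R \<nu> (last ?S) \<noteq> \<zero>)"
      if \<nu>: "range \<nu> \<subseteq> carrier R" and l: "pval R \<nu> l \<noteq> \<zero>" for \<nu>
    proof -
      have "pval R \<nu> p \<in> carrier R" for p using pval_closed[OF \<nu>] .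
      then show ?thesis using nz[OF \<nu> l] l by (simp add: ps integral_iff)
    qed
    moreover have "length ?S = length ps - length rs" using D(2) len by (simp add: ps)
    ultimately have "pseudo_div rs l ps ?m ?S D" using D(1) unfolding pseudo_div_def by blast
    then show ?thesis by blast
  qed
qed

end

section \<open>Back and forth over a subfield\<close>

definition ring_of :: "('a, 'f rsym, 'r) struct \<Rightarrow> 'a ring" where
  "ring_of M = \<lparr>carrier = univ M, monoid.mult = (\<lambda>a b. ifun M RTimes [a, b]), one = ifun M ROne [],
     zero = ifun M RZero [], add = (\<lambda>a b. ifun M RPlus [a, b])\<rparr>"

definition P_struct :: "('a, 'f, 'r psym) struct \<Rightarrow> ('a, 'f, 'r) struct" where
  "P_struct M = \<lparr>univ = {a \<in> univ M. irel M SubP [a]}, ifun = ifun M, irel = (\<lambda>R. irel M (Base R))\<rparr>"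

lemma val_P_struct: "val (P_struct M) = val M"
proof (intro ext)
  show "val (P_struct M) e t = val M e t" for e t
    by (induction t) (auto simp: P_struct_def intro!: arg_cong[of _ _ "ifun M _"])
qed

text \<open>Three blocks of variables: \<open>PY\<close> for the sequence in the subfield,
  \<open>PE\<close> for the assignment in the large field, \<open>PC\<close> for a fixed sequence of
  constants that the back and forth never changes.\<close>

datatype pvar = PY nat | PE nat | PC nat

instance pvar :: countable
  by countable_datatype

definition valuation :: "(nat \<Rightarrow> 'a) \<Rightarrow> (nat \<Rightarrow> 'a) \<Rightarrow> (nat \<Rightarrow> 'a) \<Rightarrow> pvar \<Rightarrow> 'a" where
  "valuation y e c v = (case v of PY i \<Rightarrow> y i | PE i \<Rightarrow> e i | PC i \<Rightarrow> c i)"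

lemma valuation_simps [simp]:
  "valuation y e c (PY i) = y i" "valuation y e c (PE i) = e i" "valuation y e c (PC i) = c i"
  by (simp_all add: valuation_def)

lemma valuation_upd: "valuation y (e(i := x)) c = (valuation y e c)(PE i := x)"
  by (auto simp: valuation_def fun_eq_iff split: pvar.split)

lemma range_valuation: "range y \<subseteq> A \<Longrightarrow> range e \<subseteq> A \<Longrightarrow> range c \<subseteq> A \<Longrightarrow> range (valuation y e c) \<subseteq> A"
  by (auto simp: valuation_def image_subset_iff split: pvar.split)

text \<open>Follows the entries of the subfield sequence when \<open>k\<close> elements are put in
  front of it.\<close>

definition shift_pvar :: "nat \<Rightarrow> pvar \<Rightarrow> pvar" where
  "shift_pvar k v = (case v of PY i \<Rightarrow> PY (i + k) | _ \<Rightarrow> v)"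

text \<open>The algebraic form in which the axioms enter the back and forth;
  \<open>ACF_T_model\<close> derives it from the formulas.\<close>

locale pair_of_fields =
  fixes L :: "('f rsym, 'r) language" and N :: "('a, 'f rsym, 'r psym) struct"
  assumes L_rings: "sublanguage L_rings L"
    and struct: "is_struct (add_pred L) N" and P_struct: "is_struct L (P_struct N)"
    and field: "field (ring_of N)"
    and minus: "a \<in> univ N \<Longrightarrow> ifun N RMinus [a] = \<ominus>\<^bsub>ring_of N\<^esub> a"
    and root: "cs \<noteq> [] \<Longrightarrow> set cs \<subseteq> univ N \<Longrightarrow>
      \<exists>x\<in>univ N. horner (ring_of N) (cs @ [\<one>\<^bsub>ring_of N\<^esub>]) x = \<zero>\<^bsub>ring_of N\<^esub>"
    and P_inverse: "a \<in> univ (P_struct N) \<Longrightarrow> b \<in> univ N \<Longrightarrow>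
      a \<otimes>\<^bsub>ring_of N\<^esub> b = \<one>\<^bsub>ring_of N\<^esub> \<Longrightarrow> b \<in> univ (P_struct N)"
    and fun_outside: "f \<in> funs L \<Longrightarrow> f \<notin> funs (L_rings :: ('f rsym, 'r) language) \<Longrightarrow> length xs = far L f \<Longrightarrow>
      set xs \<subseteq> univ N \<Longrightarrow> \<not> set xs \<subseteq> univ (P_struct N) \<Longrightarrow> ifun N f xs = \<zero>\<^bsub>ring_of N\<^esub>"
    and rel_outside: "R \<in> rels L \<Longrightarrow> length xs = rar L R \<Longrightarrow>
      set xs \<subseteq> univ N \<Longrightarrow> \<not> set xs \<subseteq> univ (P_struct N) \<Longrightarrow> \<not> irel N (Base R) xs"
begin

abbreviation "K \<equiv> ring_of N"
abbreviation "F \<equiv> P_struct N"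

sublocale K: field K
  by (rule field)

lemma univ_N [simp]: "univ N = carrier K"
  by (simp add: ring_of_def)

lemma F_subset: "univ F \<subseteq> univ N"
  by (auto simp: P_struct_def)

lemma ring_of_simps: "a \<oplus>\<^bsub>K\<^esub> b = ifun N RPlus [a, b]" "a \<otimes>\<^bsub>K\<^esub> b = ifun N RTimes [a, b]"
  "\<zero>\<^bsub>K\<^esub> = ifun N RZero []" "\<one>\<^bsub>K\<^esub> = ifun N ROne []"
  unfolding ring_of_def by simp_all

definition tp_eq :: "(nat \<Rightarrow> 'a) \<Rightarrow> (nat \<Rightarrow> 'a) \<Rightarrow> bool" where
  "tp_eq y y' \<longleftrightarrow> (\<forall>\<phi>. wf_fm L \<phi> \<longrightarrow> (sat F y \<phi> \<longleftrightarrow> sat F y' \<phi>))"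

text \<open>The moves allowed on the subfield side: finitely many new parameters on each side, with
  the enlarged sequences again of the same type in \<open>F\<close>.\<close>

definition ext :: "(nat \<Rightarrow> 'a) \<Rightarrow> (nat \<Rightarrow> 'a) \<Rightarrow> (nat \<Rightarrow> 'a) \<Rightarrow> (nat \<Rightarrow> 'a) \<Rightarrow> bool" where
  "ext y y' y1 y1' \<longleftrightarrow> (\<exists>zs zs'. length zs = length zs' \<and> set zs \<subseteq> univ F \<and> set zs' \<subseteq> univ F \<and>
     y1 = prep zs y \<and> y1' = prep zs' y' \<and> tp_eq y1 y1')"

lemma tp_eq_sym: "tp_eq y y' \<Longrightarrow> tp_eq y' y"
  by (auto simp: tp_eq_def)

lemma tp_eq_prepD:
  assumes "tp_eq (prep zs y) (prep zs' y')" "length zs = length zs'"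
  shows "tp_eq y y'"
  unfolding tp_eq_def
proof (intro allI impI)
  fix \<phi> :: "('f rsym, 'r) fm" assume "wf_fm L \<phi>"
  from rename_formula[OF this, of "\<lambda>i. i + length zs"] obtain \<psi> where \<psi>: "wf_fm L \<psi>"
    "\<And>M :: ('a, 'f rsym, 'r) struct. \<And>e. sat M e \<psi> \<longleftrightarrow> sat M (\<lambda>k. e (k + length zs)) \<phi>" by blast
  have "(\<lambda>k. prep zs y (k + length zs)) = y" "(\<lambda>k. prep zs' y' (k + length zs)) = y'"
    by (simp, simp add: assms(2))
  then show "sat F y \<phi> \<longleftrightarrow> sat F y' \<phi>" using assms(1) \<psi> unfolding tp_eq_def by metis
qed

lemma ext_sym: "ext y y' y1 y1' \<Longrightarrow> ext y' y y1' y1"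
  unfolding ext_def by (metis tp_eq_sym)

lemma ext_refl: "tp_eq y y' \<Longrightarrow> ext y y' y y'"
  unfolding ext_def by (intro exI[of _ "[]"]) simp

lemma ext_trans: "ext y y' y1 y1' \<Longrightarrow> ext y1 y1' y2 y2' \<Longrightarrow> ext y y' y2 y2'"
  unfolding ext_def
proof (elim exE conjE)
  fix zs zs' ws ws'
  assume "length zs = length zs'" "set zs \<subseteq> univ F" "set zs' \<subseteq> univ F" "y1 = prep zs y" "y1' = prep zs' y'"
    "length ws = length ws'" "set ws \<subseteq> univ F" "set ws' \<subseteq> univ F" "y2 = prep ws y1" "y2' = prep ws' y1'"
    "tp_eq y2 y2'"
  then show "\<exists>zs zs'. length zs = length zs' \<and> set zs \<subseteq> univ F \<and> set zs' \<subseteq> univ F \<and>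
     y2 = prep zs y \<and> y2' = prep zs' y' \<and> tp_eq y2 y2'"
    by (intro exI[of _ "ws @ zs"] exI[of _ "ws' @ zs'"]) (simp add: prep_append)
qed

lemma ext_range:
  "ext y y' y1 y1' \<Longrightarrow> range y \<subseteq> univ F \<Longrightarrow> range y' \<subseteq> univ F \<Longrightarrow> range y1 \<subseteq> univ F \<and> range y1' \<subseteq> univ F"
  unfolding ext_def using range_prep by metis

lemma ext_tp_eq: "ext y y' y1 y1' \<Longrightarrow> tp_eq y1 y1'"
  by (auto simp: ext_def)

end

text \<open>\<open>forth_F\<close> is homogeneity of the subfield for countable sequences. The
  constants \<open>c\<close> will contain the parameters of the types to be counted.\<close>

locale saturated_pair = pair_of_fields L N
  for L :: "('f rsym, 'r) language" and N :: "('a, 'f rsym, 'r psym) struct" +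
  fixes c :: "nat \<Rightarrow> 'a"
  assumes forth_F: "tp_eq y y' \<Longrightarrow> range y \<subseteq> univ F \<Longrightarrow> range y' \<subseteq> univ F \<Longrightarrow> z \<in> univ F \<Longrightarrow>
      \<exists>z'\<in>univ F. tp_eq (prep [z] y) (prep [z'] y')"
    and c: "range c \<subseteq> univ N"
begin

abbreviation "pv y e \<equiv> pval K (valuation y e c)"

text \<open>Agreement is required over all matched extensions, so that \<open>star\<close> survives
  adding parameters from \<open>F\<close> and controls the relations of \<open>e\<close> over all of
  \<open>F\<close>, not only over \<open>y\<close>.\<close>

definition star :: "(nat \<Rightarrow> 'a) \<Rightarrow> (nat \<Rightarrow> 'a) \<Rightarrow> (nat \<Rightarrow> 'a) \<Rightarrow> (nat \<Rightarrow> 'a) \<Rightarrow> bool" where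
  "star y e y' e' \<longleftrightarrow> range y \<subseteq> univ F \<and> range y' \<subseteq> univ F \<and> range e \<subseteq> univ N \<and> range e' \<subseteq> univ N \<and>
     tp_eq y y' \<and> (\<forall>y1 y1'. ext y y' y1 y1' \<longrightarrow> (\<forall>p. pv y1 e p = \<zero>\<^bsub>K\<^esub> \<longleftrightarrow> pv y1' e' p = \<zero>\<^bsub>K\<^esub>))"

text \<open>\<open>d\<close> bounds the length, so the degree is less than \<open>d\<close>.
  Coefficients come from the ring generated by all of \<open>F\<close>, the entries of
  \<open>e\<close> and those of \<open>c\<close>; validity for every \<open>d\<close> means that
  \<open>x\<close> is transcendental over F(c, e).\<close>

definition no_rel :: "nat \<Rightarrow> (nat \<Rightarrow> 'a) \<Rightarrow> 'a \<Rightarrow> bool" where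
  "no_rel d e x \<longleftrightarrow> (\<forall>y ps. range y \<subseteq> univ F \<longrightarrow> length ps \<le> d \<longrightarrow>
     horner K (map (pv y e) ps) x = \<zero>\<^bsub>K\<^esub> \<longrightarrow> (\<forall>p\<in>set ps. pv y e p = \<zero>\<^bsub>K\<^esub>))"

text \<open>A minimal polynomial that is not made monic: its coefficients stay integer expressions,
  so the same \<open>Q\<close> can be evaluated at the partner tuple. Minimality is meant over all
  of \<open>F\<close>, not only over \<open>y\<close>.\<close>

definition min_poly :: "(nat \<Rightarrow> 'a) \<Rightarrow> (nat \<Rightarrow> 'a) \<Rightarrow> pvar ringpoly list \<Rightarrow> 'a \<Rightarrow> bool" where
  "min_poly y e Q x \<longleftrightarrow> Q \<noteq> [] \<and> pv y e (last Q) \<noteq> \<zero>\<^bsub>K\<^esub> \<and> horner K (map (pv y e) Q) x = \<zero>\<^bsub>K\<^esub> \<and>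
     no_rel (length (butlast Q)) e x"

lemma forth_F_list:
  assumes y: "tp_eq y y'" "range y \<subseteq> univ F" "range y' \<subseteq> univ F"
  shows "set zs \<subseteq> univ F \<Longrightarrow> \<exists>zs'. length zs' = length zs \<and> set zs' \<subseteq> univ F \<and> tp_eq (prep zs y) (prep zs' y')"
proof (induction zs)
  case Nil
  show ?case using y by (intro exI[of _ "[]"]) simp
next
  case (Cons z zs)
  then obtain zs' where zs': "length zs' = length zs" "set zs' \<subseteq> univ F" "tp_eq (prep zs y) (prep zs' y')" by auto
  obtain z' where "z' \<in> univ F" "tp_eq (prep [z] (prep zs y)) (prep [z'] (prep zs' y'))"
    using forth_F[OF zs'(3) range_prep range_prep, of z] Cons.prems zs'(2) y by auto
  then show ?case using zs' prep_append[of "[z]" zs y] prep_append[of "[z']" zs' y']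
    by (intro exI[of _ "z' # zs'"]) simp
qed

lemma starD:
  assumes "star y e y' e'"
  shows "range y \<subseteq> univ F" "range y' \<subseteq> univ F" "range e \<subseteq> univ N" "range e' \<subseteq> univ N" "tp_eq y y'"
  using assms by (auto simp: star_def)

lemma star_zero_iff:
  "star y e y' e' \<Longrightarrow> ext y y' y1 y1' \<Longrightarrow> pv y1 e p = \<zero>\<^bsub>K\<^esub> \<longleftrightarrow> pv y1' e' p = \<zero>\<^bsub>K\<^esub>"
  by (auto simp: star_def)

lemma starI:
  assumes "range y \<subseteq> univ F" "range y' \<subseteq> univ F" "range e \<subseteq> univ N" "range e' \<subseteq> univ N" "tp_eq y y'"
    and "\<And>y1 y1' p. ext y y' y1 y1' \<Longrightarrow> pv y1 e p = \<zero>\<^bsub>K\<^esub> \<longleftrightarrow> pv y1' e' p = \<zero>\<^bsub>K\<^esub>"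
  shows "star y e y' e'"
  using assms unfolding star_def by simp

lemma star_sym:
  assumes "star y e y' e'"
  shows "star y' e' y e"
proof (rule starI)
  show "pv y1 e' p = \<zero>\<^bsub>K\<^esub> \<longleftrightarrow> pv y1' e p = \<zero>\<^bsub>K\<^esub>" if "ext y' y y1 y1'" for y1 y1' p
    using star_zero_iff[OF assms ext_sym[OF that], of p] by simp
qed (use starD[OF assms] tp_eq_sym in simp_all)

lemma star_ext:
  assumes s: "star y e y' e'" and x: "ext y y' y1 y1'"
  shows "star y1 e y1' e'"
proof (rule starI)
  show "pv y2 e p = \<zero>\<^bsub>K\<^esub> \<longleftrightarrow> pv y2' e' p = \<zero>\<^bsub>K\<^esub>" if "ext y1 y1' y2 y2'" for y2 y2' p
    using star_zero_iff[OF s ext_trans[OF x that]] .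
qed (use starD[OF s] ext_range[OF x] ext_tp_eq[OF x] in simp_all)

lemma star_forth_F:
  assumes "star y e y' e'" "set zs \<subseteq> univ F"
  shows "\<exists>zs'. length zs' = length zs \<and> set zs' \<subseteq> univ F \<and> ext y y' (prep zs y) (prep zs' y')"
proof -
  obtain zs' where "length zs' = length zs" "set zs' \<subseteq> univ F" "tp_eq (prep zs y) (prep zs' y')"
    using forth_F_list[OF starD(5,1,2)[OF assms(1)] assms(2)] by auto
  then show ?thesis using assms(2) unfolding ext_def by (intro exI[of _ zs'] exI[of "\<lambda>zs. \<exists>zs'. P zs zs'" zs for P] conjI) auto
qed

lemma range_val: "range y \<subseteq> univ F \<Longrightarrow> range e \<subseteq> univ N \<Longrightarrow> range (valuation y e c) \<subseteq> carrier K"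
  using range_valuation[of y "univ N" e c] F_subset c by auto

lemma pv_closed: "range y \<subseteq> univ F \<Longrightarrow> range e \<subseteq> univ N \<Longrightarrow> pv y e p \<in> carrier K"
  using K.pval_closed[OF range_val] .

lemma pvs_closed: "range y \<subseteq> univ F \<Longrightarrow> range e \<subseteq> univ N \<Longrightarrow> set (map (pv y e) ps) \<subseteq> carrier K"
  using K.pvals_closed[OF range_val] .

lemma pv_shift: "pv (prep zs y) e (map_ringpoly (shift_pvar (length zs)) p) = pv y e p"
proof -
  have "(\<lambda>v. valuation (prep zs y) e c (shift_pvar (length zs) v)) = valuation y e c"
    by (auto simp: shift_pvar_def fun_eq_iff valuation_def split: pvar.split)
  then show ?thesis by (simp add: pval_map)
qed

text \<open>Finitely many expressions mention finitely many entries of \<open>y\<close>; these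
  entries are put in front of \<open>y0\<close>.\<close>

lemma ex_prep_agree:
  assumes "range y \<subseteq> univ F"
  shows "\<exists>zs. set zs \<subseteq> univ F \<and> (\<forall>p\<in>set ps. \<forall>e. pv (prep zs y0) e p = pv y e p)"
proof -
  define V where "V = (\<Union>p\<in>set ps. set_ringpoly p)"
  have "finite V" by (auto simp: V_def finite_set_ringpoly)
  then have "finite (PY -` V)" by (intro finite_vimageI) (auto simp: inj_def)
  then obtain k where k: "PY -` V \<subseteq> {..<k}" by (meson finite_nat_iff_bounded)
  have "pv (prep (map y [0..<k]) y0) e p = pv y e p" if "p \<in> set ps" for p e
  proof (rule pval_cong)
    fix v assume "v \<in> set_ringpoly p"
    then have "v \<in> V" using that by (auto simp: V_def)
    then show "valuation (prep (map y [0..<k]) y0) e c v = valuation y e c v"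
      using k by (cases v) (auto simp: prep_def)
  qed
  then show ?thesis using assms by (intro exI[of _ "map y [0..<k]"]) auto
qed

text \<open>A shortest relation has nonzero leading coefficient, since otherwise that coefficient
  could be dropped. Its finitely many coefficients from \<open>F\<close> are added to
  \<open>y0\<close>.\<close>

lemma ex_min_poly:
  assumes x: "x \<in> univ N" and e: "range e \<subseteq> univ N" and y0: "range y0 \<subseteq> univ F" and n: "\<not> no_rel d e x"
  shows "\<exists>zs Q. set zs \<subseteq> univ F \<and> min_poly (prep zs y0) e Q x \<and> length Q \<le> d"
proof -
  define d' where "d' = (LEAST d. \<not> no_rel d e x)"
  have d': "\<not> no_rel d' e x" "d' \<le> d" "\<And>k. k < d' \<Longrightarrow> no_rel k e x"
    unfolding d'_def using LeastI[of "\<lambda>d. \<not> no_rel d e x", OF n] Least_le[of "\<lambda>d. \<not> no_rel d e x", OF n] not_less_Least by auto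
  obtain y ps where y: "range y \<subseteq> univ F" and ps: "length ps \<le> d'"
      "horner K (map (pv y e) ps) x = \<zero>\<^bsub>K\<^esub>" and nz: "\<exists>p\<in>set ps. pv y e p \<noteq> \<zero>\<^bsub>K\<^esub>"
    using d'(1) unfolding no_rel_def by blast
  then obtain qs q where qs: "ps = qs @ [q]" by (cases ps rule: rev_cases) auto
  have nr: "no_rel (length qs) e x" using d'(3) ps(1) qs by auto
  have q: "pv y e q \<noteq> \<zero>\<^bsub>K\<^esub>"
  proof
    assume 0: "pv y e q = \<zero>\<^bsub>K\<^esub>"
    have "horner K (map (pv y e) ps) x = horner K (map (pv y e) qs) x"
      unfolding qs using K.horner_append[OF pvs_closed[OF y e, of qs] pvs_closed[OF y e, of "[q]"]] x
        K.horner_closed[OF pvs_closed[OF y e, of qs]]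
      by (simp add: 0)
    then have "\<forall>p\<in>set qs. pv y e p = \<zero>\<^bsub>K\<^esub>" using nr y ps(2) unfolding no_rel_def by auto
    then show False using nz 0 qs by auto
  qed
  obtain zs where zs: "set zs \<subseteq> univ F" "\<forall>p\<in>set ps. \<forall>e. pv (prep zs y0) e p = pv y e p"
    using ex_prep_agree[OF y] by blast
  then have "map (pv (prep zs y0) e) ps = map (pv y e) ps" by simp
  then have "min_poly (prep zs y0) e ps x"
    unfolding min_poly_def using q qs zs nr ps by (simp del: map_append map_eq_conv)
  then show ?thesis using zs(1) ps(1) d'(2) by (intro exI[of _ zs] exI[of _ ps]) auto
qed

text \<open>A polynomial in the changed entry is regrouped as a polynomial in that entry alone, so
  comparing one-variable polynomials at \<open>x\<close> and \<open>x'\<close> is enough.\<close>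

lemma star_extendI:
  assumes s: "star y e y' e'" and x: "x \<in> univ N" "x' \<in> univ N"
    and h: "\<And>y1 y1' ps. ext y y' y1 y1' \<Longrightarrow>
      horner K (map (pv y1 e) ps) x = \<zero>\<^bsub>K\<^esub> \<longleftrightarrow> horner K (map (pv y1' e') ps) x' = \<zero>\<^bsub>K\<^esub>"
  shows "star y (e(i := x)) y' (e'(i := x'))"
proof -
  note D = starD[OF s]
  have "pv y1 (e(i := x)) p = \<zero>\<^bsub>K\<^esub> \<longleftrightarrow> pv y1' (e'(i := x')) p = \<zero>\<^bsub>K\<^esub>" if "ext y y' y1 y1'" for y1 y1' p
  proof -
    have r: "range y1 \<subseteq> univ F" "range y1' \<subseteq> univ F" using ext_range[OF that D(1,2)] by auto
    have "pv y1 (e(i := x)) p = horner K (map (pv y1 e) (coeffs_in (PE i) p)) x"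
      unfolding valuation_upd by (rule K.horner_coeffs_in) (use range_val r D x in auto)
    moreover have "pv y1' (e'(i := x')) p = horner K (map (pv y1' e') (coeffs_in (PE i) p)) x'"
      unfolding valuation_upd by (rule K.horner_coeffs_in) (use range_val r D x in auto)
    ultimately show ?thesis using h[OF that] by simp
  qed
  moreover have "range (e(i := x)) \<subseteq> univ N" "range (e'(i := x')) \<subseteq> univ N" using D x by auto
  ultimately show ?thesis by (intro starI D(1,2,5))
qed

lemma no_rel_zero_iff:
  assumes "no_rel d e x" "length ps \<le> d" "range y \<subseteq> univ F" "x \<in> univ N"
  shows "horner K (map (pv y e) ps) x = \<zero>\<^bsub>K\<^esub> \<longleftrightarrow> (\<forall>p\<in>set ps. pv y e p = \<zero>\<^bsub>K\<^esub>)"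
proof
  assume "horner K (map (pv y e) ps) x = \<zero>\<^bsub>K\<^esub>"
  then show "\<forall>p\<in>set ps. pv y e p = \<zero>\<^bsub>K\<^esub>"
    using assms(1)[unfolded no_rel_def, rule_format, OF assms(3,2)] by blast
next
  assume "\<forall>p\<in>set ps. pv y e p = \<zero>\<^bsub>K\<^esub>"
  then show "horner K (map (pv y e) ps) x = \<zero>\<^bsub>K\<^esub>"
    using assms(4) by (intro K.horner_zeros) auto
qed

text \<open>On either side a polynomial vanishes exactly when all its coefficients do, and the
  coefficients are compared by the given \<open>star\<close>.\<close>

lemma star_transcendental:
  assumes s: "star y e y' e'" and x: "x \<in> univ N" "x' \<in> univ N"
    and t: "\<And>d. no_rel d e x" "\<And>d. no_rel d e' x'"
  shows "star y (e(i := x)) y' (e'(i := x'))"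
proof (rule star_extendI[OF s x])
  fix y1 y1' ps assume e1: "ext y y' y1 y1'"
  have "range y1 \<subseteq> univ F" "range y1' \<subseteq> univ F" using ext_range[OF e1 starD(1,2)[OF s]] by auto
  then show "horner K (map (pv y1 e) ps) x = \<zero>\<^bsub>K\<^esub> \<longleftrightarrow> horner K (map (pv y1' e') ps) x' = \<zero>\<^bsub>K\<^esub>"
    using no_rel_zero_iff[OF t(1) order.refl _ x(1)] no_rel_zero_iff[OF t(2) order.refl _ x(2)]
      star_zero_iff[OF s e1] by simp
qed

text \<open>At \<open>x\<close> the pseudo-division reads m ps = D with m nonzero, and
  \<open>D\<close> is too short to vanish at \<open>x\<close> unless its coefficients do.\<close>

lemma min_poly_zero_iff:
  assumes m: "min_poly y e (rs @ [l]) x" and p: "K.pseudo_div rs l ps m S D"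
    and y: "range y \<subseteq> univ F" and e: "range e \<subseteq> univ N" and x: "x \<in> univ N"
  shows "horner K (map (pv y e) ps) x = \<zero>\<^bsub>K\<^esub> \<longleftrightarrow> (\<forall>p\<in>set D. pv y e p = \<zero>\<^bsub>K\<^esub>)"
proof -
  let ?h = "\<lambda>ps. horner K (map (pv y e) ps) x"
  have c: "?h ps \<in> carrier K" "pv y e m \<in> carrier K" for ps
    using K.horner_closed[OF pvs_closed[OF y e]] pv_closed[OF y e] x by auto
  have "?h (rs @ [l]) = \<zero>\<^bsub>K\<^esub>" and l: "pv y e l \<noteq> \<zero>\<^bsub>K\<^esub>" and nr: "no_rel (length rs) e x"
    using m by (auto simp: min_poly_def)
  moreover have "pv y e m \<otimes>\<^bsub>K\<^esub> ?h ps = ?h S \<otimes>\<^bsub>K\<^esub> ?h (rs @ [l]) \<oplus>\<^bsub>K\<^esub> ?h D"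
    using p range_val[OF y e] x unfolding K.pseudo_div_def by simp
  ultimately have "pv y e m \<otimes>\<^bsub>K\<^esub> ?h ps = ?h D" using c by simp
  moreover have "pv y e m \<noteq> \<zero>\<^bsub>K\<^esub>" using p range_val[OF y e] l unfolding K.pseudo_div_def by blast
  ultimately have "?h ps = \<zero>\<^bsub>K\<^esub> \<longleftrightarrow> ?h D = \<zero>\<^bsub>K\<^esub>"
    using c K.integral_iff[of "pv y e m" "?h ps"] by auto
  then show ?thesis using no_rel_zero_iff[OF nr _ y x] p unfolding K.pseudo_div_def by simp
qed

lemma min_poly_shift:
  assumes "min_poly y e Q x"
  shows "min_poly (prep zs y) e (map (map_ringpoly (shift_pvar (length zs))) Q) x"
proof -
  have "map (pv (prep zs y) e) (map (map_ringpoly (shift_pvar (length zs))) Q) = map (pv y e) Q"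
    by (simp add: pv_shift)
  then show ?thesis using assms unfolding min_poly_def by (simp add: last_map pv_shift del: map_map map_eq_conv)
qed

text \<open>One pseudo-remainder serves both sides: vanishing at \<open>x\<close> or
  \<open>x'\<close> means vanishing of its coefficients, which \<open>star\<close>
  transfers.\<close>

lemma star_algebraic:
  assumes s: "star y e y' e'" and x: "x \<in> univ N" "x' \<in> univ N"
    and m: "min_poly y e Q x" "min_poly y' e' Q x'"
  shows "star y (e(i := x)) y' (e'(i := x'))"
proof (rule star_extendI[OF s x])
  fix y1 y1' ps assume e1: "ext y y' y1 y1'"
  then obtain zs zs' where zs: "length zs = length zs'" "y1 = prep zs y" "y1' = prep zs' y'"
    by (auto simp: ext_def)
  have r: "range y1 \<subseteq> univ F" "range y1' \<subseteq> univ F" using ext_range[OF e1 starD(1,2)[OF s]] by auto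
  let ?Q = "map (map_ringpoly (shift_pvar (length zs))) Q"
  have mp: "min_poly y1 e ?Q x" "min_poly y1' e' ?Q x'"
    using min_poly_shift[OF m(1), of zs] min_poly_shift[OF m(2), of zs'] zs by auto
  then obtain rs l where Q: "?Q = rs @ [l]" by (cases ?Q rule: rev_cases) (auto simp: min_poly_def)
  obtain m S D where p: "K.pseudo_div rs l ps m S D" using K.pseudo_division by blast
  show "horner K (map (pv y1 e) ps) x = \<zero>\<^bsub>K\<^esub> \<longleftrightarrow> horner K (map (pv y1' e') ps) x' = \<zero>\<^bsub>K\<^esub>"
    using min_poly_zero_iff[OF mp(1)[unfolded Q] p r(1) starD(3)[OF s] x(1)]
      min_poly_zero_iff[OF mp(2)[unfolded Q] p r(2) starD(4)[OF s] x(2)] star_zero_iff[OF s e1] by simp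
qed

lemma min_poly_butlast_nonempty:
  assumes "min_poly y e (rs @ [l]) x" "range y \<subseteq> univ F" "range e \<subseteq> univ N" "x \<in> univ N"
  shows "rs \<noteq> []"
proof
  assume "rs = []"
  then show False using assms pv_closed[OF assms(2,3), of l] unfolding min_poly_def by auto
qed

text \<open>The locale gives roots of monic polynomials only; the others are divided by their
  leading coefficient.\<close>

lemma ex_root:
  assumes cs: "cs \<noteq> []" "set cs \<subseteq> univ N" and l: "l \<in> univ N" "l \<noteq> \<zero>\<^bsub>K\<^esub>"
  shows "\<exists>x\<in>univ N. horner K (cs @ [l]) x = \<zero>\<^bsub>K\<^esub>"
proof -
  let ?i = "inv\<^bsub>K\<^esub> l"
  have i: "?i \<in> carrier K" "l \<otimes>\<^bsub>K\<^esub> ?i = \<one>\<^bsub>K\<^esub>" using l by (simp_all add: K.field_Units)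
  have sc: "horner K (map (\<lambda>a. l \<otimes>\<^bsub>K\<^esub> a) ds) x = l \<otimes>\<^bsub>K\<^esub> horner K ds x"
    if "set ds \<subseteq> carrier K" "x \<in> carrier K" for ds x
    using that(1)
  proof (induction ds)
    case (Cons d ds)
    have "l \<otimes>\<^bsub>K\<^esub> d \<oplus>\<^bsub>K\<^esub> x \<otimes>\<^bsub>K\<^esub> (l \<otimes>\<^bsub>K\<^esub> g) = l \<otimes>\<^bsub>K\<^esub> (d \<oplus>\<^bsub>K\<^esub> x \<otimes>\<^bsub>K\<^esub> g)" if "g \<in> carrier K" for g
      using that Cons.prems \<open>x \<in> carrier K\<close> l by (simp add: K.r_distr K.m_lcomm)
    then show ?case using Cons that(2) by simp
  qed (use l in simp)
  let ?cs = "map (\<lambda>a. ?i \<otimes>\<^bsub>K\<^esub> a) cs"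
  have cl: "set ?cs \<subseteq> univ N" using cs(2) i(1) K.m_closed by fastforce
  obtain x where x: "x \<in> univ N" "horner K (?cs @ [\<one>\<^bsub>K\<^esub>]) x = \<zero>\<^bsub>K\<^esub>"
    using root[of ?cs] cs(1) cl by auto
  have "map (\<lambda>a. l \<otimes>\<^bsub>K\<^esub> a) (?cs @ [\<one>\<^bsub>K\<^esub>]) = cs @ [l]"
    using cs(2) l i by (auto simp: K.m_assoc[symmetric] subset_iff intro!: map_idI)
  then have "horner K (cs @ [l]) x = l \<otimes>\<^bsub>K\<^esub> horner K (?cs @ [\<one>\<^bsub>K\<^esub>]) x"
    using sc[of "?cs @ [\<one>\<^bsub>K\<^esub>]" x] cl x(1) K.one_closed by simp
  then show ?thesis using x l by auto
qed

end

context saturated_pair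
begin

text \<open>Any root of \<open>Q\<close>, read on the other side, works. A shorter relation for it
  would pull back to a proper factor of \<open>Q\<close> up to a nonzero constant, and
  \<open>x\<close> would be a root of one of two shorter polynomials.\<close>

lemma ex_min_poly_partner:
  assumes s: "star y e y' e'" and x: "x \<in> univ N" and m: "min_poly y e Q x"
  shows "\<exists>x'\<in>univ N. min_poly y' e' Q x'"
proof -
  note D = starD[OF s]
  obtain qs q where Q: "Q = qs @ [q]" using m by (cases Q rule: rev_cases) (auto simp: min_poly_def)
  have qs: "qs \<noteq> []" using min_poly_butlast_nonempty[of y e qs q x] m Q D x by simp
  have q: "pv y e q \<noteq> \<zero>\<^bsub>K\<^esub>" and hQ: "horner K (map (pv y e) Q) x = \<zero>\<^bsub>K\<^esub>" and nr: "no_rel (length qs) e x"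
    using m Q by (auto simp: min_poly_def)
  have q': "pv y' e' q \<noteq> \<zero>\<^bsub>K\<^esub>" using star_zero_iff[OF s ext_refl[OF D(5)]] q by simp
  have "set (map (pv y' e') qs) \<subseteq> univ N" "pv y' e' q \<in> univ N"
    using pvs_closed[OF D(2,4)] pv_closed[OF D(2,4)] by simp_all
  from ex_root[OF _ this q'] obtain x' where x': "x' \<in> univ N" "horner K (map (pv y' e') Q) x' = \<zero>\<^bsub>K\<^esub>"
    using qs Q by auto
  have "no_rel (length qs) e' x'"
  proof (rule ccontr)
    assume "\<not> no_rel (length qs) e' x'"
    from ex_min_poly[OF x'(1) D(4,2) this] obtain zs' R where zs': "set zs' \<subseteq> univ F"
      "min_poly (prep zs' y') e' R x'" "length R \<le> length qs" by blast
    obtain rs l where R: "R = rs @ [l]" using zs'(2) by (cases R rule: rev_cases) (auto simp: min_poly_def)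
    \<comment> \<open>The parameters of the shorter polynomial \<open>R\<close> are carried back to
      the side of \<open>x\<close>.\<close>
    obtain zs where zs: "length zs = length zs'" "ext y y' (prep zs y) (prep zs' y')"
      using star_forth_F[OF star_sym[OF s] zs'(1)] ext_sym by blast
    define y1 y1' where "y1 = prep zs y" "y1' = prep zs' y'"
    note y1 = this
    have e1: "ext y y' y1 y1'" using zs y1 by simp
    have r: "range y1 \<subseteq> univ F" "range y1' \<subseteq> univ F" using ext_range[OF e1 D(1,2)] by auto
    have rs: "rs \<noteq> []" using min_poly_butlast_nonempty[of y1' e' rs l x'] zs'(2) R y1 r D x' by simp
    have l': "pv y1' e' l \<noteq> \<zero>\<^bsub>K\<^esub>" using zs'(2) R y1 by (simp add: min_poly_def)
    then have l: "pv y1 e l \<noteq> \<zero>\<^bsub>K\<^esub>" using star_zero_iff[OF s e1] by simp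
    define P where "P = map (map_ringpoly (shift_pvar (length zs))) Q"
    have P: "map (pv y1 e) P = map (pv y e) Q" "map (pv y1' e') P = map (pv y' e') Q"
      using pv_shift[of zs y e] pv_shift[of zs' y' e'] zs(1) by (simp_all add: P_def y1)
    have lastP: "pv y1 e (last P) \<noteq> \<zero>\<^bsub>K\<^esub>" using q pv_shift[of zs y e] by (simp add: P_def Q y1)
    have lenP: "length P = Suc (length qs)" by (simp add: P_def Q)
    \<comment> \<open>Divide \<open>Q\<close>, shifted to \<open>P\<close>, by \<open>R\<close>. The
      remainder vanishes coefficientwise on the side of \<open>x'\<close> because \<open>R\<close>
      is minimal there, hence also on the side of \<open>x\<close>; there m' P = S R
      remains.\<close>
    obtain m' S D' where pd: "K.pseudo_div rs l P m' S D'" using K.pseudo_division by blast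
    have "horner K (map (pv y1' e') P) x' = \<zero>\<^bsub>K\<^esub>" using x'(2) P by simp
    then have "\<forall>p\<in>set D'. pv y1' e' p = \<zero>\<^bsub>K\<^esub>"
      using min_poly_zero_iff[OF _ pd r(2) D(4) x'(1)] zs'(2) R y1 by simp
    then have "\<forall>p\<in>set D'. pv y1 e p = \<zero>\<^bsub>K\<^esub>" using star_zero_iff[OF s e1] by simp
    then have D0: "horner K (map (pv y1 e) D') x = \<zero>\<^bsub>K\<^esub>" using x by (intro K.horner_zeros) auto
    have c: "horner K (map (pv y1 e) ps) x \<in> carrier K" for ps
      using K.horner_closed[OF pvs_closed[OF r(1) D(3)]] x by simp
    have rv: "range (valuation y1 e c) \<subseteq> carrier K" using range_val[OF r(1) D(3)] .
    have "pv y1 e m' \<otimes>\<^bsub>K\<^esub> horner K (map (pv y1 e) P) x =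
        horner K (map (pv y1 e) S) x \<otimes>\<^bsub>K\<^esub> horner K (map (pv y1 e) (rs @ [l])) x \<oplus>\<^bsub>K\<^esub> horner K (map (pv y1 e) D') x"
      using pd rv x unfolding K.pseudo_div_def by simp
    then have "horner K (map (pv y1 e) S) x \<otimes>\<^bsub>K\<^esub> horner K (map (pv y1 e) (rs @ [l])) x = \<zero>\<^bsub>K\<^esub>"
      unfolding P(1) hQ D0 using c pv_closed[OF r(1) D(3)] by (simp del: map_append)
    then consider "horner K (map (pv y1 e) S) x = \<zero>\<^bsub>K\<^esub>" | "horner K (map (pv y1 e) (rs @ [l])) x = \<zero>\<^bsub>K\<^esub>"
      using c K.integral_iff by blast
    then show False
    proof cases
      case 1
      have len: "length S = length P - length rs" using pd unfolding K.pseudo_div_def by simp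
      moreover have rl: "length rs < length P" using zs'(3) R lenP by simp
      \<comment> \<open>As \<open>R\<close> is not constant, the quotient is shorter than
        \<open>Q\<close>, so minimality of \<open>Q\<close> makes its leading coefficient
        vanish.\<close>
      ultimately have "length S \<le> length qs" "S \<noteq> []" using rs lenP by (cases rs, auto)
      then have "pv y1 e (last S) = \<zero>\<^bsub>K\<^esub>"
        using 1 no_rel_zero_iff[OF nr _ r(1) x] by auto
      moreover have "pv y1 e (last S) \<noteq> \<zero>\<^bsub>K\<^esub>"
        using pd rv l rl lastP unfolding K.pseudo_div_def by blast
      ultimately show False by simp
    next
      case 2
      then show False using no_rel_zero_iff[OF nr _ r(1) x, of "rs @ [l]"] zs'(3) R l by auto
    qed
  qed
  then show ?thesis using x' q' Q unfolding min_poly_def by (intro bexI[of _ x']) simp_all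
qed

end

section \<open>Preservation of all formulas\<close>

text \<open>Either transcendental elements exist over every F(c, e), or over none. A transcendental
  element then never lacks a partner; \<open>ex_homogeneous\<close> enlarges \<open>c\<close> to
  reach this situation.\<close>

locale homogeneous_pair = saturated_pair L N c
  for L :: "('f rsym, 'r) language" and N :: "('a, 'f rsym, 'r psym) struct" and c +
  assumes dichotomy: "(\<forall>e. range e \<subseteq> univ N \<longrightarrow> (\<exists>x\<in>univ N. \<forall>d. no_rel d e x)) \<or>
    (\<forall>e. range e \<subseteq> univ N \<longrightarrow> (\<forall>x\<in>univ N. \<exists>d. \<not> no_rel d e x))"
begin

text \<open>In the algebraic case the sequences in \<open>F\<close> grow by the coefficients of the
  minimal polynomial, hence the new \<open>y1\<close> and \<open>y1'\<close>.\<close>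

lemma star_forth:
  assumes s: "star y e y' e'" and x: "x \<in> univ N"
  shows "\<exists>x'\<in>univ N. \<exists>y1 y1'. star y1 (e(i := x)) y1' (e'(i := x'))"
proof (cases "\<forall>d. no_rel d e x")
  case True
  then obtain x' where "x' \<in> univ N" "\<forall>d. no_rel d e' x'"
    using dichotomy starD(3,4)[OF s] x by blast
  then show ?thesis using star_transcendental[OF s x] True by blast
next
  case False
  then obtain zs Q where zs: "set zs \<subseteq> univ F" "min_poly (prep zs y) e Q x"
    using ex_min_poly[OF x starD(3,1)[OF s]] by blast
  obtain zs' where "ext y y' (prep zs y) (prep zs' y')" using star_forth_F[OF s zs(1)] by blast
  then have s1: "star (prep zs y) e (prep zs' y') e'" using star_ext[OF s] by blast
  obtain x' where "x' \<in> univ N" "min_poly (prep zs' y') e' Q x'"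
    using ex_min_poly_partner[OF s1 x zs(2)] by blast
  then show ?thesis using star_algebraic[OF s1 x _ zs(2)] by blast
qed

text \<open>The partial ring isomorphism induced by the two valuations: values of the same
  expression correspond.\<close>

definition graph :: "(nat \<Rightarrow> 'a) \<Rightarrow> (nat \<Rightarrow> 'a) \<Rightarrow> (nat \<Rightarrow> 'a) \<Rightarrow> (nat \<Rightarrow> 'a) \<Rightarrow> 'a \<Rightarrow> 'a \<Rightarrow> bool" where
  "graph y e y' e' a a' \<longleftrightarrow> (\<exists>p. a = pv y e p \<and> a' = pv y' e' p)"

lemma graph_ext:
  assumes "ext y y' y1 y1'" "graph y e y' e' a a'"
  shows "graph y1 e y1' e' a a'"
proof -
  obtain zs zs' where zs: "length zs = length zs'" "y1 = prep zs y" "y1' = prep zs' y'"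
    using assms(1) by (auto simp: ext_def)
  obtain p where "a = pv y e p" "a' = pv y' e' p" using assms(2) by (auto simp: graph_def)
  then show ?thesis unfolding graph_def zs(2,3)
    using pv_shift[of zs y e p] pv_shift[of zs' y' e' p] zs(1)
    by (intro exI[of _ "map_ringpoly (shift_pvar (length zs)) p"]) simp
qed

lemma graph_in_N:
  assumes "star y e y' e'" "graph y e y' e' a a'"
  shows "a \<in> univ N" "a' \<in> univ N"
  using assms(2) pv_closed[OF starD(1,3)[OF assms(1)]] pv_closed[OF starD(2,4)[OF assms(1)]]
  by (auto simp: graph_def)

lemma graph_functional:
  assumes s: "star y e y' e'" and g: "graph y e y' e' a a'" "graph y e y' e' b b'"
  shows "a = b \<longleftrightarrow> a' = b'"
proof -
  obtain p q where pq: "a = pv y e p" "a' = pv y' e' p" "b = pv y e q" "b' = pv y' e' q"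
    using g by (auto simp: graph_def)
  have *: "u = v \<longleftrightarrow> u \<oplus>\<^bsub>K\<^esub> \<ominus>\<^bsub>K\<^esub> v = \<zero>\<^bsub>K\<^esub>" if "u \<in> carrier K" "v \<in> carrier K" for u v
    using K.r_right_minus_eq[OF that] by (simp add: a_minus_def)
  have "a = b \<longleftrightarrow> pv y e (PAdd p (PNeg q)) = \<zero>\<^bsub>K\<^esub>"
    using *[of a b] graph_in_N[OF s g(1)] graph_in_N[OF s g(2)] pq by simp
  also have "\<dots> \<longleftrightarrow> pv y' e' (PAdd p (PNeg q)) = \<zero>\<^bsub>K\<^esub>"
    using star_zero_iff[OF s ext_refl[OF starD(5)[OF s]]] .
  also have "\<dots> \<longleftrightarrow> a' = b'"
    using *[of a' b'] graph_in_N[OF s g(1)] graph_in_N[OF s g(2)] pq by simp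
  finally show ?thesis .
qed

lemma graph_prep:
  assumes "length zs = length zs'"
  shows "list_all2 (graph (prep zs y) e (prep zs' y') e') zs zs'"
  unfolding list_all2_conv_all_nth
proof (intro conjI allI impI)
  fix i assume "i < length zs"
  then show "graph (prep zs y) e (prep zs' y') e' (zs ! i) (zs' ! i)"
    unfolding graph_def using assms by (intro exI[of _ "PVar (PY i)"]) (simp add: prep_def)
qed (rule assms)

text \<open>Homogeneity gives some partner \<open>zs'\<close> of \<open>vs\<close> in
  \<open>F\<close>. After both are prepended, each entry of \<open>vs\<close> is the value of a
  variable and of its old expression, so the two expressions agree on the other side too, and
  \<open>vs'\<close> is \<open>zs'\<close>.\<close>

lemma graph_F_list:
  assumes s: "star y e y' e'" and g: "list_all2 (graph y e y' e') vs vs'" and F: "set vs \<subseteq> univ F"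
  shows "set vs' \<subseteq> univ F \<and> ext y y' (prep vs y) (prep vs' y')"
proof -
  obtain zs' where zs': "length zs' = length vs" "set zs' \<subseteq> univ F" "ext y y' (prep vs y) (prep zs' y')"
    using star_forth_F[OF s F] by blast
  have s1: "star (prep vs y) e (prep zs' y') e'" using star_ext[OF s zs'(3)] .
  have "vs' = zs'"
  proof (rule nth_equalityI)
    show "length vs' = length zs'" using g zs'(1) by (simp add: list_all2_lengthD)
    fix i assume i: "i < length vs'"
    then have i': "i < length vs" using g by (simp add: list_all2_lengthD)
    have "graph (prep vs y) e (prep zs' y') e' (vs ! i) (vs' ! i)"
      using graph_ext[OF zs'(3)] list_all2_nthD[OF g i'] by blast
    moreover have "graph (prep vs y) e (prep zs' y') e' (vs ! i) (zs' ! i)"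
      using list_all2_nthD[OF graph_prep[of vs zs'] i'] zs'(1) by simp
    ultimately show "vs' ! i = zs' ! i" using graph_functional[OF s1] by blast
  qed
  then show ?thesis using zs' by simp
qed

lemma graph_F_iff:
  assumes s: "star y e y' e'" and g: "list_all2 (graph y e y' e') vs vs'"
  shows "set vs \<subseteq> univ F \<longleftrightarrow> set vs' \<subseteq> univ F"
proof -
  have "list_all2 (graph y' e' y e) vs' vs"
    using g unfolding list_all2_conv_all_nth graph_def by metis
  then show ?thesis using graph_F_list[OF s g] graph_F_list[OF star_sym[OF s]] by blast
qed

text \<open>Ring symbols act on expressions. Any other symbol is zero at arguments not all in
  \<open>F\<close>, and at arguments in \<open>F\<close> its value is a new element of
  \<open>F\<close> that is added to the sequence; this is why \<open>y1\<close> and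
  \<open>y1'\<close> are existentially quantified.\<close>

lemma term_values:
  assumes s: "star y e y' e'"
  shows "wf_tm L t \<Longrightarrow> \<exists>y1 y1'. ext y y' y1 y1' \<and> graph y1 e y1' e' (val N e t) (val N e' t)"
  using s
proof (induction t arbitrary: y y')
  case (Var i)
  then show ?case
    by (intro exI[of _ y] exI[of _ y'] conjI ext_refl starD(5))
      (auto simp: graph_def intro: exI[of _ "PVar (PE i)"])
next
  case (Fun f ts)
  have f: "f \<in> funs L" "length ts = far L f" and wf: "\<And>t. t \<in> set ts \<Longrightarrow> wf_tm L t"
    using Fun.prems(1) by (auto simp: list_all_iff)
  have "\<exists>y1 y1'. ext y y' y1 y1' \<and> list_all2 (graph y1 e y1' e') (map (val N e) us) (map (val N e') us)"
    if "set us \<subseteq> set ts" for us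
    using that
  proof (induction us)
    case Nil
    show ?case using ext_refl[OF starD(5)[OF Fun.prems(2)]] by auto
  next
    case (Cons u us)
    then obtain y1 y1' where 1: "ext y y' y1 y1'"
      "list_all2 (graph y1 e y1' e') (map (val N e) us) (map (val N e') us)" by auto
    have "u \<in> set ts" using Cons.prems by simp
    then obtain y2 y2' where 2: "ext y1 y1' y2 y2'" "graph y2 e y2' e' (val N e u) (val N e' u)"
      using Fun.IH[of u y1 y1'] wf star_ext[OF Fun.prems(2) 1(1)] by blast
    have "list_all2 (graph y2 e y2' e') (map (val N e) us) (map (val N e') us)"
      using 1(2) graph_ext[OF 2(1)] by (rule list_all2_mono)
    then show ?case using ext_trans[OF 1(1) 2(1)] 2(2) by auto
  qed
  then obtain y1 y1' where e1: "ext y y' y1 y1'"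
    and g: "list_all2 (graph y1 e y1' e') (map (val N e) ts) (map (val N e') ts)" by blast
  have s1: "star y1 e y1' e'" using star_ext[OF Fun.prems(2) e1] .
  define vs vs' where "vs = map (val N e) ts" "vs' = map (val N e') ts"
  note vs = this
  have g: "list_all2 (graph y1 e y1' e') vs vs'" using g vs by simp
  have len: "length vs = far L f" "length vs' = far L f" using f vs by simp_all
  have N: "set vs \<subseteq> univ N" "set vs' \<subseteq> univ N"
    using g graph_in_N[OF s1] by (force simp: list_all2_conv_all_nth in_set_conv_nth)+
  have "\<exists>y2 y2'. ext y1 y1' y2 y2' \<and> graph y2 e y2' e' (ifun N f vs) (ifun N f vs')"
  proof (cases "f \<in> funs (L_rings :: ('f rsym, 'r) language)")
    case True
    have "graph y1 e y1' e' (ifun N f vs) (ifun N f vs')"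
    proof -
      consider "f = RZero" | "f = ROne" | "f = RPlus" | "f = RTimes" | "f = RMinus"
        using True by (auto simp: L_rings_def)
      then show ?thesis
      proof cases
        case 1
        then have "vs = []" "vs' = []" using len L_rings_arity[OF L_rings] by auto
        then show ?thesis using 1 unfolding graph_def by (intro exI[of _ PZero]) (simp add: ring_of_simps)
      next
        case 2
        then have "vs = []" "vs' = []" using len L_rings_arity[OF L_rings] by auto
        then show ?thesis using 2 unfolding graph_def by (intro exI[of _ POne]) (simp add: ring_of_simps)
      next
        case 3
        then obtain a b a' b' where v: "vs = [a, b]" "vs' = [a', b']"
          using len L_rings_arity[OF L_rings] by (auto simp: numeral_2_eq_2 length_Suc_conv)
        then obtain p q where "a = pv y1 e p" "a' = pv y1' e' p" "b = pv y1 e q" "b' = pv y1' e' q"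
          using g by (auto simp: graph_def)
        then show ?thesis using 3 v unfolding graph_def by (intro exI[of _ "PAdd p q"]) (simp add: ring_of_simps)
      next
        case 4
        then obtain a b a' b' where v: "vs = [a, b]" "vs' = [a', b']"
          using len L_rings_arity[OF L_rings] by (auto simp: numeral_2_eq_2 length_Suc_conv)
        then obtain p q where "a = pv y1 e p" "a' = pv y1' e' p" "b = pv y1 e q" "b' = pv y1' e' q"
          using g by (auto simp: graph_def)
        then show ?thesis using 4 v unfolding graph_def by (intro exI[of _ "PMul p q"]) (simp add: ring_of_simps)
      next
        case 5
        then obtain a a' where v: "vs = [a]" "vs' = [a']"
          using len L_rings_arity[OF L_rings] by (auto simp: length_Suc_conv)
        then obtain p where "a = pv y1 e p" "a' = pv y1' e' p"
          using g by (auto simp: graph_def)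
        then show ?thesis using 5 v N minus unfolding graph_def by (intro exI[of _ "PNeg p"]) simp
      qed
    qed
    then show ?thesis using ext_refl[OF starD(5)[OF s1]] by blast
  next
    case False
    show ?thesis
    proof (cases "set vs \<subseteq> univ F")
      case True
      define w where "w = ifun N f vs"
      have "ifun F f vs \<in> univ F" using P_struct True len f(1) unfolding is_struct_def by blast
      then have w: "w \<in> univ F" by (simp add: w_def P_struct_def)
      have V: "set vs' \<subseteq> univ F" "ext y1 y1' (prep vs y1) (prep vs' y1')"
        using graph_F_list[OF s1 g True] by auto
      have s2: "star (prep vs y1) e (prep vs' y1') e'" using star_ext[OF s1 V(2)] .
      obtain w' where w': "w' \<in> univ F" "ext (prep vs y1) (prep vs' y1') (prep [w] (prep vs y1)) (prep [w'] (prep vs' y1'))"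
        using star_forth_F[OF s2, of "[w]"] w by (auto simp: length_Suc_conv)
      let ?n = "far L f"
      \<comment> \<open>Variable 0 is the prepended value, variables 1 to n the arguments. Equality
        of types makes the partner of the value the value at the partner arguments.\<close>
      let ?\<phi> = "Eq (Var 0) (Fun f (map Var [1..<Suc ?n])) :: ('f rsym, 'r) fm"
      have mp: "map (val F (prep [a] (prep us y))) (map Var [1..<Suc ?n]) = us" if "length us = ?n" for a us y
        by (rule nth_equalityI) (use that in \<open>auto simp: prep_def simp del: upt_Suc\<close>)
      have "wf_fm L ?\<phi>" using f(1) by (simp add: list_all_iff del: upt_Suc)
      then have "sat F (prep [w] (prep vs y1)) ?\<phi> \<longleftrightarrow> sat F (prep [w'] (prep vs' y1')) ?\<phi>"
        using ext_tp_eq[OF w'(2)] unfolding tp_eq_def by blast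
      then have "w' = ifun N f vs'"
        using mp[OF len(1)] mp[OF len(2)]
        by (simp add: prep_Cons P_struct_def w_def del: map_map upt_Suc)
      moreover have "graph (prep [w] (prep vs y1)) e (prep [w'] (prep vs' y1')) e' w w'"
        using graph_prep[of "[w]" "[w']"] by simp
      ultimately show ?thesis using ext_trans[OF V(2) w'(2)] w_def by blast
    next
      case out: False
      then have "\<not> set vs' \<subseteq> univ F" using graph_F_iff[OF s1 g] by simp
      then have "ifun N f vs = \<zero>\<^bsub>K\<^esub>" "ifun N f vs' = \<zero>\<^bsub>K\<^esub>"
        using fun_outside[OF f(1) False] len N out by auto
      then have "graph y1 e y1' e' (ifun N f vs) (ifun N f vs')"
        unfolding graph_def by (intro exI[of _ PZero]) simp
      then show ?thesis using ext_refl[OF starD(5)[OF s1]] by blast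
    qed
  qed
  then show ?case using ext_trans[OF e1] by (auto simp: vs)
qed

lemma term_list_values:
  assumes s: "star y e y' e'" and wf: "\<And>t. t \<in> set ts \<Longrightarrow> wf_tm L t"
  shows "\<exists>y1 y1'. star y1 e y1' e' \<and> list_all2 (graph y1 e y1' e') (map (val N e) ts) (map (val N e') ts)"
  using wf
proof (induction ts)
  case Nil
  show ?case using s by auto
next
  case (Cons t ts)
  then obtain y1 y1' where 1: "star y1 e y1' e'"
    "list_all2 (graph y1 e y1' e') (map (val N e) ts) (map (val N e') ts)" by auto
  obtain y2 y2' where 2: "ext y1 y1' y2 y2'" "graph y2 e y2' e' (val N e t) (val N e' t)"
    using term_values[OF 1(1), of t] Cons.prems by auto
  have "list_all2 (graph y2 e y2' e') (map (val N e) ts) (map (val N e') ts)"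
    using 1(2) graph_ext[OF 2(1)] by (rule list_all2_mono)
  then show ?case using star_ext[OF 1(1) 2(1)] 2(2) by auto
qed

text \<open>A relation that holds has all its arguments in \<open>F\<close>, where equality of types
  decides it. One direction is enough, because \<open>star\<close> is symmetric.\<close>

lemma star_rel:
  assumes s: "star y e y' e'" and R: "R \<in> rels (add_pred L)" and len: "length vs = rar (add_pred L) R"
    and g: "list_all2 (graph y e y' e') vs vs'" and h: "irel N R vs"
  shows "irel N R vs'"
proof (cases R)
  case SubP
  then have l: "length vs = 1" using len by (simp add: add_pred_def)
  have N: "set vs \<subseteq> univ N"
    using g graph_in_N[OF s] by (force simp: list_all2_conv_all_nth in_set_conv_nth)
  obtain a a' where v: "vs = [a]" "vs' = [a']"
    using l list_all2_lengthD[OF g] by (auto simp: length_Suc_conv)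
  have "set vs \<subseteq> univ F" using h v N SubP by (simp add: P_struct_def)
  then have "set vs' \<subseteq> univ F" using graph_F_iff[OF s g] by simp
  then show ?thesis using v SubP by (simp add: P_struct_def)
next
  case (Base S)
  then have S: "S \<in> rels L" "length vs = rar L S" using R len by (auto simp: add_pred_def)
  have N: "set vs \<subseteq> univ N"
    using g graph_in_N[OF s] by (force simp: list_all2_conv_all_nth in_set_conv_nth)
  have F: "set vs \<subseteq> univ F" using rel_outside[OF S N] h Base by blast
  have l': "length vs' = rar L S" using list_all2_lengthD[OF g] S(2) by simp
  let ?n = "rar L S"
  let ?\<phi> = "Rel S (map Var [0..<?n]) :: ('f rsym, 'r) fm"
  have mp: "map (val F (prep us y)) (map Var [0..<?n]) = us" if "length us = ?n" for us y
    by (rule nth_equalityI) (use that in \<open>auto simp: prep_def\<close>)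
  have "wf_fm L ?\<phi>" using S(1) by (simp add: list_all_iff)
  then have "sat F (prep vs y) ?\<phi> \<longleftrightarrow> sat F (prep vs' y') ?\<phi>"
    using ext_tp_eq graph_F_list[OF s g F] unfolding tp_eq_def by blast
  then show ?thesis using mp[OF S(2)] mp[OF l'] h Base by (simp add: P_struct_def del: map_map)
qed

text \<open>The sequences vary in the induction because atomic formulas and quantifier steps both
  add parameters from \<open>F\<close>.\<close>

lemma star_sat_iff:
  "wf_fm (add_pred L) \<phi> \<Longrightarrow> star y e y' e' \<Longrightarrow> sat N e \<phi> \<longleftrightarrow> sat N e' \<phi>"
proof (induction \<phi> arbitrary: y e y' e')
  case (Eq s t)
  obtain y1 y1' where "star y1 e y1' e'"
    "list_all2 (graph y1 e y1' e') (map (val N e) [s, t]) (map (val N e') [s, t])"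
    using term_list_values[OF Eq.prems(2), of "[s, t]"] Eq.prems(1) by (auto simp: wf_add_pred_tm)
  then show ?case using graph_functional by auto
next
  case (Rel R ts)
  obtain y1 y1' where s1: "star y1 e y1' e'"
    and g: "list_all2 (graph y1 e y1' e') (map (val N e) ts) (map (val N e') ts)"
    using term_list_values[OF Rel.prems(2), of ts] Rel.prems(1) by (auto simp: wf_add_pred_tm list_all_iff)
  have g': "list_all2 (graph y1' e' y1 e) (map (val N e') ts) (map (val N e) ts)"
    using g unfolding list_all2_conv_all_nth graph_def by metis
  have R: "R \<in> rels (add_pred L)" "length ts = rar (add_pred L) R" using Rel.prems(1) by auto
  show ?case
    using star_rel[OF s1 R(1) _ g] star_rel[OF star_sym[OF s1] R(1) _ g'] R(2) by auto
next
  case (Imp \<phi> \<psi>)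
  then show ?case by (metis sat.simps(4) wf_fm.simps(4))
next
  case (Forall i \<phi>)
  have *: "sat N e' (Forall i \<phi>)" if s: "star y e y' e'" and h: "sat N e (Forall i \<phi>)" for y e y' e'
    unfolding sat.simps
  proof
    fix a' assume "a' \<in> univ N"
    then obtain a y1 y1' where "a \<in> univ N" "star y1' (e'(i := a')) y1 (e(i := a))"
      using star_forth[OF star_sym[OF s]] by blast
    moreover have "wf_fm (add_pred L) \<phi>" using Forall.prems(1) by simp
    ultimately have "sat N (e'(i := a')) \<phi> \<longleftrightarrow> sat N (e(i := a)) \<phi>" using Forall.IH by blast
    then show "sat N (e'(i := a')) \<phi>" using h \<open>a \<in> univ N\<close> by simp
  qed
  show ?case using *[OF Forall.prems(2)] *[OF star_sym[OF Forall.prems(2)]] by blast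
qed auto

end

section \<open>Counting types\<close>

text \<open>Expressions as terms of L: the subfield is closed under them, and their vanishing is
  part of the type in \<open>F\<close>.\<close>

primrec tm_of :: "nat ringpoly \<Rightarrow> 'f rsym tm" where
  "tm_of (PVar i) = Var i"
| "tm_of PZero = zero_tm"
| "tm_of POne = one_tm"
| "tm_of (PAdd p q) = plus_tm (tm_of p) (tm_of q)"
| "tm_of (PNeg p) = minus_tm (tm_of p)"
| "tm_of (PMul p q) = times_tm (tm_of p) (tm_of q)"

primrec lin :: "('a, 'm) ring_scheme \<Rightarrow> 'a list \<Rightarrow> 'a list \<Rightarrow> 'a" where
  "lin R [] bs = \<zero>\<^bsub>R\<^esub>"
| "lin R (a # as) bs = a \<otimes>\<^bsub>R\<^esub> hd bs \<oplus>\<^bsub>R\<^esub> lin R as (tl bs)"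

context field
begin

lemma lin_closed:
  "length as = length bs \<Longrightarrow> set as \<subseteq> carrier R \<Longrightarrow> set bs \<subseteq> carrier R \<Longrightarrow> lin R as bs \<in> carrier R"
  by (induction as bs rule: list_induct2) auto

lemma lin_append:
  "length as = length bs \<Longrightarrow> set as \<subseteq> carrier R \<Longrightarrow> set bs \<subseteq> carrier R \<Longrightarrow>
    length as' = length bs' \<Longrightarrow> set as' \<subseteq> carrier R \<Longrightarrow> set bs' \<subseteq> carrier R \<Longrightarrow>
    lin R (as @ as') (bs @ bs') = lin R as bs \<oplus> lin R as' bs'"
  by (induction as bs rule: list_induct2) (auto simp: lin_closed a_assoc)

lemma lin_scale:
  "length as = length bs \<Longrightarrow> set as \<subseteq> carrier R \<Longrightarrow> set bs \<subseteq> carrier R \<Longrightarrow> s \<in> carrier R \<Longrightarrow> t \<in> carrier R \<Longrightarrow>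
    lin R (map ((\<otimes>) s) as) (map ((\<otimes>) t) bs) = (s \<otimes> t) \<otimes> lin R as bs"
proof (induction as bs rule: list_induct2)
  case (Cons a as b bs)
  have "(s \<otimes> a) \<otimes> (t \<otimes> b) \<oplus> (s \<otimes> t) \<otimes> l = (s \<otimes> t) \<otimes> (a \<otimes> b \<oplus> l)" if "l \<in> carrier R" for l
    using that Cons.prems by (simp add: r_distr m_ac)
  then show ?case using Cons lin_closed[of as bs] by simp
qed simp

lemma lin_add_scale:
  "length as = length bs \<Longrightarrow> length ks = length bs \<Longrightarrow> set as \<subseteq> carrier R \<Longrightarrow> set ks \<subseteq> carrier R \<Longrightarrow>
    set bs \<subseteq> carrier R \<Longrightarrow> t \<in> carrier R \<Longrightarrow>
    lin R (map2 (\<lambda>a k. a \<oplus> t \<otimes> k) as ks) bs = lin R as bs \<oplus> t \<otimes> lin R ks bs"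
proof (induction as bs arbitrary: ks rule: list_induct2)
  case (Cons a as b bs)
  then obtain k ks' where ks: "ks = k # ks'" by (cases ks) auto
  have "(a \<oplus> t \<otimes> k) \<otimes> b \<oplus> (l \<oplus> t \<otimes> m) = a \<otimes> b \<oplus> l \<oplus> t \<otimes> (k \<otimes> b \<oplus> m)"
    if "l \<in> carrier R" "m \<in> carrier R" "a \<in> carrier R" "b \<in> carrier R" "k \<in> carrier R" "t \<in> carrier R"
    for l m a b k t
    using that by algebra
  then show ?case using Cons lin_closed[of as bs] lin_closed[of ks' bs] by (simp add: ks)
qed simp

end

context pair_of_fields
begin

lemma wf_tm_of: "wf_tm L (tm_of p)"
proof (induction p)
qed (use L_rings in \<open>auto simp: sublanguage_def L_rings_def\<close>)

lemma val_tm_of: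
  fixes y :: "nat \<Rightarrow> 'a"
  assumes "range y \<subseteq> univ N"
  shows "val N y (tm_of p) = pval K y p"
proof (induction p)
  case (PNeg p)
  have "pval K y p \<in> univ N" using K.pval_closed[of y p] assms by simp
  then show ?case using PNeg minus by simp
qed (simp_all add: ring_of_simps)

lemma pval_in_F:
  fixes y :: "nat \<Rightarrow> 'a"
  assumes "range y \<subseteq> univ F"
  shows "pval K y p \<in> univ F"
proof -
  have "range y \<subseteq> univ N" using assms F_subset by blast
  then have "val F y (tm_of p) = pval K y p" unfolding val_P_struct by (rule val_tm_of)
  then show ?thesis using val_closed[OF P_struct wf_tm_of assms, of p] by simp
qed

lemma tp_eq_pval:
  assumes "tp_eq y y'" "range y \<subseteq> univ F" "range y' \<subseteq> univ F"
  shows "pval K y p = \<zero>\<^bsub>K\<^esub> \<longleftrightarrow> pval K y' p = \<zero>\<^bsub>K\<^esub>"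
proof -
  have "wf_fm L (Eq (tm_of p) zero_tm :: ('f rsym, 'r) fm)"
    using wf_tm_of[of p] wf_tm_of[of PZero] by simp
  then have "sat F y (Eq (tm_of p) zero_tm) \<longleftrightarrow> sat F y' (Eq (tm_of p) zero_tm)"
    using assms(1) unfolding tp_eq_def by blast
  moreover have "range y \<subseteq> univ N" "range y' \<subseteq> univ N" using assms F_subset by blast+
  moreover have "ifun N RZero [] = \<zero>\<^bsub>K\<^esub>" by (simp add: ring_of_simps)
  ultimately show ?thesis by (simp add: val_P_struct val_tm_of)
qed

lemma F_closed:
  "a \<in> univ F \<Longrightarrow> b \<in> univ F \<Longrightarrow> a \<otimes>\<^bsub>K\<^esub> b \<in> univ F"
  "a \<in> univ F \<Longrightarrow> \<ominus>\<^bsub>K\<^esub> a \<in> univ F"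
  "a \<in> univ F \<Longrightarrow> a \<noteq> \<zero>\<^bsub>K\<^esub> \<Longrightarrow> inv\<^bsub>K\<^esub> a \<in> univ F"
  "\<zero>\<^bsub>K\<^esub> \<in> univ F"
proof -
  show "a \<otimes>\<^bsub>K\<^esub> b \<in> univ F" if "a \<in> univ F" "b \<in> univ F"
    using pval_in_F[of "prep [a] (\<lambda>_. b)" "PMul (PVar 0) (PVar 1)"] that range_prep[of "\<lambda>_. b" "univ F" "[a]"]
    by (simp add: prep_def)
  show "\<ominus>\<^bsub>K\<^esub> a \<in> univ F" if "a \<in> univ F"
    using pval_in_F[of "\<lambda>_. a" "PNeg (PVar 0)"] that by auto
  show "inv\<^bsub>K\<^esub> a \<in> univ F" if "a \<in> univ F" "a \<noteq> \<zero>\<^bsub>K\<^esub>"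
    using P_inverse[OF that(1)] that F_subset by (auto simp: K.field_Units)
  obtain b where "b \<in> univ F" using P_struct by (auto simp: is_struct_def)
  then show "\<zero>\<^bsub>K\<^esub> \<in> univ F" using pval_in_F[of "\<lambda>_. b" PZero] by auto
qed

end

section \<open>Linear relations over the subfield\<close>

context saturated_pair
begin

text \<open>Separates the variables: a sum of products of an expression in \<open>y\<close> with an
  expression in \<open>c\<close>. A polynomial relation over the subfield thereby becomes a linear
  relation between values of polynomials at \<open>c\<close>.\<close>

definition decomposable :: "((nat \<Rightarrow> 'a) \<Rightarrow> 'a) \<Rightarrow> bool" where
  "decomposable f \<longleftrightarrow> (\<exists>ts ms. length ts = length ms \<and>
     (\<forall>y. range y \<subseteq> univ F \<longrightarrow> f y = lin K (map (pval K y) ts) (map (pval K c) ms)))"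

lemma FN: "range y \<subseteq> univ F \<Longrightarrow> range y \<subseteq> carrier K"
  using F_subset by auto

lemma c_carrier: "range c \<subseteq> carrier K"
  using c by simp

lemma pvals_in: "range y \<subseteq> univ F \<Longrightarrow> set (map (pval K y) ts) \<subseteq> carrier K" "set (map (pval K c) ms) \<subseteq> carrier K"
  by (erule K.pvals_closed[OF FN], rule K.pvals_closed[OF c_carrier])

lemma decomposable_monomial: "decomposable (\<lambda>y. pval K y t \<otimes>\<^bsub>K\<^esub> pval K c m)"
  unfolding decomposable_def
proof (rule exI[of _ "[t]"], rule exI[of _ "[m]"], intro conjI allI impI)
  fix y :: "nat \<Rightarrow> 'a" assume "range y \<subseteq> univ F"
  then show "pval K y t \<otimes>\<^bsub>K\<^esub> pval K c m = lin K (map (pval K y) [t]) (map (pval K c) [m])"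
    using K.pval_closed[OF FN, of y t] K.pval_closed[OF c_carrier, of m] by simp
qed simp

lemma decomposable_cong: "decomposable f \<Longrightarrow> (\<And>y :: nat \<Rightarrow> 'a. range y \<subseteq> univ F \<Longrightarrow> g y = f y) \<Longrightarrow> decomposable g"
  unfolding decomposable_def by metis

lemma decomposable_add:
  assumes "decomposable f" "decomposable g"
  shows "decomposable (\<lambda>y. f y \<oplus>\<^bsub>K\<^esub> g y)"
proof -
  obtain ts ms where 1: "length ts = length ms"
    "\<And>y. range y \<subseteq> univ F \<Longrightarrow> f y = lin K (map (pval K y) ts) (map (pval K c) ms)"
    using assms(1) by (auto simp: decomposable_def)
  obtain ts' ms' where 2: "length ts' = length ms'"
    "\<And>y. range y \<subseteq> univ F \<Longrightarrow> g y = lin K (map (pval K y) ts') (map (pval K c) ms')"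
    using assms(2) by (auto simp: decomposable_def)
  show ?thesis unfolding decomposable_def
  proof (rule exI[of _ "ts @ ts'"], rule exI[of _ "ms @ ms'"], intro conjI allI impI)
    fix y :: "nat \<Rightarrow> 'a" assume y: "range y \<subseteq> univ F"
    then show "f y \<oplus>\<^bsub>K\<^esub> g y = lin K (map (pval K y) (ts @ ts')) (map (pval K c) (ms @ ms'))"
      using K.lin_append[OF _ pvals_in(1)[OF y] pvals_in(2) _ pvals_in(1)[OF y] pvals_in(2)] 1 2 by simp
  qed (use 1 2 in simp)
qed

lemma decomposable_scale:
  assumes "decomposable f"
  shows "decomposable (\<lambda>y. (pval K y t \<otimes>\<^bsub>K\<^esub> pval K c m) \<otimes>\<^bsub>K\<^esub> f y)"
proof -
  obtain ts ms where 1: "length ts = length ms"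
    "\<And>y. range y \<subseteq> univ F \<Longrightarrow> f y = lin K (map (pval K y) ts) (map (pval K c) ms)"
    using assms(1) by (auto simp: decomposable_def)
  show ?thesis unfolding decomposable_def
  proof (rule exI[of _ "map (PMul t) ts"], rule exI[of _ "map (PMul m) ms"], intro conjI allI impI)
    fix y :: "nat \<Rightarrow> 'a" assume y: "range y \<subseteq> univ F"
    have "map (pval K y) (map (PMul t) ts) = map ((\<otimes>\<^bsub>K\<^esub>) (pval K y t)) (map (pval K y) ts)"
      "map (pval K c) (map (PMul m) ms) = map ((\<otimes>\<^bsub>K\<^esub>) (pval K c m)) (map (pval K c) ms)" by simp_all
    then show "(pval K y t \<otimes>\<^bsub>K\<^esub> pval K c m) \<otimes>\<^bsub>K\<^esub> f y =
        lin K (map (pval K y) (map (PMul t) ts)) (map (pval K c) (map (PMul m) ms))"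
      using K.lin_scale[OF _ pvals_in(1)[OF y] pvals_in(2), of ts ms "pval K y t" "pval K c m"] 1 y
        K.pval_closed[OF FN[OF y]] K.pval_closed[OF c_carrier] by (simp del: map_map)
  qed (use 1 in simp)
qed

lemma decomposable_mult:
  assumes "decomposable f" "decomposable g"
  shows "decomposable (\<lambda>y. f y \<otimes>\<^bsub>K\<^esub> g y)"
proof -
  obtain ts ms where 1: "length ts = length ms"
    "\<And>y. range y \<subseteq> univ F \<Longrightarrow> f y = lin K (map (pval K y) ts) (map (pval K c) ms)"
    using assms(1) by (auto simp: decomposable_def)
  obtain ts' ms' where 2: "length ts' = length ms'"
    "\<And>y. range y \<subseteq> univ F \<Longrightarrow> g y = lin K (map (pval K y) ts') (map (pval K c) ms')"
    using assms(2) by (auto simp: decomposable_def)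
  have g: "g y \<in> carrier K" if "range y \<subseteq> univ F" for y :: "nat \<Rightarrow> 'a"
    using K.lin_closed[OF _ pvals_in(1)[OF that] pvals_in(2)] 2 that by simp
  have "decomposable (\<lambda>y. lin K (map (pval K y) ts) (map (pval K c) ms) \<otimes>\<^bsub>K\<^esub> g y)"
    using 1(1)
  proof (induction ts ms rule: list_induct2)
    case Nil
    show ?case
      by (rule decomposable_cong[OF decomposable_monomial[of PZero PZero]]) (use g in simp)
  next
    case (Cons t ts m ms)
    show ?case
    proof (rule decomposable_cong[OF decomposable_add[OF decomposable_scale[OF assms(2), of t m] Cons.IH]])
      fix y :: "nat \<Rightarrow> 'a" assume y: "range y \<subseteq> univ F"
      show "lin K (map (pval K y) (t # ts)) (map (pval K c) (m # ms)) \<otimes>\<^bsub>K\<^esub> g y =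
          (pval K y t \<otimes>\<^bsub>K\<^esub> pval K c m) \<otimes>\<^bsub>K\<^esub> g y \<oplus>\<^bsub>K\<^esub> lin K (map (pval K y) ts) (map (pval K c) ms) \<otimes>\<^bsub>K\<^esub> g y"
        using g[OF y] K.lin_closed[OF _ pvals_in(1)[OF y] pvals_in(2), of ts ms] Cons.hyps
          K.pval_closed[OF FN[OF y]] K.pval_closed[OF c_carrier] by (simp add: K.l_distr)
    qed
  qed
  then show ?thesis by (rule decomposable_cong) (simp add: 1(2))
qed

text \<open>Each entry of \<open>e0\<close> is an entry of \<open>c\<close>, so the variables
  \<open>PE\<close> can be read as constants.\<close>

lemma decomposable_pv:
  assumes e0: "range e0 \<subseteq> range c"
  shows "decomposable (\<lambda>y. pv y e0 p)"
proof -
  have N: "range e0 \<subseteq> univ N" using e0 c by blast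
  have cl: "pv y e0 p \<in> carrier K" if "range y \<subseteq> univ F" for y :: "nat \<Rightarrow> 'a" and p using pv_closed[OF that N] .
  have "\<exists>j. e0 i = c j" for i using e0 by blast
  then obtain j where j: "\<And>i. e0 i = c (j i)" by metis
  have cc: "c i \<in> carrier K" for i using c_carrier by auto
  show ?thesis
  proof (induction p)
    case (PVar v)
    show ?case
    proof (cases v)
      case (PY i)
      show ?thesis unfolding PY
        by (rule decomposable_cong[OF decomposable_monomial[of "PVar i" POne]]) (use F_subset in \<open>auto simp: image_subset_iff subset_iff\<close>)
    next
      case (PE i)
      show ?thesis unfolding PE
        by (rule decomposable_cong[OF decomposable_monomial[of POne "PVar (j i)"]]) (use j cc in simp)
    next
      case (PC i)
      show ?thesis unfolding PC
        by (rule decomposable_cong[OF decomposable_monomial[of POne "PVar i"]]) (use cc in simp)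
    qed
  next
    case PZero
    show ?case by (rule decomposable_cong[OF decomposable_monomial[of PZero PZero]]) simp
  next
    case POne
    show ?case by (rule decomposable_cong[OF decomposable_monomial[of POne POne]]) simp
  next
    case (PAdd p q)
    show ?case using decomposable_add[OF PAdd] by simp
  next
    case (PNeg p)
    show ?case
      by (rule decomposable_cong[OF decomposable_scale[OF PNeg, of "PNeg POne" POne]])
        (use cl in \<open>simp add: K.l_minus\<close>)
  next
    case (PMul p q)
    show ?case using decomposable_mult[OF PMul] by simp
  qed
qed

text \<open>The linear relations over the subfield between finitely many elements all follow from
  finitely many of them; a sequence containing the coefficients of such relations decides all of them.\<close>

lemma ex_base:
  "\<exists>y0. range y0 \<subseteq> univ F \<and> (\<forall>e0. range e0 \<subseteq> range c \<longrightarrow> star y0 e0 y0 e0)"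
proof -
  \<comment> \<open>The value of \<open>m\<close> at \<open>c\<close> lies in the F-span of the
    values of \<open>ms\<close>, with coefficients \<open>ws\<close>.\<close>
  define rel where "rel m ms ws \<longleftrightarrow> length ws = length ms \<and> set ws \<subseteq> univ F \<and>
    pval K c m = lin K ws (map (pval K c) ms)" for m ms ws
  define W where "W m ms = (if \<exists>ws. rel m ms ws then SOME ws. rel m ms ws else [])" for m ms
  have W: "rel m ms (W m ms)" if "\<exists>ws. rel m ms ws" for m ms
    using someI_ex[OF that] that by (simp add: W_def)
  have WF: "set (W m ms) \<subseteq> univ F" for m ms using W[of m ms] by (cases "\<exists>ws. rel m ms ws") (auto simp: rel_def W_def)
  \<comment> \<open>One solution for each of the countably many pairs of expressions and lists; zero
    makes the set nonempty, so that it can be enumerated.\<close>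
  define B where "B = insert \<zero>\<^bsub>K\<^esub> (\<Union>(m, ms)\<in>UNIV. set (W m ms))"
  have "countable B" unfolding B_def by (intro countable_insert countable_UN) (auto simp: countable_finite)
  then obtain y0 :: "nat \<Rightarrow> 'a" where y0: "range y0 = B"
    by (metis B_def insert_not_empty range_from_nat_into)
  have BF: "range y0 \<subseteq> univ F" unfolding y0 B_def using WF F_closed(4) by auto
  \<comment> \<open>Induction on the list of vectors: the first one is eliminated if it depends on
    the others, and otherwise its coefficient must vanish.\<close>
  have key: "lin K (map (pval K y) ts) (map (pval K c) ms) = \<zero>\<^bsub>K\<^esub> \<longleftrightarrow>
      lin K (map (pval K y') ts) (map (pval K c) ms) = \<zero>\<^bsub>K\<^esub>"
    if "length ts = length ms" and e: "ext y0 y0 y y'" for ts ms y y'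
    using that(1)
  proof (induction ms arbitrary: ts)
    case Nil
    then show ?case by simp
  next
    case (Cons m ms)
    then obtain t ts' where ts: "ts = t # ts'" "length ts' = length ms" by (cases ts) auto
    have r: "range y \<subseteq> univ F" "range y' \<subseteq> univ F" using ext_range[OF e BF BF] by auto
    have mc: "pval K c m \<in> carrier K" using K.pval_closed[OF c_carrier] .
    show ?case
    proof (cases "\<exists>ws. rel m ms ws")
      case True
      obtain zs zs' where zs: "length zs = length zs'" "y = prep zs y0" "y' = prep zs' y0"
        using e by (auto simp: ext_def)
      have "\<forall>w\<in>set (W m ms). \<exists>k. y0 k = w" using y0 unfolding B_def by (auto simp: set_eq_iff image_iff) metis
      then obtain k where k: "\<And>w. w \<in> set (W m ms) \<Longrightarrow> y0 (k w) = w" by metis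
      \<comment> \<open>The coefficients of the dependence are entries of \<open>y0\<close>; both
        extensions shift them by the same amount, so the same variables name them on both
        sides.\<close>
      define us where "us = map (\<lambda>w. PVar (k w + length zs)) (W m ms)"
      have us: "map (pval K y) us = W m ms" "map (pval K y') us = W m ms"
        using k by (auto simp: us_def zs intro!: map_idI) (simp add: zs(1)[symmetric] prep_def)?
      \<comment> \<open>Substituting the dependence for the first vector adds its coefficient
        \<open>t\<close> times \<open>us\<close> to the remaining coefficients.\<close>
      define ts1 where "ts1 = map2 (\<lambda>s u. PAdd s (PMul t u)) ts' us"
      have lenW: "length (W m ms) = length ms" and relm: "pval K c m = lin K (W m ms) (map (pval K c) ms)"
        using W[OF True] by (auto simp: rel_def)
      have lus: "length us = length ms" using lenW by (simp add: us_def)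
      have Wc: "set (W m ms) \<subseteq> carrier K" using WF F_subset by auto
      have *: "lin K (map (pval K z) ts) (map (pval K c) (m # ms)) = lin K (map (pval K z) ts1) (map (pval K c) ms)"
        if z: "range z \<subseteq> univ F" "map (pval K z) us = W m ms" for z
      proof -
        have "map (pval K z) ts1 = map2 (\<lambda>a k. a \<oplus>\<^bsub>K\<^esub> pval K z t \<otimes>\<^bsub>K\<^esub> k) (map (pval K z) ts') (map (pval K z) us)"
          by (rule nth_equalityI) (use ts lus in \<open>auto simp: ts1_def\<close>)
        also have "lin K \<dots> (map (pval K c) ms) = lin K (map (pval K z) ts') (map (pval K c) ms) \<oplus>\<^bsub>K\<^esub>
            pval K z t \<otimes>\<^bsub>K\<^esub> lin K (W m ms) (map (pval K c) ms)"
          unfolding z(2) using ts lenW Wc pvals_in(1)[OF z(1), of ts'] pvals_in(2)[of ms] K.pval_closed[OF FN[OF z(1)]]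
          by (intro K.lin_add_scale) simp_all
        also have "\<dots> = pval K z t \<otimes>\<^bsub>K\<^esub> pval K c m \<oplus>\<^bsub>K\<^esub> lin K (map (pval K z) ts') (map (pval K c) ms)"
          unfolding relm[symmetric] using mc K.pval_closed[OF FN[OF z(1)], of t]
            K.lin_closed[OF _ pvals_in(1)[OF z(1), of ts'] pvals_in(2)[of ms]] ts by (simp add: K.a_comm)
        finally show ?thesis by (simp add: ts)
      qed
      have "length ts1 = length ms" using ts lus by (simp add: ts1_def)
      then show ?thesis using *[OF r(1) us(1)] *[OF r(2) us(2)] Cons.IH[of ts1] by simp
    next
      case False
      have *: "lin K (map (pval K z) ts) (map (pval K c) (m # ms)) = \<zero>\<^bsub>K\<^esub> \<longleftrightarrow>
          pval K z t = \<zero>\<^bsub>K\<^esub> \<and> lin K (map (pval K z) ts') (map (pval K c) ms) = \<zero>\<^bsub>K\<^esub>"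
        if z: "range z \<subseteq> univ F" for z :: "nat \<Rightarrow> 'a"
      proof -
        let ?t = "pval K z t" and ?l = "lin K (map (pval K z) ts') (map (pval K c) ms)"
        have tc: "?t \<in> carrier K" "?l \<in> carrier K"
          using K.pval_closed[OF FN[OF z]] K.lin_closed[OF _ pvals_in(1)[OF z, of ts'] pvals_in(2)[of ms]] ts by simp_all
        have eq: "lin K (map (pval K z) ts) (map (pval K c) (m # ms)) = ?t \<otimes>\<^bsub>K\<^esub> pval K c m \<oplus>\<^bsub>K\<^esub> ?l"
          by (simp add: ts)
        \<comment> \<open>With a nonzero coefficient, division inside \<open>F\<close> would put the
          first vector into the span of the others.\<close>
        have "?t = \<zero>\<^bsub>K\<^esub>" if 0: "?t \<otimes>\<^bsub>K\<^esub> pval K c m \<oplus>\<^bsub>K\<^esub> ?l = \<zero>\<^bsub>K\<^esub>"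
        proof (rule ccontr)
          assume nz: "?t \<noteq> \<zero>\<^bsub>K\<^esub>"
          let ?i = "inv\<^bsub>K\<^esub> ?t"
          have i: "?i \<in> carrier K" "?i \<otimes>\<^bsub>K\<^esub> ?t = \<one>\<^bsub>K\<^esub>" "?i \<in> univ F"
            using nz tc F_closed(3)[OF pval_in_F[OF z] nz] by (simp_all add: K.field_Units)
          have "pval K c m = (\<ominus>\<^bsub>K\<^esub> ?i) \<otimes>\<^bsub>K\<^esub> ?l"
          proof -
            have "pval K c m = ?i \<otimes>\<^bsub>K\<^esub> (?t \<otimes>\<^bsub>K\<^esub> pval K c m)"
              using i mc tc by (simp add: K.m_assoc[symmetric])
            also have "?t \<otimes>\<^bsub>K\<^esub> pval K c m = \<ominus>\<^bsub>K\<^esub> ?l"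
              using 0 tc mc K.minus_equality[of "?t \<otimes>\<^bsub>K\<^esub> pval K c m" ?l] by simp
            finally show ?thesis using i tc by (simp add: K.l_minus K.r_minus)
          qed
          also have "\<dots> = ((\<ominus>\<^bsub>K\<^esub> ?i) \<otimes>\<^bsub>K\<^esub> \<one>\<^bsub>K\<^esub>) \<otimes>\<^bsub>K\<^esub> ?l" using i tc by simp
          also have "\<dots> = lin K (map ((\<otimes>\<^bsub>K\<^esub>) (\<ominus>\<^bsub>K\<^esub> ?i)) (map (pval K z) ts')) (map ((\<otimes>\<^bsub>K\<^esub>) \<one>\<^bsub>K\<^esub>) (map (pval K c) ms))"
            using ts i pvals_in(1)[OF z, of ts'] pvals_in(2)[of ms] by (intro K.lin_scale[symmetric]) simp_all
          also have "map ((\<otimes>\<^bsub>K\<^esub>) \<one>\<^bsub>K\<^esub>) (map (pval K c) ms) = map (pval K c) ms"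
            using K.pval_closed[OF c_carrier] by simp
          finally have "rel m ms (map ((\<otimes>\<^bsub>K\<^esub>) (\<ominus>\<^bsub>K\<^esub> ?i)) (map (pval K z) ts'))"
            unfolding rel_def using ts F_closed(1)[OF F_closed(2)[OF i(3)] pval_in_F[OF z]] by auto
          then show False using False by blast
        qed
        then show ?thesis unfolding eq using tc mc by auto
      qed
      show ?thesis
        unfolding *[OF r(1)] *[OF r(2)] using tp_eq_pval[OF ext_tp_eq[OF e] r] Cons.IH[OF ts(2)] by simp
    qed
  qed
  have "star y0 e0 y0 e0" if e0: "range e0 \<subseteq> range c" for e0
  proof (rule starI)
    fix y y' p assume e: "ext y0 y0 y y'"
    obtain ts ms where "length ts = length ms"
      "\<And>y. range y \<subseteq> univ F \<Longrightarrow> pv y e0 p = lin K (map (pval K y) ts) (map (pval K c) ms)"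
      using decomposable_pv[OF e0, of p] unfolding decomposable_def by blast
    then show "pv y e0 p = \<zero>\<^bsub>K\<^esub> \<longleftrightarrow> pv y' e0 p = \<zero>\<^bsub>K\<^esub>"
      using key[OF _ e] ext_range[OF e BF BF] by simp
  qed (use BF e0 c in \<open>auto simp: tp_eq_def\<close>)
  then show ?thesis using BF by blast
qed

end

lemma countable_image_factor:
  assumes "countable (g ` A)" "\<And>a b. a \<in> A \<Longrightarrow> b \<in> A \<Longrightarrow> g a = g b \<Longrightarrow> f a = f b"
  shows "countable (f ` A)"
proof -
  have "f ` A \<subseteq> (\<lambda>z. f (inv_into A g z)) ` (g ` A)"
  proof
    fix b assume "b \<in> f ` A"
    then obtain a where a: "a \<in> A" "b = f a" by blast
    have "f (inv_into A g (g a)) = f a"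
      using a(1) by (intro assms(2)) (auto intro: inv_into_into f_inv_into_f)
    then show "b \<in> (\<lambda>z. f (inv_into A g z)) ` (g ` A)" using a by (metis imageI)
  qed
  then show ?thesis using assms(1) by (meson countable_image countable_subset)
qed

section \<open>Towers of minimal polynomials\<close>

context homogeneous_pair
begin

text \<open>The code lists, latest change first, the changed variable, the number of added
  parameters and the minimal polynomial, or \<open>None\<close> for a transcendental value. Codes
  form a countable type; all information from the subfield is collected in
  \<open>zs\<close>.\<close>

inductive tower :: "(nat \<Rightarrow> 'a) \<Rightarrow> (nat \<Rightarrow> 'a) \<Rightarrow> (nat \<Rightarrow> 'a) \<Rightarrow>
    (nat \<times> nat \<times> pvar ringpoly list option) list \<Rightarrow> 'a list \<Rightarrow> bool"
  for y0 e0 where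
  base: "tower y0 e0 e0 [] []"
| algebraic: "tower y0 e0 e qs zs \<Longrightarrow> set ws \<subseteq> univ F \<Longrightarrow> x \<in> univ N \<Longrightarrow>
    min_poly (prep ws (prep zs y0)) e Q x \<Longrightarrow>
    tower y0 e0 (e(i := x)) ((i, length ws, Some Q) # qs) (ws @ zs)"
| transcendental: "tower y0 e0 e qs zs \<Longrightarrow> x \<in> univ N \<Longrightarrow> (\<And>d. no_rel d e x) \<Longrightarrow>
    tower y0 e0 (e(i := x)) ((i, 0, None) # qs) zs"

lemma tower_props:
  "tower y0 e0 e qs zs \<Longrightarrow> length zs = sum_list (map (\<lambda>(i, k, Q). k) qs) \<and> set zs \<subseteq> univ F"
  by (induction rule: tower.induct) auto

lemma tower_range:
  "tower y0 e0 e qs zs \<Longrightarrow> range e0 \<subseteq> univ N \<Longrightarrow> range e \<subseteq> univ N"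
  by (induction rule: tower.induct) auto

lemma tower_step:
  assumes t: "tower y0 e0 e qs zs" and x: "x \<in> univ N" and y0: "range y0 \<subseteq> univ F" and e0: "range e0 \<subseteq> univ N"
  shows "\<exists>qs' zs'. tower y0 e0 (e(i := x)) qs' zs'"
proof (cases "\<forall>d. no_rel d e x")
  case True
  then show ?thesis using tower.transcendental[OF t x] by blast
next
  case False
  have "range (prep zs y0) \<subseteq> univ F" using range_prep[OF y0] tower_props[OF t] by blast
  then obtain ws Q where "set ws \<subseteq> univ F" "min_poly (prep ws (prep zs y0)) e Q x"
    using ex_min_poly[OF x tower_range[OF t e0]] False by blast
  then show ?thesis using tower.algebraic[OF t _ x] by blast
qed

lemma ex_tower:
  assumes y0: "range y0 \<subseteq> univ F" and e0: "range e0 \<subseteq> univ N"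
  shows "finite I \<Longrightarrow> range e \<subseteq> univ N \<Longrightarrow> (\<And>i. i \<notin> I \<Longrightarrow> e i = e0 i) \<Longrightarrow> \<exists>qs zs. tower y0 e0 e qs zs"
proof (induction I arbitrary: e rule: finite_induct)
  case empty
  then have "e = e0" by auto
  then show ?case using tower.base by blast
next
  case (insert i I)
  \<comment> \<open>Entry \<open>i\<close> is first reset to its base value, so that it can be
    changed in the last step.\<close>
  have "\<exists>qs zs. tower y0 e0 (e(i := e0 i)) qs zs"
    using insert.prems e0 by (intro insert.IH) auto
  then obtain qs zs where "tower y0 e0 (e(i := e0 i)) qs zs" by blast
  moreover have "e i \<in> univ N" using insert.prems(1) by blast
  ultimately have "\<exists>qs zs. tower y0 e0 ((e(i := e0 i))(i := e i)) qs zs" using tower_step y0 e0 by blast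
  then show ?case by simp
qed

text \<open>Equal codes force the same rule, the same polynomial and the same splitting of the
  parameters at every step, so the one-step lemmas apply along the tower.\<close>

lemma tower_star:
  assumes s: "star y0 e0 y0 e0"
  shows "tower y0 e0 e qs zs \<Longrightarrow> tower y0 e0 e' qs zs' \<Longrightarrow> tp_eq (prep zs y0) (prep zs' y0) \<Longrightarrow>
    star (prep zs y0) e (prep zs' y0) e'"
proof (induction arbitrary: e' zs' rule: tower.induct)
  case base
  from base.prems(1) show ?case by cases (simp_all add: s)
next
  case (algebraic e qs zs ws x Q i)
  from algebraic.prems(1) obtain d vs ws' x' where e': "e' = d(i := x')" "zs' = ws' @ vs" "length ws' = length ws"
    "tower y0 e0 d qs vs" "set ws' \<subseteq> univ F" "x' \<in> univ N" "min_poly (prep ws' (prep vs y0)) d Q x'"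
    by cases auto
  have tp: "tp_eq (prep ws (prep zs y0)) (prep ws' (prep vs y0))"
    using algebraic.prems(2) by (simp add: e' prep_append)
  have s1: "star (prep zs y0) e (prep vs y0) d"
    using algebraic.IH[OF e'(4)] tp_eq_prepD[OF tp] e'(3) by simp
  have "ext (prep zs y0) (prep vs y0) (prep ws (prep zs y0)) (prep ws' (prep vs y0))"
    unfolding ext_def
    by (rule exI[of _ ws], rule exI[of _ ws']) (use algebraic.hyps(2) e'(3,5) tp in simp)
  from star_algebraic[OF star_ext[OF s1 this] algebraic.hyps(3) e'(6) algebraic.hyps(4) e'(7)]
  show ?case unfolding e'(1,2) prep_append .
next
  case (transcendental e qs zs x i)
  from transcendental.prems(1) obtain d x' where e': "e' = d(i := x')"
    "tower y0 e0 d qs zs'" "x' \<in> univ N" "\<And>d'. no_rel d' d x'"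
    by cases auto
  show ?case
    unfolding e'(1) using transcendental e' by (intro star_transcendental) auto
qed

text \<open>An assignment is classified by a code and by the type of its parameters over
  \<open>y0\<close>; \<open>count\<close> leaves countably many such pairs. Assignments differing
  from \<open>e0\<close> at finitely many places suffice, as towers are finite.\<close>

lemma countable_realized:
  assumes y0: "range y0 \<subseteq> univ F" and s: "star y0 e0 y0 e0"
    and count: "\<And>k. countable (tuple_types L F y0 k)"
  shows "countable ((\<lambda>e. {\<phi>. wf_fm (add_pred L) \<phi> \<and> sat N e \<phi>}) ` {e. range e \<subseteq> univ N \<and> finite {i. e i \<noteq> e0 i}})"
    (is "countable (?f ` ?A)")
proof -
  have e0: "range e0 \<subseteq> univ N" using starD[OF s] by blast
  have ex: "\<exists>qs zs. tower y0 e0 e qs zs" if "e \<in> ?A" for e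
    by (rule ex_tower[OF y0 e0, of "{i. e i \<noteq> e0 i}" e]) (use that in simp_all)
  define q where "q e = (SOME qs. \<exists>zs. tower y0 e0 e qs zs)" for e
  define z where "z e = (SOME zs. tower y0 e0 e (q e) zs)" for e
  have qz: "tower y0 e0 e (q e) (z e)" if "e \<in> ?A" for e
    unfolding z_def by (rule someI_ex) (unfold q_def, rule someI_ex, rule ex[OF that])
  let ?t = "\<lambda>zs. realized_type (\<lambda>zs. sat F (prep zs y0)) {\<phi>. wf_fm L \<phi>} zs"
  let ?g = "\<lambda>e. (q e, ?t (z e))"
  show ?thesis
  proof (rule countable_image_factor[of ?g])
    have "?t zs \<in> (\<Union>k. tuple_types L F y0 k)" if "set zs \<subseteq> univ F" for zs
      using boolean_family.realized_type_in[OF boolean_family_tuples, of zs "tuples F (length zs)" F "\<lambda>zs. prep zs y0" L] that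
      by (auto simp: tuples_def)
    then have "?t (z e) \<in> (\<Union>k. tuple_types L F y0 k)" if "e \<in> ?A" for e
      using tower_props[OF qz[OF that]] by simp
    then have "?g ` ?A \<subseteq> UNIV \<times> (\<Union>k. tuple_types L F y0 k)"
      by (intro image_subsetI) (rule SigmaI, simp_all only: UNIV_I)
    moreover have "countable (UNIV \<times> (\<Union>k. tuple_types L F y0 k) ::
        ((nat \<times> nat \<times> pvar ringpoly list option) list \<times> ('f rsym, 'r) fm set) set)"
      using count by (intro countable_SIGMA countable_UN) auto
    ultimately show "countable (?g ` ?A)" by (rule countable_subset)
    fix a b assume ab: "a \<in> ?A" "b \<in> ?A" and eq: "?g a = ?g b"
    have "tp_eq (prep (z a) y0) (prep (z b) y0)"
      using eq unfolding tp_eq_def realized_type_def by auto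
    from tower_star[OF s qz[OF ab(1)] _ this] have "star (prep (z a) y0) a (prep (z b) y0) b"
      using qz[OF ab(2)] eq by simp
    then show "?f a = ?f b" using star_sat_iff by blast
  qed
qed

end

section \<open>Models of the theory of pairs\<close>

lemma true_in_Alls: "true_in M (Alls is \<phi>) \<longleftrightarrow> true_in M \<phi>"
proof
  assume h: "true_in M (Alls is \<phi>)"
  show "true_in M \<phi>"
    unfolding true_in_def
  proof (intro allI impI)
    fix e :: "nat \<Rightarrow> 'a" assume e: "range e \<subseteq> univ M"
    then have "sat M e (Alls is \<phi>)" using h by (simp add: true_in_def)
    then show "sat M e \<phi>" using e by (auto simp: sat_Alls)
  qed
next
  assume h: "true_in M \<phi>"
  show "true_in M (Alls is \<phi>)"
    unfolding true_in_def sat_Alls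
  proof (intro allI impI)
    fix e e' :: "nat \<Rightarrow> 'a"
    assume e: "range e \<subseteq> univ M" and e': "(\<forall>i. i \<notin> set is \<longrightarrow> e' i = e i) \<and> e' ` set is \<subseteq> univ M"
    have "e' i \<in> univ M" for i using e e' by (cases "i \<in> set is") auto
    then show "sat M e' \<phi>" using h unfolding true_in_def by blast
  qed
qed

lemma true_in_AllsD: "true_in M (Alls is \<phi>) \<Longrightarrow> range e \<subseteq> univ M \<Longrightarrow> sat M e \<phi>"
  unfolding true_in_Alls unfolding true_in_def by simp

lemma sat_all_in_P: "sat M e (all_in_P is) \<longleftrightarrow> (\<forall>i\<in>set is. irel M SubP [e i])"
  by (simp add: all_in_P_def sat_Conjs)

lemma sat_relativize:
  "range e \<subseteq> univ (P_struct M) \<Longrightarrow> sat M e (relativize \<phi>) \<longleftrightarrow> sat (P_struct M) e \<phi>"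
proof (induction \<phi> arbitrary: e)
  case (Forall i \<phi>)
  have u: "univ (P_struct M) = {a \<in> univ M. irel M SubP [a]}" by (simp add: P_struct_def)
  have "sat M (e(i := a)) (relativize \<phi>) \<longleftrightarrow> sat (P_struct M) (e(i := a)) \<phi>"
    if "a \<in> univ (P_struct M)" for a
    using Forall.prems that by (intro Forall.IH) auto
  then show ?case by (auto simp: u)
qed (simp_all add: val_P_struct, auto simp: P_struct_def)

text \<open>\<open>poly_tm\<close> lists the leading coefficient first and \<open>horner\<close> the
  constant one, hence \<open>rev\<close>.\<close>

lemma foldl_horner:
  assumes "field K" "set ds \<subseteq> carrier K" "x \<in> carrier K"
  shows "foldl (\<lambda>s a. s \<otimes>\<^bsub>K\<^esub> x \<oplus>\<^bsub>K\<^esub> a) \<zero>\<^bsub>K\<^esub> (rev ds) = horner K ds x"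
proof -
  interpret K: field K by (rule assms(1))
  show ?thesis using assms(2)
  proof (induction ds)
    case (Cons d ds)
    then show ?case using assms(3) K.horner_closed[of ds x] by (simp add: K.m_comm K.a_comm)
  qed simp
qed

lemma val_poly_tm:
  "val M e (poly_tm ts t) =
    foldl (\<lambda>s a. s \<otimes>\<^bsub>ring_of M\<^esub> val M e t \<oplus>\<^bsub>ring_of M\<^esub> a) \<zero>\<^bsub>ring_of M\<^esub> (map (val M e) ts)"
proof -
  have "val M e (foldl (\<lambda>s c. plus_tm (times_tm s t) c) s ts) =
    foldl (\<lambda>s a. s \<otimes>\<^bsub>ring_of M\<^esub> val M e t \<oplus>\<^bsub>ring_of M\<^esub> a) (val M e s) (map (val M e) ts)" for s
    by (induction ts arbitrary: s) (simp_all add: ring_of_def)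
  then show ?thesis by (simp add: poly_tm_def ring_of_def)
qed

text \<open>Axioms appear as true formulas, the form in which they pass to the ultrapower.\<close>

locale ACF_T_model =
  fixes L :: "('f rsym, 'r) language" and T :: "('f rsym, 'r) fm set" and N :: "('a, 'f rsym, 'r psym) struct"
  assumes L: "sublanguage L_rings L" and struct: "is_struct (add_pred L) N"
    and field_axioms: "\<And>\<phi>. \<phi> \<in> field_ax \<Longrightarrow> true_in N \<phi>"
    and roots: "\<And>n. n \<ge> 1 \<Longrightarrow> true_in N (root_axiom n)"
    and subfield: "\<And>\<phi>. \<phi> \<in> subfield_ax \<Longrightarrow> true_in N \<phi>"
    and model_T: "\<And>\<phi>. \<phi> \<in> T \<Longrightarrow> true_in N (relativize \<phi>)"
    and fun_ax: "\<And>f \<phi>. f \<in> funs L - funs (L_rings :: ('f rsym, 'r) language) \<Longrightarrow> \<phi> \<in> fun_axioms L f \<Longrightarrow> true_in N \<phi>"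
    and rel_ax: "\<And>R. R \<in> rels L \<Longrightarrow> true_in N (rel_axiom L R)"
begin

abbreviation "K \<equiv> ring_of N"
abbreviation "F \<equiv> P_struct N"

lemma ops:
  "a \<oplus>\<^bsub>K\<^esub> b = ifun N RPlus [a, b]" "a \<otimes>\<^bsub>K\<^esub> b = ifun N RTimes [a, b]"
  "\<zero>\<^bsub>K\<^esub> = ifun N RZero []" "\<one>\<^bsub>K\<^esub> = ifun N ROne []" "carrier K = univ N"
  by (simp_all add: ring_of_def)

lemma univ_F: "univ F = {a \<in> univ N. irel N SubP [a]}"
  by (simp add: P_struct_def)

lemma fun_closed: "f \<in> funs L \<Longrightarrow> set xs \<subseteq> univ N \<Longrightarrow> length xs = far L f \<Longrightarrow> ifun N f xs \<in> univ N"
  using struct by (simp add: is_struct_def add_pred_def)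

lemma closed:
  "a \<in> univ N \<Longrightarrow> b \<in> univ N \<Longrightarrow> ifun N RPlus [a, b] \<in> univ N"
  "a \<in> univ N \<Longrightarrow> b \<in> univ N \<Longrightarrow> ifun N RTimes [a, b] \<in> univ N"
  "a \<in> univ N \<Longrightarrow> ifun N RMinus [a] \<in> univ N" "ifun N RZero [] \<in> univ N" "ifun N ROne [] \<in> univ N"
  by (simp_all add: fun_closed L_rings_arity[OF L])

lemma instance3:
  assumes "true_in N \<phi>" "a \<in> univ N" "b \<in> univ N" "d \<in> univ N"
  shows "sat N (\<lambda>i. if i = 0 then a else if i = 1 then b else d) \<phi>"
  using assms unfolding true_in_def by (auto simp: image_subset_iff)

lemma field_laws:
  assumes a: "a \<in> univ N" and b: "b \<in> univ N" and d: "d \<in> univ N"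
  shows "(a \<oplus>\<^bsub>K\<^esub> b) \<oplus>\<^bsub>K\<^esub> d = a \<oplus>\<^bsub>K\<^esub> (b \<oplus>\<^bsub>K\<^esub> d)" "a \<oplus>\<^bsub>K\<^esub> b = b \<oplus>\<^bsub>K\<^esub> a" "a \<oplus>\<^bsub>K\<^esub> \<zero>\<^bsub>K\<^esub> = a"
    "a \<oplus>\<^bsub>K\<^esub> ifun N RMinus [a] = \<zero>\<^bsub>K\<^esub>"
    "(a \<otimes>\<^bsub>K\<^esub> b) \<otimes>\<^bsub>K\<^esub> d = a \<otimes>\<^bsub>K\<^esub> (b \<otimes>\<^bsub>K\<^esub> d)" "a \<otimes>\<^bsub>K\<^esub> b = b \<otimes>\<^bsub>K\<^esub> a" "a \<otimes>\<^bsub>K\<^esub> \<one>\<^bsub>K\<^esub> = a"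
    "a \<otimes>\<^bsub>K\<^esub> (b \<oplus>\<^bsub>K\<^esub> d) = a \<otimes>\<^bsub>K\<^esub> b \<oplus>\<^bsub>K\<^esub> a \<otimes>\<^bsub>K\<^esub> d"
    "\<zero>\<^bsub>K\<^esub> \<noteq> \<one>\<^bsub>K\<^esub>" "a \<noteq> \<zero>\<^bsub>K\<^esub> \<Longrightarrow> \<exists>b\<in>univ N. a \<otimes>\<^bsub>K\<^esub> b = \<one>\<^bsub>K\<^esub>"
proof -
  let ?e = "\<lambda>i :: nat. if i = 0 then a else if i = 1 then b else d"
  have inst: "sat N ?e \<phi>" if "Alls is \<phi> \<in> field_ax" for "is" \<phi>
    using field_axioms[OF that] a b d by (intro instance3) (simp_all add: true_in_Alls)
  have inst0: "sat N ?e \<phi>" if "\<phi> \<in> field_ax" for \<phi>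
    using field_axioms[OF that] a b d by (rule instance3)
  let ?x = "Var 0 :: 'f rsym tm" and ?y = "Var 1 :: 'f rsym tm" and ?z = "Var 2 :: 'f rsym tm"
  show "(a \<oplus>\<^bsub>K\<^esub> b) \<oplus>\<^bsub>K\<^esub> d = a \<oplus>\<^bsub>K\<^esub> (b \<oplus>\<^bsub>K\<^esub> d)"
    using inst[of "[0,1,2]" "Eq (plus_tm (plus_tm ?x ?y) ?z) (plus_tm ?x (plus_tm ?y ?z))"]
    by (simp add: field_ax_def Let_def ops)
  show "a \<oplus>\<^bsub>K\<^esub> b = b \<oplus>\<^bsub>K\<^esub> a"
    using inst[of "[0,1]" "Eq (plus_tm ?x ?y) (plus_tm ?y ?x)"] by (simp add: field_ax_def Let_def ops)
  show "a \<oplus>\<^bsub>K\<^esub> \<zero>\<^bsub>K\<^esub> = a"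
    using inst[of "[0]" "Eq (plus_tm ?x zero_tm) ?x"] by (simp add: field_ax_def Let_def ops)
  show "a \<oplus>\<^bsub>K\<^esub> ifun N RMinus [a] = \<zero>\<^bsub>K\<^esub>"
    using inst[of "[0]" "Eq (plus_tm ?x (minus_tm ?x)) zero_tm"] by (simp add: field_ax_def Let_def ops)
  show "(a \<otimes>\<^bsub>K\<^esub> b) \<otimes>\<^bsub>K\<^esub> d = a \<otimes>\<^bsub>K\<^esub> (b \<otimes>\<^bsub>K\<^esub> d)"
    using inst[of "[0,1,2]" "Eq (times_tm (times_tm ?x ?y) ?z) (times_tm ?x (times_tm ?y ?z))"]
    by (simp add: field_ax_def Let_def ops)
  show "a \<otimes>\<^bsub>K\<^esub> b = b \<otimes>\<^bsub>K\<^esub> a"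
    using inst[of "[0,1]" "Eq (times_tm ?x ?y) (times_tm ?y ?x)"] by (simp add: field_ax_def Let_def ops)
  show "a \<otimes>\<^bsub>K\<^esub> \<one>\<^bsub>K\<^esub> = a"
    using inst[of "[0]" "Eq (times_tm ?x one_tm) ?x"] by (simp add: field_ax_def Let_def ops)
  show "a \<otimes>\<^bsub>K\<^esub> (b \<oplus>\<^bsub>K\<^esub> d) = a \<otimes>\<^bsub>K\<^esub> b \<oplus>\<^bsub>K\<^esub> a \<otimes>\<^bsub>K\<^esub> d"
    using inst[of "[0,1,2]" "Eq (times_tm ?x (plus_tm ?y ?z)) (plus_tm (times_tm ?x ?y) (times_tm ?x ?z))"]
    by (simp add: field_ax_def Let_def ops)
  show "\<zero>\<^bsub>K\<^esub> \<noteq> \<one>\<^bsub>K\<^esub>"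
    using inst0[of "Neg (Eq zero_tm one_tm)"] by (simp add: field_ax_def Let_def ops)
  show "\<exists>b\<in>univ N. a \<otimes>\<^bsub>K\<^esub> b = \<one>\<^bsub>K\<^esub>" if "a \<noteq> \<zero>\<^bsub>K\<^esub>"
    using inst[of "[0]" "Imp (Neg (Eq ?x zero_tm)) (Exists 1 (Eq (times_tm ?x ?y) one_tm))"] that
    by (simp add: field_ax_def Let_def ops)
qed

lemma field_K: "field K"
proof (rule cring.cring_fieldI2)
  have m: "comm_monoid K"
    by (rule comm_monoidI) (use closed field_laws in \<open>auto simp: ops(5)\<close>, auto simp: ops)
  show "cring K"
  proof (rule cringI)
    show "abelian_group K"
    proof (rule abelian_groupI)
      show "\<exists>y\<in>carrier K. y \<oplus>\<^bsub>K\<^esub> x = \<zero>\<^bsub>K\<^esub>" if "x \<in> carrier K" for x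
        using that field_laws(2,4)[of x] closed(3) by (metis ops(5))
    qed (use field_laws closed in \<open>auto simp: ops\<close>)
    show "(x \<oplus>\<^bsub>K\<^esub> y) \<otimes>\<^bsub>K\<^esub> z = x \<otimes>\<^bsub>K\<^esub> z \<oplus>\<^bsub>K\<^esub> y \<otimes>\<^bsub>K\<^esub> z"
      if "x \<in> carrier K" "y \<in> carrier K" "z \<in> carrier K" for x y z
      using that field_laws(6,8) closed by (metis ops(1,5))
  qed (rule m)
next
  show "\<zero>\<^bsub>K\<^esub> \<noteq> \<one>\<^bsub>K\<^esub>" using field_laws(9)[OF closed(4,4,4)] .
  show "\<exists>b\<in>carrier K. a \<otimes>\<^bsub>K\<^esub> b = \<one>\<^bsub>K\<^esub>" if "a \<in> carrier K" "a \<noteq> \<zero>\<^bsub>K\<^esub>" for a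
    using field_laws(10)[of a a a] that unfolding ops(5) by blast
qed

lemma subfield_laws:
  assumes a: "a \<in> univ N" and b: "b \<in> univ N"
  shows "irel N SubP [\<zero>\<^bsub>K\<^esub>]" "irel N SubP [\<one>\<^bsub>K\<^esub>]"
    "irel N SubP [a] \<Longrightarrow> irel N SubP [b] \<Longrightarrow> irel N SubP [a \<oplus>\<^bsub>K\<^esub> b]"
    "irel N SubP [a] \<Longrightarrow> irel N SubP [ifun N RMinus [a]]"
    "irel N SubP [a] \<Longrightarrow> irel N SubP [b] \<Longrightarrow> irel N SubP [a \<otimes>\<^bsub>K\<^esub> b]"
    "irel N SubP [a] \<Longrightarrow> a \<otimes>\<^bsub>K\<^esub> b = \<one>\<^bsub>K\<^esub> \<Longrightarrow> irel N SubP [b]"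
proof -
  let ?e = "\<lambda>i :: nat. if i = 0 then a else if i = 1 then b else b"
  have inst: "sat N ?e \<phi>" if "Alls is \<phi> \<in> subfield_ax" for "is" \<phi>
    using subfield[OF that] a b by (intro instance3) (simp_all add: true_in_Alls)
  have inst0: "sat N ?e \<phi>" if "\<phi> \<in> subfield_ax" for \<phi>
    using subfield[OF that] a b b by (rule instance3)
  let ?x = "Var 0 :: 'f rsym tm" and ?y = "Var 1 :: 'f rsym tm"
  show "irel N SubP [\<zero>\<^bsub>K\<^esub>]" "irel N SubP [\<one>\<^bsub>K\<^esub>]"
    using inst0[of "in_P zero_tm"] inst0[of "in_P one_tm"] by (simp_all add: subfield_ax_def Let_def ops)
  show "irel N SubP [a \<oplus>\<^bsub>K\<^esub> b]" if "irel N SubP [a]" "irel N SubP [b]"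
    using inst[of "[0,1]" "Imp (Conj (in_P ?x) (in_P ?y)) (in_P (plus_tm ?x ?y))"] that
    by (simp add: subfield_ax_def Let_def ops)
  show "irel N SubP [ifun N RMinus [a]]" if "irel N SubP [a]"
    using inst[of "[0]" "Imp (in_P ?x) (in_P (minus_tm ?x))"] that by (simp add: subfield_ax_def Let_def ops)
  show "irel N SubP [a \<otimes>\<^bsub>K\<^esub> b]" if "irel N SubP [a]" "irel N SubP [b]"
    using inst[of "[0,1]" "Imp (Conj (in_P ?x) (in_P ?y)) (in_P (times_tm ?x ?y))"] that
    by (simp add: subfield_ax_def Let_def ops)
  show "irel N SubP [b]" if "irel N SubP [a]" "a \<otimes>\<^bsub>K\<^esub> b = \<one>\<^bsub>K\<^esub>"
    using inst[of "[0,1]" "Imp (Conj (in_P ?x) (Eq (times_tm ?x ?y) one_tm)) (in_P ?y)"] that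
    by (simp add: subfield_ax_def Let_def ops)
qed

lemma vars_env:
  assumes "set xs \<subseteq> univ N"
  defines "e \<equiv> \<lambda>i. if i < length xs then xs ! i else ifun N RZero []"
  shows "range e \<subseteq> univ N" "map (val N e) (map Var [0..<length xs]) = xs"
    "(\<forall>i\<in>set [0..<length xs]. irel N SubP [e i]) \<longleftrightarrow> set xs \<subseteq> univ F"
proof -
  show "range e \<subseteq> univ N" using assms closed(4) by (auto simp: e_def)
  show "map (val N e) (map Var [0..<length xs]) = xs" by (rule nth_equalityI) (auto simp: e_def)
  show "(\<forall>i\<in>set [0..<length xs]. irel N SubP [e i]) \<longleftrightarrow> set xs \<subseteq> univ F"
  proof
    assume *: "\<forall>i\<in>set [0..<length xs]. irel N SubP [e i]"
    show "set xs \<subseteq> univ F"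
    proof
      fix a assume a: "a \<in> set xs"
      then obtain i where "i < length xs" "a = xs ! i" by (metis in_set_conv_nth)
      then show "a \<in> univ F" using * a assms(1) by (auto simp: e_def univ_F)
    qed
  next
    assume *: "set xs \<subseteq> univ F"
    show "\<forall>i\<in>set [0..<length xs]. irel N SubP [e i]"
    proof
      fix i assume "i \<in> set [0..<length xs]"
      then have "i < length xs" "xs ! i \<in> univ F" using * nth_mem by auto
      then show "irel N SubP [e i]" by (simp add: e_def univ_F)
    qed
  qed
qed

lemma fun_outside:
  assumes f: "f \<in> funs L" "f \<notin> funs (L_rings :: ('f rsym, 'r) language)"
    and xs: "set xs \<subseteq> univ N" "length xs = far L f"
  shows "set xs \<subseteq> univ F \<Longrightarrow> ifun N f xs \<in> univ F" "\<not> set xs \<subseteq> univ F \<Longrightarrow> ifun N f xs = \<zero>\<^bsub>K\<^esub>"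
proof -
  let ?e = "\<lambda>i. if i < length xs then xs ! i else ifun N RZero []"
  note E = vars_env[OF xs(1)]
  let ?vs = "[0..<far L f]" and ?t = "Fun f (map Var [0..<far L f])"
  have "true_in N (Alls ?vs (Imp (all_in_P ?vs) (in_P ?t)))"
    "true_in N (Alls ?vs (Imp (Neg (all_in_P ?vs)) (Eq ?t zero_tm)))"
    using fun_ax[of f] f by (simp_all add: fun_axioms_def Let_def)
  then have "sat N ?e (Imp (all_in_P ?vs) (in_P ?t))" "sat N ?e (Imp (Neg (all_in_P ?vs)) (Eq ?t zero_tm))"
    using true_in_AllsD[OF _ E(1)] by blast+
  then have "(set xs \<subseteq> univ F \<longrightarrow> irel N SubP [ifun N f xs]) \<and> (\<not> set xs \<subseteq> univ F \<longrightarrow> ifun N f xs = \<zero>\<^bsub>K\<^esub>)"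
    unfolding sat.simps sat_all_in_P val.simps list.map xs(2)[symmetric] E(2,3) by (simp add: ops(3))
  then show "set xs \<subseteq> univ F \<Longrightarrow> ifun N f xs \<in> univ F" "\<not> set xs \<subseteq> univ F \<Longrightarrow> ifun N f xs = \<zero>\<^bsub>K\<^esub>"
    using fun_closed[OF f(1) xs] by (auto simp: univ_F)
qed

lemma rel_outside:
  assumes R: "R \<in> rels L" and xs: "set xs \<subseteq> univ N" "length xs = rar L R" "\<not> set xs \<subseteq> univ F"
  shows "\<not> irel N (Base R) xs"
proof -
  let ?e = "\<lambda>i. if i < length xs then xs ! i else ifun N RZero []"
  note E = vars_env[OF xs(1)]
  let ?vs = "[0..<rar L R]"
  have "true_in N (Alls ?vs (Imp (Neg (all_in_P ?vs)) (Neg (Rel (Base R) (map Var ?vs)))))"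
    using rel_ax[OF R] by (simp add: rel_axiom_def Let_def)
  then have "sat N ?e (Imp (Neg (all_in_P ?vs)) (Neg (Rel (Base R) (map Var ?vs))))"
    using true_in_AllsD[OF _ E(1)] by blast
  then show ?thesis
    using xs(3) unfolding sat.simps sat_all_in_P xs(2)[symmetric] E(2,3) by simp
qed

lemma is_struct_P: "is_struct L F"
  unfolding is_struct_def
proof (intro conjI ballI allI impI)
  have z: "\<zero>\<^bsub>K\<^esub> \<in> univ F" "\<one>\<^bsub>K\<^esub> \<in> univ F"
    using closed subfield_laws(1,2)[OF closed(4,4)] by (auto simp: univ_F ops)
  then show "univ F \<noteq> {}" by auto
  fix f xs assume f: "f \<in> funs L" and xs: "set xs \<subseteq> univ F \<and> length xs = far L f"
  have N: "set xs \<subseteq> univ N" using xs by (auto simp: univ_F)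
  have "ifun N f xs \<in> univ F"
  proof (cases "f \<in> funs (L_rings :: ('f rsym, 'r) language)")
    case False
    then show ?thesis using fun_outside(1) f xs N by blast
  next
    case True
    then consider "f = RZero" | "f = ROne" | "f = RPlus" | "f = RTimes" | "f = RMinus"
      by (auto simp: L_rings_def)
    then show ?thesis
    proof cases
      case 1
      then show ?thesis using xs L_rings_arity[OF L] z by (auto simp: ops)
    next
      case 2
      then show ?thesis using xs L_rings_arity[OF L] z by (auto simp: ops)
    next
      case 3
      then obtain a b where "xs = [a, b]" using xs L_rings_arity[OF L] by (auto simp: numeral_2_eq_2 length_Suc_conv)
      then show ?thesis using 3 xs closed subfield_laws(3)[of a b] by (auto simp: univ_F ops)
    next
      case 4
      then obtain a b where "xs = [a, b]" using xs L_rings_arity[OF L] by (auto simp: numeral_2_eq_2 length_Suc_conv)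
      then show ?thesis using 4 xs closed subfield_laws(5)[of a b] by (auto simp: univ_F ops)
    next
      case 5
      then obtain a where "xs = [a]" using xs L_rings_arity[OF L] by (auto simp: length_Suc_conv)
      then show ?thesis using 5 xs closed subfield_laws(4)[of a a] by (auto simp: univ_F ops)
    qed
  qed
  then show "ifun F f xs \<in> univ F" by (simp add: P_struct_def)
qed

lemma ex_root:
  assumes cs: "cs \<noteq> []" "set cs \<subseteq> univ N"
  shows "\<exists>x\<in>univ N. horner K (cs @ [\<one>\<^bsub>K\<^esub>]) x = \<zero>\<^bsub>K\<^esub>"
proof -
  let ?n = "length cs"
  \<comment> \<open>Reversed, because variable 0 of \<open>root_axiom\<close> is the coefficient
    just below the leading one.\<close>
  let ?e = "\<lambda>i. if i < length (rev cs) then rev cs ! i else ifun N RZero []"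
  have rcs: "set (rev cs) \<subseteq> univ N" using cs by simp
  note E = vars_env[OF rcs]
  let ?p = "poly_tm (one_tm # map Var [0..<?n]) (Var ?n) :: 'f rsym tm"
  have "true_in N (Exists ?n (Eq ?p zero_tm))"
    using roots[of ?n] cs(1) by (simp add: root_axiom_def true_in_Alls Suc_le_eq)
  then have "sat N ?e (Exists ?n (Eq ?p zero_tm))" using E(1) unfolding true_in_def by simp
  then obtain x where x: "x \<in> univ N" "val N (?e(?n := x)) ?p = val N (?e(?n := x)) zero_tm" by auto
  have "map (val N (?e(?n := x))) (map Var [0..<?n]) = map (val N ?e) (map Var [0..<?n])" by simp
  also have "\<dots> = rev cs" using E(2) by simp
  finally have m: "map (val N (?e(?n := x))) (one_tm # map Var [0..<?n]) = rev (cs @ [\<one>\<^bsub>K\<^esub>])"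
    by (simp add: ops del: map_map)
  have v: "val N (?e(?n := x)) (Var ?n) = x" by simp
  have "set (cs @ [\<one>\<^bsub>K\<^esub>]) \<subseteq> carrier K" using cs closed by (auto simp: ops)
  from foldl_horner[OF field_K this, of x] x show ?thesis
    unfolding val_poly_tm m v by (auto simp: ops(3,5))
qed

lemma pair_of_fields: "pair_of_fields L N"
proof (rule pair_of_fields.intro)
  show "sublanguage L_rings L" by (rule L)
  show "is_struct (add_pred L) N" by (rule struct)
  show "is_struct L F" by (rule is_struct_P)
  show "field K" by (rule field_K)
  then interpret K: field K .
  show "ifun N RMinus [a] = \<ominus>\<^bsub>K\<^esub> a" if "a \<in> univ N" for a
    using K.minus_equality[of "ifun N RMinus [a]" a] that closed field_laws(2,4) by (metis ops(5))
  show "\<exists>x\<in>univ N. horner K (cs @ [\<one>\<^bsub>K\<^esub>]) x = \<zero>\<^bsub>K\<^esub>" if "cs \<noteq> []" "set cs \<subseteq> univ N" for cs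
    using ex_root that .
  show "b \<in> univ F" if "a \<in> univ F" "b \<in> univ N" "a \<otimes>\<^bsub>K\<^esub> b = \<one>\<^bsub>K\<^esub>" for a b
    using that subfield_laws(6)[of a b] by (auto simp: univ_F)
  show "ifun N f xs = \<zero>\<^bsub>K\<^esub>"
    if "f \<in> funs L" "f \<notin> funs (L_rings :: ('f rsym, 'r) language)" "length xs = far L f"
      "set xs \<subseteq> univ N" "\<not> set xs \<subseteq> univ F" for f xs
    using fun_outside(2) that by blast
  show "\<not> irel N (Base R) xs"
    if "R \<in> rels L" "length xs = rar L R" "set xs \<subseteq> univ N" "\<not> set xs \<subseteq> univ F" for R xs
    using rel_outside that by blast
qed

lemma P_model: "is_model L F T"
  unfolding is_model_def true_in_def
proof (intro conjI ballI allI impI is_struct_P)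
  fix \<phi> and e :: "nat \<Rightarrow> 'a" assume \<phi>: "\<phi> \<in> T" and e: "range e \<subseteq> univ F"
  have "range e \<subseteq> univ N" using e by (auto simp: univ_F)
  then show "sat F e \<phi>" using model_T[OF \<phi>] sat_relativize[OF e] unfolding true_in_def by blast
qed

end

section \<open>Well-formedness and free variables\<close>

lemma wf_Alls: "wf_fm L (Alls is \<phi>) \<longleftrightarrow> wf_fm L \<phi>"
  by (induction "is") (auto simp: Alls_def)

lemma add_pred_simps [simp]:
  "funs (add_pred L) = funs L" "far (add_pred L) = far L" "SubP \<in> rels (add_pred L)"
  "rar (add_pred L) SubP = 1" "Base R \<in> rels (add_pred L) \<longleftrightarrow> R \<in> rels L" "rar (add_pred L) (Base R) = rar L R"
  by (auto simp: add_pred_def)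

lemma wf_relativize: "wf_fm L \<phi> \<Longrightarrow> wf_fm (add_pred L) (relativize \<phi>)"
  by (induction \<phi>) (auto simp: wf_add_pred_tm list_all_iff)

lemma wf_all_in_P: "wf_fm (add_pred L) (all_in_P is)"
  by (simp add: all_in_P_def wf_Conjs)

text \<open>The transfer of truth to the ultrapower is proved for well-formed formulas, whose terms
  have values in the universe.\<close>

lemma wf_ACF_T:
  assumes L: "sublanguage L_rings L" and T: "T \<subseteq> sentences L"
    and \<phi>: "\<phi> \<in> ACF \<union> subfield_ax \<union> relativize ` T
      \<union> (\<Union>f \<in> funs L - funs (L_rings :: ('f rsym, 'r) language). fun_axioms L f) \<union> rel_axiom L ` rels L"
  shows "wf_fm (add_pred L) \<phi>"
proof -
  note ar = L_rings_arity[OF L]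
  have poly: "wf_tm (add_pred L) (poly_tm ts t)"
    if "wf_tm (add_pred L) t" "list_all (wf_tm (add_pred L)) ts" for ts t
  proof -
    have "wf_tm (add_pred L) (foldl (\<lambda>s c. plus_tm (times_tm s t) c) s ts)" if "wf_tm (add_pred L) s" for s
      using that \<open>list_all (wf_tm (add_pred L)) ts\<close> \<open>wf_tm (add_pred L) t\<close>
      by (induction ts arbitrary: s) (simp_all add: ar)
    then show ?thesis by (simp add: poly_tm_def ar)
  qed
  consider "\<phi> \<in> field_ax" | n where "\<phi> = root_axiom n" | "\<phi> \<in> subfield_ax" | \<psi> where "\<phi> = relativize \<psi>" "\<psi> \<in> T"
    | f where "f \<in> funs L" "\<phi> \<in> fun_axioms L f" | R where "R \<in> rels L" "\<phi> = rel_axiom L R"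
    using \<phi> unfolding ACF_def by blast
  then show ?thesis
  proof cases
    case 1
    then show ?thesis by (auto simp: field_ax_def Let_def wf_Alls ar)
  next
    case 2
    then show ?thesis by (simp add: root_axiom_def wf_Alls poly list_all_iff ar)
  next
    case 3
    then show ?thesis by (auto simp: subfield_ax_def Let_def wf_Alls ar)
  next
    case 4
    then show ?thesis using T by (auto simp: sentences_def intro!: wf_relativize)
  next
    case 5
    then show ?thesis by (auto simp: fun_axioms_def Let_def wf_Alls wf_all_in_P list_all_iff ar)
  next
    case 6
    then show ?thesis by (auto simp: rel_axiom_def Let_def wf_Alls wf_all_in_P list_all_iff)
  qed
qed

lemma fv_unconst_tm: "2 * i \<in> fv_tm (unconst_tm c t) \<Longrightarrow> i \<in> fv_tm t"
proof (induction t)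
  case (Fun f ts)
  have "2 * i \<noteq> Suc (2 * j)" for j by arith
  then show ?case using Fun by (cases f) auto
qed simp

lemma fv_unconst_fm: "2 * i \<in> fv (unconst_fm c \<phi>) \<Longrightarrow> i \<in> fv \<phi>"
  by (induction \<phi>) (auto dest: fv_unconst_tm)

context pair_of_fields
begin

text \<open>If over some \<open>e1\<close> no transcendental element is left, \<open>e1\<close>
  joins the constants, and from then on every element is algebraic over each F(c, e).\<close>

lemma ex_homogeneous:
  fixes a :: "nat \<Rightarrow> 'a"
  assumes forth: "\<And>y y' z. tp_eq y y' \<Longrightarrow> range y \<subseteq> univ F \<Longrightarrow> range y' \<subseteq> univ F \<Longrightarrow> z \<in> univ F \<Longrightarrow>
      \<exists>z'\<in>univ F. tp_eq (prep [z] y) (prep [z'] y')"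
    and a: "range a \<subseteq> univ N"
  shows "\<exists>c. range a \<subseteq> range c \<and> homogeneous_pair L N c"
proof -
  have sat_pair: "saturated_pair L N c" if "range c \<subseteq> univ N" for c
    using forth that by unfold_locales blast+
  interpret A: saturated_pair L N a by (rule sat_pair[OF a])
  show ?thesis
  proof (cases "\<forall>e. range e \<subseteq> univ N \<longrightarrow> (\<exists>x\<in>univ N. \<forall>d. A.no_rel d e x)")
    case True
    have "homogeneous_pair L N a"
      by (intro homogeneous_pair.intro homogeneous_pair_axioms.intro A.saturated_pair_axioms disjI1 True)
    then show ?thesis by blast
  next
    case False
    then obtain e1 where e1: "range e1 \<subseteq> univ N" "\<And>x. x \<in> univ N \<Longrightarrow> \<exists>d. \<not> A.no_rel d e1 x" by blast
    let ?c = "interleave a e1"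
    have c: "range ?c \<subseteq> univ N" using a e1(1) by (simp add: range_interleave)
    interpret B: saturated_pair L N ?c by (rule sat_pair[OF c])
    have "\<exists>d. \<not> B.no_rel d e x" if x: "x \<in> univ N" for e x
    proof -
      obtain d where "\<not> A.no_rel d e1 x" using e1(2)[OF x] by blast
      then obtain y ps where y: "range y \<subseteq> univ F" "length ps \<le> d"
        "horner K (map (A.pv y e1) ps) x = \<zero>\<^bsub>K\<^esub>" "\<exists>p\<in>set ps. A.pv y e1 p \<noteq> \<zero>\<^bsub>K\<^esub>"
        unfolding A.no_rel_def by blast
      \<comment> \<open>Rereads an expression over constants \<open>a\<close> and assignment
        \<open>e1\<close> as one over the interleaved constants: \<open>a\<close> at even and
        \<open>e1\<close> at odd places. No \<open>PE\<close> variable remains, so the relation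
        holds over every \<open>e\<close>.\<close>
      define f where "f v = (case v of PY i \<Rightarrow> PY i | PE i \<Rightarrow> PC (Suc (2 * i)) | PC i \<Rightarrow> PC (2 * i))" for v
      have "(\<lambda>v. valuation y e ?c (f v)) = valuation y e1 a"
        by (rule ext) (simp add: f_def split: pvar.split)
      then have p: "B.pv y e (map_ringpoly f p) = A.pv y e1 p" for p by (simp add: pval_map)
      have "map (B.pv y e) (map (map_ringpoly f) ps) = map (A.pv y e1) ps" by (simp add: p)
      then have "\<not> B.no_rel d e x"
        unfolding B.no_rel_def using y p
        by (intro notI, elim allE[of _ y] allE[of _ "map (map_ringpoly f) ps"]) (simp del: map_map)
      then show ?thesis by blast
    qed
    then have "homogeneous_pair L N ?c"
      by (intro homogeneous_pair.intro homogeneous_pair_axioms.intro B.saturated_pair_axioms disjI2) blast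
    then show ?thesis by (intro exI[of _ ?c]) (simp add: range_interleave)
  qed
qed

end

section \<open>The ultrapower as a saturated pair\<close>

context nat_ultrafilter
begin

lemma true_in_ultrapower:
  fixes M :: "('a, 'f, 'r) struct"
  assumes "is_struct L M" "wf_fm L \<phi>" "true_in M \<phi>"
  shows "true_in (ultrapower M) \<phi>"
  unfolding true_in_def
proof (intro allI impI)
  fix e :: "nat \<Rightarrow> nat \<Rightarrow> 'a" assume e: "range e \<subseteq> univ (ultrapower M)"
  have "sat M (\<lambda>i. e i k) \<phi>" for k
    using assms(3) ultrapower_component(2)[OF e, of k] unfolding true_in_def by blast
  then show "sat (ultrapower M) e \<phi>" using sat_ultrapower[OF assms(1,2) e] UNIV by simp
qed

definition diag :: "('a, 'f, 'r) struct \<Rightarrow> 'a \<Rightarrow> nat \<Rightarrow> 'a" where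
  "diag M a = rep M (\<lambda>_. a)"

lemma diag: "a \<in> univ M \<Longrightarrow> diag M a \<in> univ (ultrapower M)"
  by (auto simp: diag_def ultrapower_def)

lemma diag_eq: "a \<in> univ M \<Longrightarrow> {k. diag M a k = a} \<in> U"
  using rep[of "\<lambda>_. a" M] by (auto simp: diag_def)

text \<open>The diagonal embedding is elementary: a formula has finitely many free variables, so at
  almost all indices the representatives take their constant values.\<close>

lemma sat_diag:
  assumes M: "is_struct L M" and \<phi>: "wf_fm L \<phi>" and d: "range d \<subseteq> univ M"
  shows "sat (ultrapower M) (\<lambda>i. diag M (d i)) \<phi> \<longleftrightarrow> sat M d \<phi>"
proof -
  let ?A = "{k. \<forall>i\<in>fv \<phi>. diag M (d i) k = d i}" and ?B = "{k. sat M (\<lambda>i. diag M (d i) k) \<phi>}"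
  have A: "?A \<in> U"
    using d by (intro finite_Ball finite_fv diag_eq) (auto simp: image_subset_iff)
  have c: "sat M (\<lambda>i. diag M (d i) k) \<phi> \<longleftrightarrow> sat M d \<phi>" if "k \<in> ?A" for k
    using that by (intro sat_cong) simp
  have "range (\<lambda>i. diag M (d i)) \<subseteq> univ (ultrapower M)"
    using d by (auto simp: image_subset_iff intro!: diag)
  then have "sat (ultrapower M) (\<lambda>i. diag M (d i)) \<phi> \<longleftrightarrow> ?B \<in> U"
    using sat_ultrapower[OF M \<phi>] by blast
  also have "\<dots> \<longleftrightarrow> ?A \<inter> ?B \<in> U" using A Int_iff by simp
  also have "?A \<inter> ?B = (if sat M d \<phi> then ?A else {})" using c by auto
  finally show ?thesis using A Falsum by simp
qed

text \<open>The type of \<open>z\<close> over \<open>y\<close>, read over \<open>y'\<close>, is a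
  type, and among the countably many types over \<open>y'\<close> it is isolated by a countable
  subset. Saturation realizes that subset inside the subfield, even if L is uncountable.\<close>

lemma forth_P_struct:
  fixes M :: "('a, 'f rsym, 'r psym) struct" and L :: "('f rsym, 'r) language"
  assumes M: "is_struct (add_pred L) M" and P: "pair_of_fields L (ultrapower M)"
    and count: "countable (tuple_types L (P_struct (ultrapower M)) y' 1)"
    and tp: "pair_of_fields.tp_eq L (ultrapower M) y y'"
    and y: "range y \<subseteq> univ (P_struct (ultrapower M))" "range y' \<subseteq> univ (P_struct (ultrapower M))"
    and z: "z \<in> univ (P_struct (ultrapower M))"
  shows "\<exists>z'\<in>univ (P_struct (ultrapower M)). pair_of_fields.tp_eq L (ultrapower M) (prep [z] y) (prep [z'] y')"
proof -
  let ?N = "ultrapower M"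
  let ?F = "P_struct ?N"
  interpret P: pair_of_fields L ?N by (rule P)
  interpret B: boolean_family "tuples ?F 1" "\<lambda>zs. sat ?F (prep zs y')" "{\<phi>. wf_fm L \<phi>}" Neg Conj "Neg Falsum"
    by (rule boolean_family_tuples)
  define p where "p = {\<phi>. wf_fm L \<phi> \<and> sat ?F (prep [z] y) \<phi>}"
  have "fin_sat (tuples ?F 1) (\<lambda>zs. sat ?F (prep zs y')) p"
    unfolding fin_sat_def
  proof (intro allI impI)
    fix q assume q: "q \<subseteq> p \<and> finite q"
    then obtain ql where ql: "set ql = q" using finite_list by auto
    let ?\<psi> = "Conjs ql"
    have wf: "wf_fm L (Exs [0..<1] ?\<psi>)" using q ql by (auto simp: wf_Exs wf_Conjs p_def)
    \<comment> \<open>Truncated subtraction lets variables 0 and 1 both read entry 0 of the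
      sequence; the reading at variable 0 is the dummy that the quantifier overwrites.\<close>
    obtain \<theta> where \<theta>: "wf_fm L \<theta>"
      "\<And>e :: nat \<Rightarrow> nat \<Rightarrow> 'a. sat ?F e \<theta> \<longleftrightarrow> sat ?F (\<lambda>k. e (k - 1)) (Exs [0..<1] ?\<psi>)"
      using rename_formula[OF wf, of "\<lambda>k. k - 1"] by blast
    have sh: "(\<lambda>k. w (k - 1)) = prep [w 0] w" for w :: "nat \<Rightarrow> nat \<Rightarrow> 'a"
      by (auto simp: prep_def fun_eq_iff)
    have "sat ?F (prep [z] y) ?\<psi>" using q ql by (auto simp: sat_Conjs p_def)
    then have "sat ?F y \<theta>"
      unfolding \<theta>(2) sh using ex_prep_iff_Exs[OF y(1), of "[y 0]" 1] z by (metis One_nat_def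
        bot.extremum insert_subset length_Cons list.set(1,2) list.size(3))
    then have "sat ?F y' \<theta>" using tp \<theta>(1) unfolding P.tp_eq_def by blast
    then obtain zs where "length zs = 1" "set zs \<subseteq> univ ?F" "sat ?F (prep zs y') ?\<psi>"
      unfolding \<theta>(2) sh using ex_prep_iff_Exs[OF y(2), of "[y' 0]" 1] by auto
    then show "\<exists>zs\<in>tuples ?F 1. \<forall>\<phi>\<in>q. sat ?F (prep zs y') \<phi>"
      using ql by (auto simp: tuples_def sat_Conjs)
  qed
  then have pT: "p \<in> B.Ty" by (rule B.complete_type[rotated]) (auto simp: p_def)
  \<comment> \<open>\<open>Neg Falsum\<close> belongs to every type, so the isolation lemma is
    applied to all types at once.\<close>
  have "countable {q \<in> B.Ty. Neg Falsum \<in> q}" using count by (rule countable_subset[rotated]) auto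
  from B.countably_determined[OF pT _ this] obtain \<Delta> where \<Delta>: "\<Delta> \<subseteq> p" "countable \<Delta>"
    "\<forall>q\<in>B.Ty. \<Delta> \<subseteq> q \<longrightarrow> q = p" by (auto simp: p_def)
  define e0 where "e0 = prep [y' 0] y'"
  have yN: "range y' \<subseteq> univ ?N" using y(2) P.F_subset by blast
  have e0: "range e0 \<subseteq> univ ?N" unfolding e0_def using yN by (intro range_prep) auto
  have prep0: "e = prep [e 0] y'" if "\<And>i. i \<notin> {0} \<Longrightarrow> e i = e0 i" for e
    using that by (auto simp: e0_def prep_def fun_eq_iff)
  \<comment> \<open>Formulas of the subfield become formulas of the pair, and the extra one forces
    the solution into the subfield.\<close>
  let ?D = "insert (in_P (Var 0)) (relativize ` \<Delta>)"
  have "\<exists>e. range e \<subseteq> univ ?N \<and> (\<forall>i. i \<notin> {0} \<longrightarrow> e i = e0 i) \<and> (\<forall>\<phi>\<in>?D. sat ?N e \<phi>)"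
  proof (rule ultrapower_saturated[OF M _ _ e0])
    show "wf_fm (add_pred L) \<phi>" if "\<phi> \<in> ?D" for \<phi>
      using that \<Delta>(1) by (auto simp: p_def intro!: wf_relativize)
    show "countable ?D" using \<Delta>(2) by auto
    fix q assume q: "q \<subseteq> ?D" "finite q"
    then have "q - {in_P (Var 0)} \<subseteq> relativize ` \<Delta>" "finite (q - {in_P (Var 0)})" by auto
    then obtain r where r: "r \<subseteq> \<Delta>" "finite r" "q - {in_P (Var 0)} = relativize ` r"
      by (metis finite_subset_image)
    obtain zs where zs: "zs \<in> tuples ?F 1" "\<forall>\<phi>\<in>r. sat ?F (prep zs y') \<phi>"
      using B.type_fin_sat[OF pT r(2)] r(1) \<Delta>(1) by (meson subset_trans)
    obtain w where w: "zs = [w]" "w \<in> univ ?F" using zs(1) by (auto simp: tuples_def length_Suc_conv)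
    have rF: "range (prep [w] y') \<subseteq> univ ?F" using y(2) w by (intro range_prep) auto
    have "sat ?N (prep [w] y') \<phi>" if "\<phi> \<in> q" for \<phi>
    proof (cases "\<phi> = in_P (Var 0)")
      case True
      then show ?thesis using w(2) by (simp add: prep_Cons P_struct_def)
    next
      case False
      then have "\<phi> \<in> relativize ` r" unfolding r(3)[symmetric] using that by simp
      then obtain \<psi> where "\<psi> \<in> r" "\<phi> = relativize \<psi>" by auto
      then show ?thesis using zs(2) w sat_relativize[OF rF] by auto
    qed
    moreover have "range (prep [w] y') \<subseteq> univ ?N" using rF P.F_subset by blast
    ultimately show "\<exists>e. range e \<subseteq> univ ?N \<and> (\<forall>i. i \<notin> {0} \<longrightarrow> e i = e0 i) \<and> (\<forall>\<phi>\<in>q. sat ?N e \<phi>)"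
      by (intro exI[of _ "prep [w] y'"]) (auto simp: e0_def prep_def)
  qed
  then obtain e where e: "range e \<subseteq> univ ?N" "\<And>i. i \<notin> {0} \<Longrightarrow> e i = e0 i"
    "sat ?N e (in_P (Var 0))" "\<And>\<phi>. \<phi> \<in> \<Delta> \<Longrightarrow> sat ?N e (relativize \<phi>)" by auto
  define z' where "z' = e 0"
  have ez: "e = prep [z'] y'" unfolding z'_def by (rule prep0) (rule e(2))
  have z': "z' \<in> univ ?F" using e(1,3) unfolding z'_def P_struct_def by auto
  have rF: "range (prep [z'] y') \<subseteq> univ ?F" using y(2) z' by (intro range_prep) auto
  let ?r = "realized_type (\<lambda>zs. sat ?F (prep zs y')) {\<phi>. wf_fm L \<phi>} [z']"
  have "?r \<in> B.Ty" using z' by (intro B.realized_type_in) (simp add: tuples_def)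
  moreover have "\<Delta> \<subseteq> ?r"
    using e(4) \<Delta>(1) sat_relativize[OF rF] unfolding ez by (auto simp: realized_type_def p_def)
  ultimately have "?r = p" using \<Delta>(3) by blast
  then have "P.tp_eq (prep [z] y) (prep [z'] y')" unfolding P.tp_eq_def p_def realized_type_def by blast
  then show ?thesis using z' by blast
qed

end

section \<open>Counting the types of a model in its ultrapower\<close>

theorem corollary5p26:
  fixes L :: "('f rsym, 'r) language"
    and T :: "('f rsym, 'r) fm set"
  assumes "theory_of_fields L T"
    and "complete_theory TYPE(('f rsym, 'r) fm) L T"
    and "omega_stable TYPE(('f rsym, 'r) fm) L T"
  shows "omega_stable TYPE('u) (add_pred L) (ACF_T L T)"
  unfolding omega_stable_def
proof (intro allI impI, elim conjE)
  fix M :: "('u, 'f rsym, 'r psym) struct" and A n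
  assume model: "is_model (add_pred L) M (ACF_T L T)" and A: "A \<subseteq> univ M" "countable A"
  have L: "sublanguage L_rings L" and T: "T \<subseteq> sentences L"
    using assms(1) by (auto simp: theory_of_fields_def)
  have M: "is_struct (add_pred L) M" using model by (simp add: is_model_def)
  obtain U where "nat_ultrafilter U" using ex_nat_ultrafilter by blast
  then interpret U: nat_ultrafilter U .
  define N where "N = U.ultrapower M"
  have ax: "true_in N \<phi>"
    if "\<phi> \<in> ACF \<union> subfield_ax \<union> relativize ` T
      \<union> (\<Union>f \<in> funs L - funs (L_rings :: ('f rsym, 'r) language). fun_axioms L f) \<union> rel_axiom L ` rels L" for \<phi>
  proof -
    have "true_in M \<phi>" using model that unfolding is_model_def ACF_T_def by blast
    then show ?thesis unfolding N_def using U.true_in_ultrapower[OF M wf_ACF_T[OF L T that]] by blast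
  qed
  have struct: "is_struct (add_pred L) N" unfolding N_def by (rule U.is_struct_ultrapower[OF M])
  interpret Q: ACF_T_model L T N
    by (rule ACF_T_model.intro[OF L struct]; rule ax; auto simp: ACF_def)
  interpret P: pair_of_fields L N by (rule Q.pair_of_fields)
  have count: "countable (tuple_types L P.F y k)" if "range y \<subseteq> univ P.F" for y k
    using omega_stable_countable_tuple_types[OF assms(3) T Q.P_model that] .
  have forth: "\<exists>z'\<in>univ P.F. P.tp_eq (prep [z] y) (prep [z'] y')"
    if "P.tp_eq y y'" "range y \<subseteq> univ P.F" "range y' \<subseteq> univ P.F" "z \<in> univ P.F" for y y' z
    using U.forth_P_struct[OF M Q.pair_of_fields[unfolded N_def] count[unfolded N_def]] that unfolding N_def by blast
  \<comment> \<open>Keeps the enumerated set nonempty when \<open>A\<close> is empty.\<close>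
  obtain a0 where a0: "a0 \<in> univ M" using M by (auto simp: is_struct_def)
  obtain b :: "nat \<Rightarrow> 'u" where b: "range b = insert a0 A"
    using A(2) by (metis countable_insert insert_not_empty range_from_nat_into)
  have bM: "range b \<subseteq> univ M" using b A(1) a0 by auto
  define ci where "ci a = (SOME i. b i = a)" for a
  have ci: "b (ci a) = a" if "a \<in> A" for a
    unfolding ci_def by (rule someI_ex) (use b that in \<open>auto simp: image_iff set_eq_iff\<close>, metis)
  define \<beta> where "\<beta> i = U.diag M (b i)" for i
  have \<beta>: "range \<beta> \<subseteq> univ N" using bM by (auto simp: \<beta>_def N_def image_subset_iff intro!: U.diag)
  obtain c where c: "range \<beta> \<subseteq> range c" and hom: "homogeneous_pair L N c"
    using P.ex_homogeneous[OF forth \<beta>] by blast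
  interpret H: homogeneous_pair L N c by (rule hom)
  obtain y0 where y0: "range y0 \<subseteq> univ P.F" "\<And>e0. range e0 \<subseteq> range c \<Longrightarrow> H.star y0 e0 y0 e0"
    using H.ex_base by blast
  \<comment> \<open>The base assignment: parameters at the odd places and the constant \<beta> 0 at
    the even ones, all of them among the constants \<open>c\<close>.\<close>
  define e0 where "e0 = interleave (\<lambda>_. \<beta> 0) \<beta>"
  have re0: "range e0 = range \<beta>" by (auto simp: e0_def range_interleave)
  have realized: "countable ((\<lambda>e. {\<phi>. wf_fm (add_pred L) \<phi> \<and> sat N e \<phi>}) ` {e. range e \<subseteq> univ N \<and> finite {i. e i \<noteq> e0 i}})"
    by (rule H.countable_realized[OF y0(1) y0(2) count[OF y0(1)]]) (use c re0 in simp)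

  let ?\<Phi> = "param_forms (add_pred L) A n"
  let ?u = "unconst_fm ci :: ('f rsym + 'u, 'r psym) fm \<Rightarrow> ('f rsym, 'r psym) fm"
  \<comment> \<open>Almost constant assignments only, since realized types were counted for finite
    changes of \<open>e0\<close>. By \<open>trunc\<close> nothing is lost: formulas in
    \<open>?\<Phi>\<close> see only the variables below \<open>n\<close>.\<close>
  define W where "W = {x :: nat \<Rightarrow> nat \<Rightarrow> 'u. range x \<subseteq> univ N \<and> finite {i. x i \<noteq> \<beta> 0}}"
  define h where "h x \<phi> = sat N (interleave x \<beta>) (?u \<phi>)" for x \<phi>
  have wf: "wf_fm (add_pred L) (?u \<phi>)" if "\<phi> \<in> ?\<Phi>" for \<phi>
    using that wf_unconst_fm by (auto simp: param_forms_def)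
  have satM: "sat M (interleave e b) (?u \<phi>) \<longleftrightarrow> sat (expand M) e \<phi>" if "\<phi> \<in> ?\<Phi>" for \<phi> e
    using that ci by (intro sat_unconst_fm[of A]) (auto simp: param_forms_def)
  have trunc: "\<exists>x'\<in>W. \<forall>\<phi>\<in>?\<Phi>. h x' \<phi> \<longleftrightarrow> sat N (interleave x \<beta>) (?u \<phi>)" if x: "range x \<subseteq> univ N"
    for x :: "nat \<Rightarrow> nat \<Rightarrow> 'u"
  proof (intro bexI ballI)
    let ?x = "\<lambda>i. if i < n then x i else \<beta> 0"
    have "{i. ?x i \<noteq> \<beta> 0} \<subseteq> {..<n}" by auto
    then have "finite {i. ?x i \<noteq> \<beta> 0}" by (rule finite_subset) simp
    then show "?x \<in> W" using x \<beta> by (auto simp: W_def)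
    fix \<phi> assume \<phi>: "\<phi> \<in> ?\<Phi>"
    show "h ?x \<phi> \<longleftrightarrow> sat N (interleave x \<beta>) (?u \<phi>)"
      unfolding h_def
    proof (rule sat_cong)
      fix i assume i: "i \<in> fv (?u \<phi>)"
      show "interleave ?x \<beta> i = interleave x \<beta> i"
      proof (cases "even i")
        case True
        then obtain j where j: "i = 2 * j" by (elim evenE)
        then have "j \<in> fv \<phi>" using i fv_unconst_fm by blast
        then show ?thesis using \<phi> j by (auto simp: param_forms_def)
      qed (simp add: interleave_def)
    qed
  qed
  interpret B: boolean_family W h ?\<Phi> Neg Conj "Neg Falsum"
    by unfold_locales (auto simp: h_def param_forms_def)
  have interN: "range (interleave x \<beta>) \<subseteq> univ N" if "range x \<subseteq> univ N" for x
    using that \<beta> by (simp add: range_interleave)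
  have "countable B.Ty"
  proof (rule B.countable_types)
    let ?f = "\<lambda>e. {\<phi>. wf_fm (add_pred L) \<phi> \<and> sat N e \<phi>}"
    have real: "realized_type h ?\<Phi> x = {\<phi>\<in>?\<Phi>. ?u \<phi> \<in> ?f (interleave x \<beta>)}" for x
      using wf by (auto simp: realized_type_def h_def)
    have mem: "interleave x \<beta> \<in> {e. range e \<subseteq> univ N \<and> finite {i. e i \<noteq> e0 i}}" if "x \<in> W" for x
    proof -
      have "{i. interleave x \<beta> i \<noteq> e0 i} \<subseteq> (*) 2 ` {i. x i \<noteq> \<beta> 0}"
        by (auto simp: e0_def interleave_def split: if_splits)
      moreover have "finite ((*) 2 ` {i. x i \<noteq> \<beta> 0})" using that by (auto simp: W_def)
      ultimately have "finite {i. interleave x \<beta> i \<noteq> e0 i}" by (rule finite_subset)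
      then show ?thesis using that interN by (auto simp: W_def)
    qed
    have "realized_type h ?\<Phi> ` W \<subseteq> (\<lambda>p. {\<phi>\<in>?\<Phi>. ?u \<phi> \<in> p}) ` ?f `
        {e. range e \<subseteq> univ N \<and> finite {i. e i \<noteq> e0 i}}"
      unfolding real by (rule image_subsetI, rule image_eqI[OF refl], rule image_eqI[OF refl], rule mem)
    then show "countable (realized_type h ?\<Phi> ` W)"
      using realized by (meson countable_image countable_subset)
  next
    fix \<Delta> assume \<Delta>: "\<Delta> \<subseteq> ?\<Phi>" "countable \<Delta>" "fin_sat W h \<Delta>"
    \<comment> \<open>Even variables are solved for while odd ones keep the parameters; the solution
      is truncated afterwards to lie in \<open>W\<close>.\<close>
    have "\<exists>e. range e \<subseteq> univ N \<and> (\<forall>i. i \<notin> {i. even i} \<longrightarrow> e i = e0 i) \<and> (\<forall>\<phi>\<in>?u ` \<Delta>. sat N e \<phi>)"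
      unfolding N_def
    proof (rule U.ultrapower_saturated[OF M])
      show "wf_fm (add_pred L) \<phi>" if "\<phi> \<in> ?u ` \<Delta>" for \<phi> using that \<Delta>(1) wf by blast
      show "countable (?u ` \<Delta>)" using \<Delta>(2) by simp
      show "range e0 \<subseteq> univ (U.ultrapower M)" using re0 \<beta> by (simp add: N_def)
      fix q assume "q \<subseteq> ?u ` \<Delta>" "finite q"
      then obtain r where r: "r \<subseteq> \<Delta>" "finite r" "q = ?u ` r" by (metis finite_subset_image)
      then obtain x where "x \<in> W" "\<forall>\<phi>\<in>r. h x \<phi>" using \<Delta>(3) unfolding fin_sat_def by blast
      then show "\<exists>e. range e \<subseteq> univ (U.ultrapower M) \<and> (\<forall>i. i \<notin> {i. even i} \<longrightarrow> e i = e0 i) \<and>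
          (\<forall>\<phi>\<in>q. sat (U.ultrapower M) e \<phi>)"
        using interN[of x] r(3)
        by (intro exI[of _ "interleave x \<beta>"]) (auto simp: W_def h_def N_def[symmetric] e0_def interleave_def)
    qed
    then obtain e where e: "range e \<subseteq> univ N" "\<And>i. odd i \<Longrightarrow> e i = e0 i" "\<And>\<phi>. \<phi> \<in> \<Delta> \<Longrightarrow> sat N e (?u \<phi>)"
      by auto
    have "e = interleave (\<lambda>i. e (2 * i)) \<beta>"
    proof
      fix i show "e i = interleave (\<lambda>i. e (2 * i)) \<beta> i"
        using e(2)[of i] by (cases "even i") (auto simp: e0_def interleave_def)
    qed
    moreover have "range (\<lambda>i. e (2 * i)) \<subseteq> univ N" using e(1) by auto
    ultimately show "\<exists>x\<in>W. \<forall>\<phi>\<in>\<Delta>. h x \<phi>" using trunc[of "\<lambda>i. e (2 * i)"] e(3) \<Delta>(1) by (metis subsetD)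
  qed
  \<comment> \<open>\<open>M\<close> and its ultrapower finitely satisfy the same sets: one
    direction uses the diagonal embedding, the other a component at a suitable index.\<close>
  moreover have "types (add_pred L) M A n = B.Ty"
    unfolding types_eq_max_types
  proof (rule max_types_cong)
    fix p assume p: "p \<subseteq> ?\<Phi>"
    have "(\<exists>e\<in>{e. range e \<subseteq> univ M}. \<forall>\<phi>\<in>q. sat (expand M) e \<phi>) \<longleftrightarrow> (\<exists>x\<in>W. \<forall>\<phi>\<in>q. h x \<phi>)"
      if q: "q \<subseteq> p" "finite q" for q
    proof
      assume "\<exists>e\<in>{e. range e \<subseteq> univ M}. \<forall>\<phi>\<in>q. sat (expand M) e \<phi>"
      then obtain e where e: "range e \<subseteq> univ M" "\<forall>\<phi>\<in>q. sat (expand M) e \<phi>" by blast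
      let ?x = "\<lambda>i. U.diag M (e i)"
      have r: "range (interleave e b) \<subseteq> univ M" using e(1) bM by (simp add: range_interleave)
      have "interleave ?x \<beta> = (\<lambda>i. U.diag M (interleave e b i))"
        by (auto simp: interleave_def \<beta>_def)
      then have "sat N (interleave ?x \<beta>) (?u \<phi>)" if "\<phi> \<in> q" for \<phi>
        using U.sat_diag[OF M wf r, of \<phi>] satM[of \<phi> e] e(2) that p q(1) by (auto simp: N_def)
      moreover have "range ?x \<subseteq> univ N" using e(1) by (auto simp: N_def image_subset_iff intro!: U.diag)
      ultimately show "\<exists>x\<in>W. \<forall>\<phi>\<in>q. h x \<phi>" using trunc[of ?x] p q(1) by (metis subsetD)
    next
      assume "\<exists>x\<in>W. \<forall>\<phi>\<in>q. h x \<phi>"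
      then obtain x where x: "x \<in> W" "\<forall>\<phi>\<in>q. h x \<phi>" by blast
      have xN: "range x \<subseteq> univ N" using x(1) by (simp add: W_def)
      have "{k. \<forall>\<phi>\<in>q. sat M (\<lambda>i. interleave x \<beta> i k) (?u \<phi>)} \<in> U" (is "?S \<in> U")
      proof (rule U.finite_Ball[OF q(2)])
        fix \<phi> assume "\<phi> \<in> q"
        then show "{k. sat M (\<lambda>i. interleave x \<beta> i k) (?u \<phi>)} \<in> U"
          using U.sat_ultrapower[OF M wf interN[OF xN, unfolded N_def], of \<phi>] x(2) p q(1)
          by (auto simp: h_def N_def)
      qed
      \<comment> \<open>At such an index the representatives of the finitely many parameters
        involved take their true values, so the component is an assignment over \<open>A\<close> in
        \<open>M\<close>.\<close>
      moreover have "{k. \<forall>\<phi>\<in>q. \<forall>i\<in>fv (?u \<phi>). \<beta> (i div 2) k = b (i div 2)} \<in> U" (is "?T \<in> U")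
        using bM unfolding \<beta>_def
        by (intro U.finite_Ball q(2) finite_fv U.diag_eq) (auto simp: image_subset_iff)
      ultimately have "?S \<inter> ?T \<in> U" by (intro U.Int_iff[THEN iffD2] conjI)
      then have "?S \<inter> ?T \<noteq> {}" by (rule contrapos_pn) (simp only: U.Falsum not_False_eq_True)
      then obtain k where "k \<in> ?S \<inter> ?T" unfolding ex_in_conv[symmetric] ..
      then have k: "\<forall>\<phi>\<in>q. sat M (\<lambda>i. interleave x \<beta> i k) (?u \<phi>)"
        "\<forall>\<phi>\<in>q. \<forall>i\<in>fv (?u \<phi>). \<beta> (i div 2) k = b (i div 2)" by simp_all
      have "sat (expand M) (\<lambda>i. x i k) \<phi>" if \<phi>: "\<phi> \<in> q" for \<phi>
      proof -
        have "sat M (interleave (\<lambda>i. x i k) b) (?u \<phi>) \<longleftrightarrow> sat M (\<lambda>i. interleave x \<beta> i k) (?u \<phi>)"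
          by (rule sat_cong) (use k(2) \<phi> in \<open>auto simp: interleave_def\<close>)
        then show ?thesis using satM[of \<phi>] k(1) \<phi> p q(1) by auto
      qed
      moreover have "range (\<lambda>i. x i k) \<subseteq> univ M" using U.ultrapower_component(2)[OF xN[unfolded N_def]] .
      ultimately show "\<exists>e\<in>{e. range e \<subseteq> univ M}. \<forall>\<phi>\<in>q. sat (expand M) e \<phi>" by blast
    qed
    then show "fin_sat {e. range e \<subseteq> univ M} (sat (expand M)) p \<longleftrightarrow> fin_sat W h p"
      unfolding fin_sat_def by blast
  qed
  ultimately show "countable (types (add_pred L) M A n)" by simp
qed

end
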